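(* Let $\{(p_n,\mathcal D_n,L_n)\}_{n\ge1}$ be a sequence of Hadamard triples on $\mathbb R$ (with $p_n>1$ integers, $0\in\mathcal D_n\subset\{0,1,2,\dots\}$ and $\#\mathcal D_n\ge2$) such that $\sup_n\max\{p_n^{-1}d:d\in\mathcal D_n\}<\infty$ and $\sup_n\#\mathcal D_n<\infty$. Then the Cantor-Moran measure $\mu_{\{p_n,\mathcal D_n\}}$ is singularly continuous with respect to Lebesgue measure if and only if $\#\{j:p_j>\#\mathcal D_j\}=\infty$ (equivalently, infinitely many pairs $(p_j,\mathcal D_j)$ satisfy DPC). In particular, every such Cantor-Moran measure that is singularly continuous is a spectral measure.
   Context: A Hadamard triple on $\mathbb R$ is a triple $(p,\mathcal D,L)$ with $p>1$ an integer, $\mathcal D,L\subset\mathbb Z$ finite with $\#\mathcal D=\#L$, such that the matrix $\frac{1}{\sqrt{\#\mathcal D}}\big[e^{2\pi i d\ell/p}\big]_{\ell\in L,d\in\mathcal D}$ is unitary. For finite $A\subset\mathbb R$, $\delta_A=\frac{1}{\#A}\sum_{a\in A}\delta_a$. The Cantor-Moran measure $\mu_{\{p_n,\mathcal D_n\}}=\delta_{p_1^{-1}\mathcal D_1}*\delta_{(p_1p_2)^{-1}\mathcal D_2}*\cdots$ is the weak limit of the finite convolutions $\delta_{p_1^{-1}\mathcal D_1}*\cdots*\delta_{(p_1\cdots p_n)^{-1}\mathcal D_n}$. The Fourier transform is $\widehat\mu(\xi)=\int e^{2\pi i x\xi}d\mu(x)$. For an integer $p>1$ and finite $D\subset\mathbb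 Z$, $T_{p,D}$ is the set of $\xi\in[0,1)$ for which there exist distinct $\ell_1,\ell_2\in\{0,\dots,p-1\}$ with $\widehat{\delta_{p^{-1}D}}(\xi+\ell_i)\ne0$, $i=1,2$; $(p,D)$ satisfies the Double Points Condition (DPC) if $T_{p,D}=[0,1)$. A probability measure $\mu$ is spectral if there is a countable $\Lambda\subset\mathbb R$ with $\{e^{2\pi i\lambda x}\}_{\lambda\in\Lambda}$ an orthogonal basis of $L^2(\mu)$. *)

theory Defs
  imports "HOL-Probability.Probability" "HOL-Probability.Convolution"
begin

definition delta_set :: "real set \<Rightarrow> real measure" where
  "delta_set A = distr (measure_pmf (pmf_of_set A)) borel (\<lambda>x. x)"

definition fourier :: "real measure \<Rightarrow> real \<Rightarrow> complex" where
  "fourier M \<xi> = (CLINT x|M. cis (2 * pi * x * \<xi>))"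

text \<open>Hadamard triple (p, D, L): the normalised matrix [e^(2 pi i d l / p)] (rows l in L,
  columns d in D) is unitary; written out as orthonormality of the rows (square matrix).\<close>
definition hadamard_triple :: "nat \<Rightarrow> int set \<Rightarrow> int set \<Rightarrow> bool" where
  "hadamard_triple p D L \<longleftrightarrow> p > 1 \<and> finite D \<and> finite L \<and> card D = card L \<and>
     (\<forall>l1\<in>L. \<forall>l2\<in>L.
        (\<Sum>d\<in>D. (cis (2 * pi * real_of_int (d * l1) / real p) / complex_of_real (sqrt (card D)))
                 * cnj (cis (2 * pi * real_of_int (d * l2) / real p) / complex_of_real (sqrt (card D))))
        = (if l1 = l2 then 1 else 0))"

definition scaled_digits :: "nat \<Rightarrow> int set \<Rightarrow> real set" where
  "scaled_digits p D = (\<lambda>d. real_of_int d / real p) ` D"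

definition T_set :: "nat \<Rightarrow> int set \<Rightarrow> real set" where
  "T_set p D = {\<xi> \<in> {0..<1}. \<exists>l1 \<in> {0..<p}. \<exists>l2 \<in> {0..<p}. l1 \<noteq> l2 \<and>
      fourier (delta_set (scaled_digits p D)) (\<xi> + real l1) \<noteq> 0 \<and>
      fourier (delta_set (scaled_digits p D)) (\<xi> + real l2) \<noteq> 0}"

definition DPC :: "nat \<Rightarrow> int set \<Rightarrow> bool" where
  "DPC p D \<longleftrightarrow> T_set p D = {0..<1}"

text \<open>Finite convolutions (0-indexed: p 0, D 0 play the role of p_1, D_1):
  moran_partial p D n = delta_{p_1^{-1} D_1} * ... * delta_{(p_1...p_n)^{-1} D_n}.\<close>
fun moran_partial :: "(nat \<Rightarrow> nat) \<Rightarrow> (nat \<Rightarrow> int set) \<Rightarrow> nat \<Rightarrow> real measure" where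
  "moran_partial p D 0 = return borel 0"
| "moran_partial p D (Suc n) =
     convolution (moran_partial p D n) (delta_set ((\<lambda>d. real_of_int d / (\<Prod>k\<le>n. real (p k))) ` D n))"

definition singularly_continuous :: "real measure \<Rightarrow> bool" where
  "singularly_continuous M \<longleftrightarrow>
     (\<forall>x. emeasure M {x} = 0) \<and>
     (\<exists>A \<in> sets borel. emeasure lborel A = 0 \<and> emeasure M (space M - A) = 0)"

definition square_integrable :: "real measure \<Rightarrow> (real \<Rightarrow> complex) \<Rightarrow> bool" where
  "square_integrable M f \<longleftrightarrow> f \<in> borel_measurable M \<and> integrable M (\<lambda>x. (cmod (f x))\<^sup>2)"

definition spectral :: "real measure \<Rightarrow> bool" where
  "spectral M \<longleftrightarrow> (\<exists>Lam :: real set. countable Lam \<and>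
     (\<forall>a\<in>Lam. \<forall>b\<in>Lam. a \<noteq> b \<longrightarrow>
        (CLINT x|M. cis (2 * pi * a * x) * cnj (cis (2 * pi * b * x))) = 0) \<and>
     (\<forall>f. square_integrable M f \<longrightarrow>
        (\<forall>c\<in>Lam. (CLINT x|M. f x * cnj (cis (2 * pi * c * x))) = 0) \<longrightarrow>
        (AE x in M. f x = 0)))"

end

(* For the spectral property, call x in [0,1) bad at level n if no finite spectrum T of the discrete
   measure of levels n, ..., m - 1 captures a fixed fraction of e_x in L^2 of the tail nu_n, that is, if
   sum_{t in T} |nu_n^(x + t)|^2 < eps for all T. A bad point has children (x + l) / p_n, and since the
   weights |mask((x + l) / p_n)|^2 over a Hadamard partner L sum to 1, at least one child is as bad as x.
   When p_n > #D_n the weights over all residues sum to p_n / #D_n > 1, which forces a second child of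
   controlled badness; when the badness passes to a child of weight near 1, all d * child are nearly
   integers, and this keeps distinct bad points apart. So infinitely many levels with p_n > #D_n would
   produce arbitrarily many separated common near-zeros of some nu_m^ in [0,1], whereas interpolation at 0
   (nu_m^(0) = 1, supports uniformly bounded) bounds their number. Hence no point is eps-bad, uniformly in
   n, and a spectrum is built greedily, each step recovering the fraction eps of the missing mass of
   one rational frequency. No weak limits of tails are used, so p_n may be unbounded and the
   levels with p_n > #D_n may be arbitrarily sparse.

   For the measure type, mu is covered at level n by prod #D_k intervals of length 2C / (p_1...p_n). *)
theory Submission
  imports Defs "HOL-Computational_Algebra.Polynomial"
begin

section \<open>Exponentials and Hadamard triples\<close>

text \<open>The order of two choices shapes the argument. The support bound alone fixes the number k
  of near-zeros that is too many; only afterwards is a separation s chosen, and it affects nothing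
  but the threshold \<delta>. Hence k - 1 branchings suffice, each costing a fixed factor in badness
  and in separation. Between branchings nothing may be lost, since the wait is unbounded: passing to
  children can shrink distances by the factor p_n, and only the near-integrality of d * child rules
  this out. That p_n is bounded at bad points follows from the same count, because a large p_n
  yields k separated heavy children at once. Badness refers to all spectra of a block, not just to
  those built from the given partners: translates are spectra too, and different branches may be
  prolonged by different sets. This is what admits an arbitrary residue as a second child and lets
  the greedy construction choose separately for each frequency. Tails never occur as measures; only
  their transforms \<open>N n\<close> do, controlled by inequalities that survive products and
  limits.\<close>

definition echar :: "real \<Rightarrow> complex" where
  "echar x = cis (2 * pi * x)"

lemma echar_0 [simp]: "echar 0 = 1"
  by (simp add: echar_def)

lemma echar_add: "echar (x + y) = echar x * echar y"
  by (simp add: echar_def cis_mult algebra_simps)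

lemma norm_echar [simp]: "cmod (echar x) = 1"
  by (simp add: echar_def)

lemma cnj_echar: "cnj (echar x) = echar (- x)"
  by (simp add: echar_def cis_cnj)

lemma echar_nonzero [simp]: "echar x \<noteq> 0"
  by (simp add: echar_def)

lemma echar_mult_minus [simp]: "echar x * echar (- x) = 1"
  by (simp flip: echar_add)

lemma echar_of_int [simp]: "echar (of_int k) = 1"
  by (simp add: echar_def cis_multiple_2pi)

lemma echar_add_int: "echar (x + of_int k) = echar x"
  by (simp add: echar_add)

lemma echar_power: "echar x ^ n = echar (of_nat n * x)"
  by (induction n) (auto simp: echar_add algebra_simps)

lemma echar_eq_1_iff: "echar x = 1 \<longleftrightarrow> x \<in> \<int>"
proof
  assume "echar x = 1"
  then have "cos (2 * pi * x) = 1"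
    by (simp add: echar_def complex_eq_iff)
  then obtain n :: int where "2 * pi * x = of_int n * 2 * pi"
    by (auto simp: cos_one_2pi_int)
  then have "x = of_int n" by simp
  then show "x \<in> \<int>" by simp
qed (auto elim!: Ints_cases)

lemma norm_echar_diff: "cmod (echar x - 1) = 2 * \<bar>sin (pi * x)\<bar>"
proof -
  have "(cmod (echar x - 1))\<^sup>2 = (2 * \<bar>sin (pi * x)\<bar>)\<^sup>2"
    using cos_double_sin[of "pi * x"] sin_cos_squared_add[of "2 * pi * x"]
    unfolding cmod_power2 by (simp add: echar_def power2_eq_square algebra_simps)
  then show ?thesis
    by (subst (asm) power2_eq_iff_nonneg) auto
qed

lemma norm_echar_diff_le: "cmod (echar x - 1) \<le> 2 * pi * \<bar>x\<bar>"
  using abs_sin_x_le_abs_x[of "pi * x"] by (simp add: norm_echar_diff abs_mult)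

lemma norm_echar_parallelogram: "(cmod (1 + echar x))\<^sup>2 + (cmod (echar x - 1))\<^sup>2 = 4"
  using sin_cos_squared_add[of "2 * pi * x"]
  unfolding cmod_power2 by (simp add: echar_def power2_eq_square algebra_simps)

text \<open>Jordan's inequality: the concave sine lies above its chord over [0, pi/2].\<close>

lemma norm_echar_diff_ge:
  assumes "\<bar>x\<bar> \<le> 1/2"
  shows "4 * \<bar>x\<bar> \<le> cmod (echar x - 1)"
proof -
  have "concave_on {0..pi/2} sin"
    by (rule f''_le0_imp_concave[where f' = cos and f'' = "\<lambda>x. - sin x"])
       (auto intro!: derivative_eq_intros sin_ge_zero)
  from concave_onD[OF this, of "2 * \<bar>x\<bar>" 0 "pi/2"] assms
  have "2 * \<bar>x\<bar> \<le> sin (pi * \<bar>x\<bar>)" by (simp add: mult.commute)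
  also have "\<dots> \<le> \<bar>sin (pi * x)\<bar>"
    by (cases "x \<ge> 0") auto
  finally show ?thesis by (simp add: norm_echar_diff)
qed

text \<open>Orthogonality of the characters of Z/p. If p does not divide a, this is a geometric sum
  over a p-th root of unity other than 1.\<close>

lemma sum_echar_residues:
  assumes "p > 0"
  shows "(\<Sum>l<p. echar (real_of_int a * real l / real p)) = (if int p dvd a then of_nat p else 0)"
proof (cases "int p dvd a")
  case True
  then obtain k where k: "a = int p * k" ..
  have "echar (real_of_int a * real l / real p) = 1" for l
    using echar_of_int[of "k * int l"] assms by (simp add: k)
  then show ?thesis using True by simp
next
  case False
  define z where "z = echar (real_of_int a / real p)"
  have "z \<noteq> 1"
  proof
    assume "z = 1"
    then obtain k where "real_of_int a / real p = of_int k"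
      unfolding z_def echar_eq_1_iff by (auto elim: Ints_cases)
    then have "real_of_int a = real_of_int (int p * k)"
      using assms by (simp add: field_simps)
    then have "a = int p * k" by linarith
    then show False using False by simp
  qed
  have "z ^ p = 1"
    using assms by (simp add: z_def echar_power)
  have "(\<Sum>l<p. echar (real_of_int a * real l / real p)) = (\<Sum>l<p. z ^ l)"
    by (simp add: z_def echar_power mult.commute)
  also have "\<dots> = 0"
    using \<open>z \<noteq> 1\<close> \<open>z ^ p = 1\<close> by (simp add: geometric_sum)
  finally show ?thesis using False by simp
qed

text \<open>The Fourier transform of the uniform measure on D; for digits divided by p it is
  evaluated at \<xi> / p.\<close>

definition digit_mask :: "int set \<Rightarrow> real \<Rightarrow> complex" where
  "digit_mask D y = (\<Sum>d\<in>D. echar (real_of_int d * y)) / of_nat (card D)"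

lemma digit_mask_0 [simp]: "finite D \<Longrightarrow> D \<noteq> {} \<Longrightarrow> digit_mask D 0 = 1"
  by (simp add: digit_mask_def)

lemma digit_mask_add_int: "digit_mask D (y + of_int k) = digit_mask D y"
proof -
  have "echar (real_of_int d * (y + of_int k)) = echar (real_of_int d * y)" for d
    using echar_add_int[of "real_of_int d * y" "d * k"] by (simp add: algebra_simps)
  then show ?thesis by (simp add: digit_mask_def)
qed

lemma norm_mask_le: "cmod (digit_mask D y) \<le> 1"
proof (cases "card D = 0")
  case False
  have "cmod (\<Sum>d\<in>D. echar (real_of_int d * y)) \<le> (\<Sum>d\<in>D. 1)"
    by (rule sum_norm_le) auto
  then show ?thesis using False by (simp add: digit_mask_def norm_divide)
qed (simp add: digit_mask_def)

lemma norm_mask_diff_le: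
  assumes "finite D" "D \<noteq> {}" and "\<And>d. d \<in> D \<Longrightarrow> \<bar>real_of_int d\<bar> \<le> B"
  shows "cmod (digit_mask D y - 1) \<le> 2 * pi * B * \<bar>y\<bar>"
proof -
  have c: "card D > 0" using assms by (simp add: card_gt_0_iff)
  have "digit_mask D y - 1 = (\<Sum>d\<in>D. echar (real_of_int d * y) - 1) / of_nat (card D)"
    using c by (simp add: digit_mask_def sum_subtractf field_simps)
  moreover have "cmod (\<Sum>d\<in>D. echar (real_of_int d * y) - 1) \<le> (\<Sum>d\<in>D. 2 * pi * B * \<bar>y\<bar>)"
  proof (rule sum_norm_le)
    fix d assume "d \<in> D"
    have "cmod (echar (real_of_int d * y) - 1) \<le> 2 * pi * (\<bar>real_of_int d\<bar> * \<bar>y\<bar>)"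
      using norm_echar_diff_le[of "real_of_int d * y"] by (simp add: abs_mult)
    also have "\<dots> \<le> 2 * pi * (B * \<bar>y\<bar>)"
      using assms(3)[OF \<open>d \<in> D\<close>] by (intro mult_left_mono mult_right_mono) auto
    finally show "cmod (echar (real_of_int d * y) - 1) \<le> 2 * pi * B * \<bar>y\<bar>" by simp
  qed
  ultimately have "cmod (digit_mask D y - 1) \<le> (\<Sum>d\<in>D. 2 * pi * B * \<bar>y\<bar>) / card D"
    by (simp only: norm_divide norm_of_nat divide_right_mono of_nat_0_le_iff)
  then show ?thesis using c by simp
qed

lemma norm_mask_squared:
  "complex_of_real ((cmod (digit_mask D y))\<^sup>2) =
     (\<Sum>d\<in>D. \<Sum>d'\<in>D. echar (real_of_int (d - d') * y)) / (of_nat (card D))\<^sup>2"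
proof -
  have "complex_of_real ((cmod (digit_mask D y))\<^sup>2) = digit_mask D y * cnj (digit_mask D y)"
    by (simp only: complex_norm_square)
  also have "\<dots> = (\<Sum>d\<in>D. \<Sum>d'\<in>D. echar (real_of_int d * y) * cnj (echar (real_of_int d' * y)))
                   / (of_nat (card D))\<^sup>2"
    by (simp add: digit_mask_def sum_product power2_eq_square)
  also have "(\<lambda>d d'. echar (real_of_int d * y) * cnj (echar (real_of_int d' * y)))
      = (\<lambda>d d'. echar (real_of_int (d - d') * y))"
    by (auto simp: fun_eq_iff cnj_echar algebra_simps simp flip: echar_add)
  finally show ?thesis .
qed

text \<open>One expansion for two uses: L a Hadamard partner, or L a complete residue system. In
  both, the inner character sum vanishes unless d = d'.\<close>

lemma sum_norm_mask_squared:
  "complex_of_real (\<Sum>l\<in>L. (cmod (digit_mask D ((x + f l) / q)))\<^sup>2) =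
     (\<Sum>d\<in>D. \<Sum>d'\<in>D. echar (real_of_int (d - d') * x / q) *
        (\<Sum>l\<in>L. echar (real_of_int (d - d') * f l / q))) / (of_nat (card D))\<^sup>2"
proof -
  have "complex_of_real (\<Sum>l\<in>L. (cmod (digit_mask D ((x + f l) / q)))\<^sup>2) =
     (\<Sum>l\<in>L. \<Sum>d\<in>D. \<Sum>d'\<in>D. echar (real_of_int (d - d') * ((x + f l) / q))) / (of_nat (card D))\<^sup>2"
    by (simp only: of_real_sum norm_mask_squared sum_divide_distrib)
  also have "(\<Sum>l\<in>L. \<Sum>d\<in>D. \<Sum>d'\<in>D. echar (real_of_int (d - d') * ((x + f l) / q))) =
     (\<Sum>d\<in>D. \<Sum>d'\<in>D. \<Sum>l\<in>L. echar (real_of_int (d - d') * ((x + f l) / q)))"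
    by (subst sum.swap, rule sum.cong[OF refl], subst sum.swap, rule refl)
  also have "\<dots> = (\<Sum>d\<in>D. \<Sum>d'\<in>D. echar (real_of_int (d - d') * x / q) *
        (\<Sum>l\<in>L. echar (real_of_int (d - d') * f l / q)))"
  proof -
    have "echar (a * ((x + f l) / q)) = echar (a * x / q) * echar (a * f l / q)" for a l
      by (simp add: distrib_left add_divide_distrib flip: echar_add)
    then show ?thesis by (simp only: sum_distrib_left)
  qed
  finally show ?thesis .
qed

text \<open>With rows orthonormal, \<open>B = A\<^sup>* A\<close> is a projection of trace \<open>card D\<close>. Its diagonal entries are
  \<open>1\<close>, because all entries of \<open>A\<close> have the same modulus, and they exhaust its Frobenius norm.\<close>
lemma hadamard_columns:
  assumes H: "hadamard_triple p D L" and "d \<in> D" "d' \<in> D" "d \<noteq> d'"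
  shows "(\<Sum>l\<in>L. echar (real_of_int (d - d') * real_of_int l / real p)) = 0"
proof -
  define q where "q = card D"
  have fin: "finite D" "finite L" and card: "card L = q" "q > 0"
    using H \<open>d \<in> D\<close> by (auto simp: hadamard_triple_def q_def card_gt_0_iff)
  have row: "(\<Sum>d\<in>D. echar (real_of_int d * (real_of_int (l1 - l2) / real p))) =
      (if l1 = l2 then of_nat q else 0)" if "l1 \<in> L" "l2 \<in> L" for l1 l2
  proof -
    have "(\<Sum>d\<in>D. (cis (2 * pi * real_of_int (d * l1) / real p) / complex_of_real (sqrt (card D)))
              * cnj (cis (2 * pi * real_of_int (d * l2) / real p) / complex_of_real (sqrt (card D))))
        = (\<Sum>d\<in>D. echar (real_of_int d * (real_of_int (l1 - l2) / real p)) / of_nat q)"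
    proof (rule sum.cong[OF refl])
      fix d
      have "cis (2 * pi * real_of_int (d * l1) / real p) * cnj (cis (2 * pi * real_of_int (d * l2) / real p))
          = echar (real_of_int d * (real_of_int (l1 - l2) / real p))"
        by (simp add: echar_def cis_cnj cis_mult algebra_simps diff_divide_distrib)
      moreover have "complex_of_real (sqrt (real q)) * complex_of_real (sqrt (real q)) = of_nat q"
        by (simp flip: of_real_mult)
      ultimately show "cis (2 * pi * real_of_int (d * l1) / real p) / complex_of_real (sqrt (card D))
              * cnj (cis (2 * pi * real_of_int (d * l2) / real p) / complex_of_real (sqrt (card D)))
            = echar (real_of_int d * (real_of_int (l1 - l2) / real p)) / of_nat q"
        by (simp add: q_def)
    qed
    then show ?thesis
      using H that card unfolding hadamard_triple_def by (auto simp flip: sum_divide_distrib)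
  qed
  \<comment> \<open>Unnormalised: \<open>b\<close> is q times the projection up to conjugation, so
    its diagonal entries are q and its squared Frobenius norm is q^3.\<close>
  define b where "b d d' = (\<Sum>l\<in>L. echar (real_of_int (d - d') * real_of_int l / real p))" for d d'
  have "complex_of_real (\<Sum>d\<in>D. \<Sum>d'\<in>D. (cmod (b d d'))\<^sup>2) =
      (\<Sum>d\<in>D. \<Sum>d'\<in>D. \<Sum>l1\<in>L. \<Sum>l2\<in>L. echar (real_of_int d * (real_of_int (l1 - l2) / real p))
         * cnj (echar (real_of_int d' * (real_of_int (l1 - l2) / real p))))"
    unfolding of_real_sum
  proof (intro sum.cong refl)
    fix d d'
    have "complex_of_real ((cmod (b d d'))\<^sup>2) = b d d' * cnj (b d d')"
      by (simp only: complex_norm_square)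
    also have "\<dots> = (\<Sum>l1\<in>L. \<Sum>l2\<in>L. echar (real_of_int d * (real_of_int (l1 - l2) / real p))
         * cnj (echar (real_of_int d' * (real_of_int (l1 - l2) / real p))))"
      unfolding b_def cnj_sum sum_product
      by (intro sum.cong refl)
         (simp add: cnj_echar algebra_simps diff_divide_distrib add_divide_distrib flip: echar_add)
    finally show "complex_of_real ((cmod (b d d'))\<^sup>2) = \<dots>" .
  qed
  also have "\<dots> = (\<Sum>d\<in>D. \<Sum>l1\<in>L. \<Sum>l2\<in>L. \<Sum>d'\<in>D. echar (real_of_int d * (real_of_int (l1 - l2) / real p))
         * cnj (echar (real_of_int d' * (real_of_int (l1 - l2) / real p))))"
    by (rule sum.cong[OF refl], subst sum.swap, rule sum.cong[OF refl], rule sum.swap)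
  also have "\<dots> = (\<Sum>l1\<in>L. \<Sum>l2\<in>L. \<Sum>d\<in>D. \<Sum>d'\<in>D. echar (real_of_int d * (real_of_int (l1 - l2) / real p))
         * cnj (echar (real_of_int d' * (real_of_int (l1 - l2) / real p))))"
    by (subst sum.swap, rule sum.cong[OF refl], rule sum.swap)
  also have "\<dots> = (\<Sum>l1\<in>L. \<Sum>l2\<in>L. if l1 = l2 then of_nat q * of_nat q else 0)"
    by (intro sum.cong refl, unfold sum_product[symmetric] cnj_sum[symmetric], subst (1 2) row) auto
  also have "\<dots> = of_nat (q * q * q)"
    using fin card by (simp add: sum.delta)
  finally have frob: "(\<Sum>d\<in>D. \<Sum>d'\<in>D. (cmod (b d d'))\<^sup>2) = real (q * q * q)"
    by (metis of_real_eq_iff of_real_of_nat_eq)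
  have diag: "(cmod (b d d))\<^sup>2 = real (q * q)" for d
    by (simp add: b_def card power2_eq_square)
  have split: "(\<Sum>d'\<in>D. (cmod (b d d'))\<^sup>2) = real (q * q) + (\<Sum>d'\<in>D - {d}. (cmod (b d d'))\<^sup>2)"
    if "d \<in> D" for d
    using fin that by (simp add: sum.remove diag)
  have "(\<Sum>d\<in>D. \<Sum>d'\<in>D - {d}. (cmod (b d d'))\<^sup>2) = 0"
    using frob by (simp add: split sum.distrib q_def[symmetric])
  then have "(\<Sum>d'\<in>D - {d}. (cmod (b d d'))\<^sup>2) = 0"
    using fin assms(2) by (simp add: sum_nonneg_eq_0_iff sum_nonneg)
  then have "(cmod (b d d'))\<^sup>2 = 0"
    using fin assms(3,4) by (simp add: sum_nonneg_eq_0_iff)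
  then show ?thesis by (simp add: b_def)
qed

text \<open>Parseval for the exponential at x over the spectrum L: column orthogonality leaves only
  the diagonal, which contributes q * card L / q^2 = 1 with q = card D.\<close>

lemma hadamard_sum_mask:
  assumes H: "hadamard_triple p D L" and "D \<noteq> {}"
  shows "(\<Sum>l\<in>L. (cmod (digit_mask D ((x + real_of_int l) / real p)))\<^sup>2) = 1"
proof -
  have fin: "finite D" and card: "card L = card D" "card D > 0"
    using H assms(2) by (auto simp: hadamard_triple_def card_gt_0_iff)
  have "(\<Sum>d'\<in>D. echar (real_of_int (d - d') * x / real p) *
        (\<Sum>l\<in>L. echar (real_of_int (d - d') * real_of_int l / real p))) = of_nat (card D)"
    if "d \<in> D" for d
  proof -
    have "(\<Sum>d'\<in>D. echar (real_of_int (d - d') * x / real p) *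
        (\<Sum>l\<in>L. echar (real_of_int (d - d') * real_of_int l / real p))) =
        (\<Sum>d'\<in>D. if d' = d then of_nat (card D) else 0)"
      using hadamard_columns[OF H that] card by (intro sum.cong refl) auto
    then show ?thesis using fin that by simp
  qed
  then have "complex_of_real (\<Sum>l\<in>L. (cmod (digit_mask D ((x + real_of_int l) / real p)))\<^sup>2) = 1"
    unfolding sum_norm_mask_squared using card by (simp add: power2_eq_square)
  then show ?thesis by (simp only: of_real_eq_1_iff)
qed

text \<open>Congruent digits have equal columns, and equal columns are not orthogonal.\<close>

lemma hadamard_inj_mod:
  assumes H: "hadamard_triple p D L" and "d \<in> D" "d' \<in> D" "int p dvd d - d'"
  shows "d = d'"
proof (rule ccontr)
  assume "d \<noteq> d'"
  obtain k where k: "d - d' = int p * k" using assms(4) ..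
  have p: "p > 0" and card: "card L > 0"
    using H \<open>d \<in> D\<close> by (auto simp: hadamard_triple_def card_gt_0_iff)
  have "echar (real_of_int (d - d') * real_of_int l / real p) = 1" for l
    using p echar_of_int[of "k * l"] by (simp add: k)
  then show False
    using hadamard_columns[OF H assms(2,3) \<open>d \<noteq> d'\<close>] card by simp
qed

lemma hadamard_card_le:
  assumes H: "hadamard_triple p D L"
  shows "card D \<le> p"
proof -
  have p: "p > 0" using H by (simp add: hadamard_triple_def)
  have "inj_on (\<lambda>d. d mod int p) D"
    by (intro inj_onI hadamard_inj_mod[OF H]) (auto simp: mod_eq_dvd_iff)
  moreover have "(\<lambda>d. d mod int p) ` D \<subseteq> {0..<int p}" using p by auto
  ultimately have "card D \<le> card {0..<int p}"
    by (intro card_inj_on_le) auto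
  then show ?thesis by simp
qed

text \<open>The total exceeds 1 exactly if p > card D, while no term exceeds 1. Both the second bad
  child and the Double Points Condition come from this surplus.\<close>

lemma hadamard_sum_residues:
  assumes H: "hadamard_triple p D L" and "D \<noteq> {}"
  shows "(\<Sum>l<p. (cmod (digit_mask D ((x + real l) / real p)))\<^sup>2) = real p / real (card D)"
proof -
  have fin: "finite D" and p: "p > 0" and card: "card D > 0"
    using H assms(2) by (auto simp: hadamard_triple_def card_gt_0_iff)
  have "(\<Sum>d'\<in>D. echar (real_of_int (d - d') * x / real p) *
        (\<Sum>l<p. echar (real_of_int (d - d') * real l / real p))) = of_nat p"
    if "d \<in> D" for d
  proof -
    have "(\<Sum>d'\<in>D. echar (real_of_int (d - d') * x / real p) *
        (\<Sum>l<p. echar (real_of_int (d - d') * real l / real p))) =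
        (\<Sum>d'\<in>D. if d' = d then of_nat p else 0)"
      using hadamard_inj_mod[OF H that] unfolding sum_echar_residues[OF p]
      by (intro sum.cong refl) auto
    then show ?thesis using fin that by simp
  qed
  then have "complex_of_real (\<Sum>l<p. (cmod (digit_mask D ((x + real l) / real p)))\<^sup>2) =
      complex_of_real (real p / real (card D))"
    unfolding sum_norm_mask_squared using card by (simp add: power2_eq_square)
  then show ?thesis by (simp only: of_real_eq_iff)
qed

section \<open>A quantitative bound on the zeros of Fourier transforms\<close>

text \<open>The clause \<open>x < Max S\<close> serves the induction on the largest point: it keeps
  the zero found between the old maximum and the new point distinct from the earlier ones.\<close>

lemma Rolle_finite_zeros:
  fixes f f' :: "real \<Rightarrow> real"
  assumes der: "\<And>x. (f has_real_derivative f' x) (at x)"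
    and "finite S" "S \<noteq> {}" "\<And>x. x \<in> S \<Longrightarrow> f x = 0"
  shows "\<exists>S'. finite S' \<and> card S = Suc (card S') \<and> (\<forall>x\<in>S'. f' x = 0 \<and> x < Max S)"
  using assms(2-)
proof (induction S rule: finite_linorder_max_induct)
  case (insert b A)
  show ?case
  proof (cases "A = {}")
    case True
    then show ?thesis by (intro exI[of _ "{}"]) auto
  next
    case False
    with insert obtain S' where S': "finite S'" "card A = Suc (card S')"
      "\<And>x. x \<in> S' \<Longrightarrow> f' x = 0 \<and> x < Max A" by auto
    have m: "Max A \<in> A" "Max A < b" using False insert by auto
    obtain z where z: "Max A < z" "z < b" "f' z = 0"
    proof (rule Rolle_deriv[OF m(2), of f "\<lambda>x h. f' x * h", THEN exE])
      show "f (Max A) = f b" using insert(5) m by auto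
      show "continuous_on {Max A..b} f"
        using der by (meson DERIV_isCont continuous_at_imp_continuous_on)
      show "(f has_derivative (\<lambda>h. f' x * h)) (at x)" for x
        using der[of x] by (simp add: has_field_derivative_def)
    next
      fix z assume "Max A < z \<and> z < b \<and> (\<lambda>h. f' z * h) = (\<lambda>v. 0)"
      then show thesis using that[of z] by (metis mult.right_neutral)
    qed
    have "Max (insert b A) = b"
      using insert(1,2) by (intro Max_eqI) (auto intro: less_imp_le)
    moreover have "b \<notin> A" "z \<notin> S'" using insert(2) S'(3) z by force+
    ultimately show ?thesis
      using S' z m insert(1) by (intro exI[of _ "insert z S'"]) force
  qed
qed auto

lemma Rolle_iterated:
  fixes h :: "nat \<Rightarrow> real \<Rightarrow> real"
  assumes "\<And>k x. (h k has_real_derivative h (Suc k) x) (at x)"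
    and "finite S" "card S = Suc n" "\<And>x. x \<in> S \<Longrightarrow> h 0 x = 0"
  shows "\<exists>x. h n x = 0"
proof -
  have "\<exists>S. finite S \<and> card S = Suc n - k \<and> (\<forall>x\<in>S. h k x = 0)" if "k \<le> n" for k
    using that
  proof (induction k)
    case 0
    then show ?case using assms by auto
  next
    case (Suc k)
    then obtain S where S: "finite S" "card S = Suc n - k" "\<forall>x\<in>S. h k x = 0" by auto
    then have "S \<noteq> {}" using Suc.prems by auto
    then show ?case
      using Rolle_finite_zeros[of "h k" "h (Suc k)" S] assms(1) S Suc.prems by auto
  qed
  from this[of n] obtain S where "finite S" "card S = 1" "\<forall>x\<in>S. h n x = 0" by auto
  then show ?thesis by (auto simp: card_1_singleton_iff)
qed

section \<open>Lagrange interpolation and its remainder\<close>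

definition lagrange :: "real set \<Rightarrow> real \<Rightarrow> real \<Rightarrow> real" where
  "lagrange X x t = (\<Prod>y\<in>X - {x}. (t - y) / (x - y))"

definition lagrange_poly :: "real set \<Rightarrow> real \<Rightarrow> real poly" where
  "lagrange_poly X x = (\<Prod>y\<in>X - {x}. smult (1 / (x - y)) [:- y, 1:])"

lemma poly_lagrange: "poly (lagrange_poly X x) t = lagrange X x t"
  by (simp add: lagrange_poly_def lagrange_def poly_prod diff_divide_distrib)

lemma lagrange_node:
  assumes "finite X" "x \<in> X" "y \<in> X"
  shows "lagrange X x y = (if x = y then 1 else 0)"
proof (cases "x = y")
  case True
  have "(\<Prod>y\<in>X - {x}. (x - y) / (x - y)) = 1"
    by (intro prod.neutral) auto
  with True show ?thesis by (simp add: lagrange_def)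
next
  case False
  then show ?thesis using assms by (auto simp: lagrange_def)
qed

lemma degree_lagrange_poly:
  assumes "finite X" "x \<in> X"
  shows "degree (lagrange_poly X x) < card X"
proof -
  have "degree (lagrange_poly X x) \<le> (\<Sum>y\<in>X - {x}. degree (smult (1 / (x - y)) [:- y, 1:]))"
    unfolding lagrange_poly_def by (rule degree_prod_sum_le[unfolded o_def]) (use assms in auto)
  also have "\<dots> \<le> (\<Sum>y\<in>X - {x}. 1)"
    by (intro sum_mono) simp
  also have "\<dots> < card X"
    using assms card_gt_0_iff[of X] by auto
  finally show ?thesis .
qed

text \<open>Applied twice below: the monic node polynomial has n-th derivative n!, and the
  interpolant, of smaller degree, has n-th derivative 0.\<close>

lemma higher_pderiv_degree_le:
  fixes r :: "real poly"
  assumes "degree r \<le> n"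
  shows "(pderiv ^^ n) r = [:fact n * coeff r n:]"
proof (rule poly_eqI)
  fix i
  show "coeff ((pderiv ^^ n) r) i = coeff [:fact n * coeff r n:] i"
  proof (cases i)
    case 0
    then show ?thesis by (simp add: coeff_higher_pderiv pochhammer_fact)
  next
    case (Suc j)
    then have "coeff r (i + n) = 0" using assms by (intro coeff_eq_0) auto
    then show ?thesis using Suc by (simp add: coeff_higher_pderiv)
  qed
qed

text \<open>The classical remainder: g minus its interpolant minus a multiple of the node polynomial
  vanishes at n + 1 points, so by Rolle its n-th derivative has a zero. For nodes in [0, 1] the node
  polynomial has modulus at most 1 at 0.\<close>

lemma lagrange_error:
  fixes g :: "nat \<Rightarrow> real \<Rightarrow> real"
  assumes der: "\<And>k x. (g k has_real_derivative g (Suc k) x) (at x)"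
    and X: "finite X" "card X = n" "X \<subseteq> {0..1}" "0 \<notin> X"
    and bound: "\<And>x. \<bar>g n x\<bar> \<le> B"
  shows "\<bar>g 0 0 - (\<Sum>x\<in>X. lagrange X x 0 * g 0 x)\<bar> \<le> B / fact n"
proof -
  define r where "r = (\<Sum>x\<in>X. smult (g 0 x) (lagrange_poly X x))"
  define w where "w = (\<Prod>x\<in>X. [:- x, 1:])"
  \<comment> \<open>Chosen so that \<open>h 0\<close> vanishes at 0 as well as at the nodes.\<close>
  define \<kappa> where "\<kappa> = (g 0 0 - poly r 0) / poly w 0"
  define h where "h k x = g k x - poly ((pderiv ^^ k) r) x - \<kappa> * poly ((pderiv ^^ k) w) x" for k x
  have w: "degree w = n" "coeff w n = 1"
    using X degree_prod_eq_sum_degree[of X "\<lambda>x. [:- x, 1:]"]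
      lead_coeff_prod[of "\<lambda>x. [:- x, 1:]" X] by (auto simp: w_def)
  have w0: "poly w 0 \<noteq> 0" "\<bar>poly w 0\<bar> \<le> 1"
    using X by (auto simp: w_def poly_prod abs_prod intro!: prod_le_1)
  have r_node: "poly r x = g 0 x" if "x \<in> X" for x
    using that X by (simp add: r_def poly_sum poly_lagrange lagrange_node if_distrib cong: if_cong)
  have r_deg: "n > 0 \<longrightarrow> degree r < n"
  proof
    assume "n > 0"
    have "degree r \<le> n - 1"
      unfolding r_def using X \<open>n > 0\<close>
      by (intro degree_sum_le) (auto intro!: order.trans[OF degree_smult_le] dest!: degree_lagrange_poly)
    then show "degree r < n" using \<open>n > 0\<close> by simp
  qed
  have r_n: "(pderiv ^^ n) r = 0"
  proof (cases "n = 0")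
    case True
    then show ?thesis using X by (simp add: r_def)
  next
    case False
    then show ?thesis using r_deg by (simp add: higher_pderiv_degree_le coeff_eq_0)
  qed
  have "(h k has_real_derivative h (Suc k) x) (at x)" for k x
    unfolding h_def by (auto intro!: derivative_eq_intros der)
  moreover have "h 0 x = 0" if "x \<in> insert 0 X" for x
  proof (cases "x = 0")
    case True
    then show ?thesis using w0 by (simp add: h_def \<kappa>_def)
  next
    case False
    then have "x \<in> X" using that by simp
    then have "poly w x = 0" using X by (auto simp: w_def poly_prod)
    then show ?thesis by (simp add: h_def r_node \<open>x \<in> X\<close>)
  qed
  moreover have "finite (insert 0 X)" "card (insert 0 X) = Suc n" using X by auto
  ultimately obtain z where "h n z = 0" using Rolle_iterated[of h] by blast
  then have "g n z = \<kappa> * fact n"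
    using w by (simp add: h_def r_n higher_pderiv_degree_le)
  then have \<kappa>: "\<bar>\<kappa>\<bar> \<le> B / fact n"
    using bound[of z] by (simp add: abs_mult field_simps)
  have "\<bar>g 0 0 - poly r 0\<bar> = \<bar>\<kappa>\<bar> * \<bar>poly w 0\<bar>"
    using w0 by (simp add: \<kappa>_def abs_divide)
  also have "\<dots> \<le> \<bar>\<kappa>\<bar> * 1" using w0 by (intro mult_left_mono) auto
  also have "\<dots> \<le> B / fact n" using \<kappa> by simp
  finally show ?thesis
    by (simp add: r_def poly_sum poly_lagrange mult.commute)
qed

text \<open>The factor 2 adds the errors of the real and the imaginary part.\<close>

lemma lagrange_error_echar:
  assumes X: "finite X" "card X = n" "X \<subseteq> {0..1}" "0 \<notin> X" and "0 \<le> a" "a \<le> R"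
  shows "cmod (1 - (\<Sum>x\<in>X. complex_of_real (lagrange X x 0) * echar (a * x))) \<le> 2 * (2 * pi * R) ^ n / fact n"
proof -
  \<comment> \<open>One family covers both parts: the phase c = 0 gives the cosine, c = - pi / 2 the
    sine, and each derivative adds a quarter turn.\<close>
  define g where "g c k x = (2 * pi * a) ^ k * cos (2 * pi * a * x + c + real k * (pi / 2))" for c k x
  have pw: "(2 * pi * a) ^ n \<le> (2 * pi * R) ^ n" using assms by (intro power_mono) auto
  have "\<bar>g c 0 0 - (\<Sum>x\<in>X. lagrange X x 0 * g c 0 x)\<bar> \<le> (2 * pi * R) ^ n / fact n" for c
  proof (rule lagrange_error[OF _ X])
    show "(g c k has_real_derivative g c (Suc k) x) (at x)" for k x
    proof -
      have "cos (2 * pi * a * x + c + real (Suc k) * (pi / 2)) = - sin (2 * pi * a * x + c + real k * (pi / 2))"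
        using minus_sin_cos_eq[of "2 * pi * a * x + c + real k * (pi / 2)"]
        by (simp add: algebra_simps add_divide_distrib)
      then show ?thesis
        unfolding g_def by (auto intro!: derivative_eq_intros)
    qed
    show "\<bar>g c n x\<bar> \<le> (2 * pi * R) ^ n" for x
    proof -
      have "\<bar>g c n x\<bar> \<le> (2 * pi * a) ^ n * 1"
        unfolding g_def abs_mult using \<open>0 \<le> a\<close> by (intro mult_mono) auto
      with pw show ?thesis by simp
    qed
  qed
  note bd = this
  let ?z = "1 - (\<Sum>x\<in>X. complex_of_real (lagrange X x 0) * echar (a * x))"
  have "\<bar>Re ?z\<bar> \<le> (2 * pi * R) ^ n / fact n"
    using bd[of 0] by (simp add: g_def echar_def algebra_simps)
  moreover have "\<bar>Im ?z\<bar> \<le> (2 * pi * R) ^ n / fact n"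
    using bd[of "- pi / 2"] by (simp add: g_def echar_def algebra_simps cos_diff sum_negf)
  ultimately show ?thesis
    using cmod_le[of ?z] by simp
qed

text \<open>\<open>band_limited R\<close> is an integral-free substitute for a Fourier transform of a probability
  measure on \<open>[0, R]\<close>: every linear combination of values of \<open>f\<close> is dominated by those of the
  exponentials with frequency in \<open>[0, R]\<close>.\<close>
definition band_limited :: "real \<Rightarrow> (real \<Rightarrow> complex) \<Rightarrow> bool" where
  "band_limited R f \<longleftrightarrow> (\<forall>X c B. finite X \<longrightarrow>
     (\<forall>a\<in>{0..R}. cmod (\<Sum>x\<in>X. c x * echar (a * x)) \<le> B) \<longrightarrow> cmod (\<Sum>x\<in>X. c x * f x) \<le> B)"

lemma band_limitedD:
  assumes "band_limited R f" "finite X" "\<And>a. a \<in> {0..R} \<Longrightarrow> cmod (\<Sum>x\<in>X. c x * echar (a * x)) \<le> B"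
  shows "cmod (\<Sum>x\<in>X. c x * f x) \<le> B"
  using assms unfolding band_limited_def by auto

lemma band_limited_one: "0 \<le> R \<Longrightarrow> band_limited R (\<lambda>_. 1)"
  unfolding band_limited_def by (auto dest!: bspec[where x = 0])

lemma band_limited_mono: "band_limited R f \<Longrightarrow> R \<le> R' \<Longrightarrow> band_limited R' f"
  unfolding band_limited_def by (meson atLeastAtMost_iff order.trans)

text \<open>A mask averages translations: the digit d moves the frequency a to a + d / P, which
  stays within R + S, so each summand satisfies the bound B and so does their mean.\<close>

lemma band_limited_mult_mask:
  assumes f: "band_limited R f" and D: "finite D" "D \<noteq> {}"
    and d: "\<And>d. d \<in> D \<Longrightarrow> 0 \<le> real_of_int d / P \<and> real_of_int d / P \<le> S"
  shows "band_limited (R + S) (\<lambda>x. f x * digit_mask D (x / P))"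
  unfolding band_limited_def
proof (intro allI impI)
  fix X :: "real set" and c B
  assume X: "finite X" and B: "\<forall>a\<in>{0..R + S}. cmod (\<Sum>x\<in>X. c x * echar (a * x)) \<le> B"
  have card: "card D > 0" using D by (simp add: card_gt_0_iff)
  have "cmod (\<Sum>x\<in>X. (c x * echar (real_of_int d * (x / P))) * f x) \<le> B" if "d \<in> D" for d
  proof -
    have "cmod (\<Sum>x\<in>X. (c x * echar (real_of_int d * (x / P))) * echar (a * x)) \<le> B"
      if "a \<in> {0..R}" for a
    proof -
      have "(\<Sum>x\<in>X. (c x * echar (real_of_int d * (x / P))) * echar (a * x)) =
          (\<Sum>x\<in>X. c x * echar ((a + real_of_int d / P) * x))"
        by (simp only: distrib_right echar_add) (simp add: mult_ac)
      moreover have "a + real_of_int d / P \<in> {0..R + S}"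
        using d[OF \<open>d \<in> D\<close>] that by auto
      ultimately show ?thesis using B by metis
    qed
    then show ?thesis by (rule band_limitedD[OF f X])
  qed
  then have "cmod (\<Sum>d\<in>D. \<Sum>x\<in>X. (c x * echar (real_of_int d * (x / P))) * f x) \<le> (\<Sum>d\<in>D. B)"
    by (rule sum_norm_le)
  moreover have "(\<Sum>d\<in>D. \<Sum>x\<in>X. (c x * echar (real_of_int d * (x / P))) * f x)
      = of_nat (card D) * (\<Sum>x\<in>X. c x * (f x * digit_mask D (x / P)))"
  proof -
    have "(\<Sum>d\<in>D. (c x * echar (real_of_int d * (x / P))) * f x) =
        of_nat (card D) * (c x * (f x * digit_mask D (x / P)))" for x
      using card by (simp add: digit_mask_def mult_ac flip: sum_distrib_left sum_distrib_right)
    then show ?thesis by (subst sum.swap) (simp only: sum_distrib_left)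
  qed
  ultimately show "cmod (\<Sum>x\<in>X. c x * (f x * digit_mask D (x / P))) \<le> B"
    using card by (simp add: norm_mult)
qed

text \<open>The defining inequalities involve finitely many values of f at a time, hence pass to
  pointwise limits.\<close>

lemma band_limited_limit:
  assumes "\<And>m. band_limited R (f m)" "\<And>x. (\<lambda>m. f m x) \<longlonglongrightarrow> g x"
  shows "band_limited R g"
  unfolding band_limited_def
proof (intro allI impI)
  fix X :: "real set" and c B
  assume X: "finite X" and B: "\<forall>a\<in>{0..R}. cmod (\<Sum>x\<in>X. c x * echar (a * x)) \<le> B"
  have "(\<lambda>m. cmod (\<Sum>x\<in>X. c x * f m x)) \<longlonglongrightarrow> cmod (\<Sum>x\<in>X. c x * g x)"
    by (intro tendsto_intros assms)
  moreover have "cmod (\<Sum>x\<in>X. c x * f m x) \<le> B" for m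
    using band_limitedD[OF assms(1) X] B by simp
  ultimately show "cmod (\<Sum>x\<in>X. c x * g x) \<le> B"
    by (intro LIMSEQ_le_const2) auto
qed

text \<open>Each factor is at most 1 / s. As s \<le> 1, the exponent card X - 1 may be raised to
  card X.\<close>

lemma lagrange_bound:
  assumes "finite X" "X \<subseteq> {0..1}" "x \<in> X" "0 < s" "s \<le> 1"
    and sep: "\<And>x y. x \<in> X \<Longrightarrow> y \<in> X \<Longrightarrow> x \<noteq> y \<Longrightarrow> s \<le> \<bar>x - y\<bar>"
  shows "\<bar>lagrange X x 0\<bar> \<le> (1 / s) ^ card X"
proof -
  have "\<bar>lagrange X x 0\<bar> \<le> (\<Prod>y\<in>X - {x}. 1 / s)"
    unfolding lagrange_def abs_prod
  proof (rule prod_mono, intro conjI)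
    fix y assume y: "y \<in> X - {x}"
    have "\<bar>(0 - y) / (x - y)\<bar> = \<bar>y\<bar> / \<bar>x - y\<bar>" by simp
    also have "\<dots> \<le> 1 / s"
      using y assms sep[of x y] by (intro frac_le) auto
    finally show "\<bar>(0 - y) / (x - y)\<bar> \<le> 1 / s" .
  qed simp
  also have "\<dots> = (1 / s) ^ card (X - {x})" by simp
  also have "\<dots> \<le> (1 / s) ^ card X"
    using assms by (intro power_increasing) (auto simp: card_Diff_subset)
  finally show ?thesis .
qed

text \<open>If f is tiny at n separated nodes, so is its interpolated value at 0, yet f 0 = 1 and
  the interpolation error is below 1/2 once (2 pi R)^n / n! < 1/4. Thus n depends on R only; the
  separation s enters through the Lagrange coefficients and affects \<delta> alone.\<close>

lemma band_limited_not_small: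
  assumes "0 \<le> R"
  obtains n where "n > 0" "\<And>s. s > 0 \<Longrightarrow> \<exists>\<delta>>0. \<forall>f X. band_limited R f \<longrightarrow> f 0 = 1 \<longrightarrow> finite X \<longrightarrow>
      card X = n \<longrightarrow> X \<subseteq> {0..1} \<longrightarrow> (\<forall>x\<in>X. \<forall>y\<in>X. x \<noteq> y \<longrightarrow> s \<le> \<bar>x - y\<bar>) \<longrightarrow> (\<exists>x\<in>X. \<delta> < (cmod (f x))\<^sup>2)"
proof -
  have "(\<lambda>n. (2 * pi * R) ^ n / fact n) \<longlonglongrightarrow> 0"
    using summable_LIMSEQ_zero[OF summable_exp[of "2 * pi * R"]] by (simp add: divide_inverse mult.commute)
  then have "\<forall>\<^sub>F n in sequentially. (2 * pi * R) ^ n / fact n < 1 / 4"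
    by (rule order_tendstoD) simp
  then have "\<forall>\<^sub>F n in sequentially. n > 0 \<and> (2 * pi * R) ^ n / fact n < 1 / 4"
    using eventually_gt_at_top[of 0] by eventually_elim simp
  then obtain n where "n > 0" "(2 * pi * R) ^ n / fact n < 1 / 4"
    using eventually_happens' sequentially_bot by blast
  then have n: "n > 0" "2 * (2 * pi * R) ^ n / fact n < 1 / 2" by simp_all
  show thesis
  proof (rule that[OF n(1)])
    fix s :: real assume "s > 0"
    define t where "t = min s 1"
    have t: "0 < t" "t \<le> 1" using \<open>s > 0\<close> by (auto simp: t_def)
    \<comment> \<open>Then n nodes with coefficients at most t^(-n) and values at most \<eta> / 2
      contribute at most 1/4 altogether.\<close>
    define \<eta> where "\<eta> = t ^ n / (2 * real n)"
    have \<eta>: "\<eta> > 0" using t n by (simp add: \<eta>_def)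
    have \<eta>1: "\<eta> < 1"
      using t n power_le_one[of t n] by (simp add: \<eta>_def)
    show "\<exists>\<delta>>0. \<forall>f X. band_limited R f \<longrightarrow> f 0 = 1 \<longrightarrow> finite X \<longrightarrow>
      card X = n \<longrightarrow> X \<subseteq> {0..1} \<longrightarrow> (\<forall>x\<in>X. \<forall>y\<in>X. x \<noteq> y \<longrightarrow> s \<le> \<bar>x - y\<bar>) \<longrightarrow> (\<exists>x\<in>X. \<delta> < (cmod (f x))\<^sup>2)"
    proof (intro exI[of _ "\<eta>\<^sup>2 / 4"] conjI allI impI)
      show "0 < \<eta>\<^sup>2 / 4" using \<eta> by simp
      fix f X assume f: "band_limited R f" "f 0 = 1" and X: "finite X" "card X = n" "X \<subseteq> {0..1}"
        and sep: "\<forall>x\<in>X. \<forall>y\<in>X. x \<noteq> y \<longrightarrow> s \<le> \<bar>x - y\<bar>"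
      show "\<exists>x\<in>X. \<eta>\<^sup>2 / 4 < (cmod (f x))\<^sup>2"
      proof (rule ccontr)
        assume "\<not> ?thesis"
        have small: "cmod (f x) \<le> \<eta> / 2" if "x \<in> X" for x
        proof (rule power2_le_imp_le)
          show "(cmod (f x))\<^sup>2 \<le> (\<eta> / 2)\<^sup>2"
            using \<open>\<not> (\<exists>x\<in>X. \<eta>\<^sup>2 / 4 < (cmod (f x))\<^sup>2)\<close> that by (simp add: power_divide not_less)
        qed (use \<eta> in simp)
        \<comment> \<open>The value f 0 = 1 is too large for a node.\<close>
        have "0 \<notin> X" using small[of 0] f(2) \<eta>1 by force
        \<comment> \<open>Coefficients that turn the interpolation error at 0 into a single linear
          combination of values, to which \<open>band_limited\<close> applies.\<close>
        define c where "c x = (if x = 0 then 1 else - complex_of_real (lagrange X x 0))" for x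
        have ins: "(\<Sum>x\<in>insert 0 X. c x * h x) = h 0 - (\<Sum>x\<in>X. complex_of_real (lagrange X x 0) * h x)" for h
        proof -
          have "(\<Sum>x\<in>X. c x * h x) = (\<Sum>x\<in>X. - (complex_of_real (lagrange X x 0) * h x))"
            using \<open>0 \<notin> X\<close> by (intro sum.cong refl) (auto simp: c_def)
          then show ?thesis using X \<open>0 \<notin> X\<close> by (simp add: c_def sum_negf)
        qed
        have "cmod (\<Sum>x\<in>insert 0 X. c x * echar (a * x)) \<le> 2 * (2 * pi * R) ^ n / fact n" if "a \<in> {0..R}" for a
          using lagrange_error_echar[OF X \<open>0 \<notin> X\<close>, of a R] that by (simp add: ins)
        then have "cmod (\<Sum>x\<in>insert 0 X. c x * f x) \<le> 2 * (2 * pi * R) ^ n / fact n"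
          using f(1) X(1) unfolding band_limited_def by (meson finite_insert)
        then have 1: "cmod (1 - (\<Sum>x\<in>X. complex_of_real (lagrange X x 0) * f x)) < 1 / 2"
          using n(2) unfolding ins f(2) by linarith
        have "cmod (\<Sum>x\<in>X. complex_of_real (lagrange X x 0) * f x) \<le> (\<Sum>x\<in>X. (1 / t) ^ n * (\<eta> / 2))"
        proof (rule sum_norm_le)
          fix x assume x: "x \<in> X"
          have "\<bar>lagrange X x 0\<bar> \<le> (1 / t) ^ n"
            using lagrange_bound[OF X(1,3) x t] sep X(2) by (auto simp: t_def min.coboundedI1)
          with small[OF x] t show "cmod (complex_of_real (lagrange X x 0) * f x) \<le> (1 / t) ^ n * (\<eta> / 2)"
            unfolding norm_mult by (intro mult_mono) auto
        qed
        also have "\<dots> = 1 / 4"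
          using X n t by (simp add: \<eta>_def power_divide)
        finally show False
          using 1 norm_triangle_ineq2[of 1 "\<Sum>x\<in>X. complex_of_real (lagrange X x 0) * f x"] by simp
      qed
    qed
  qed
qed

section \<open>Completeness of exponentials\<close>

lemma iexp_eq_echar: "exp (\<i> * complex_of_real (2 * pi * \<xi> * x)) = echar (\<xi> * x)"
  by (simp add: echar_def cis_conv_exp mult.assoc)

lemma char_eq_echar: "char M (2 * pi * \<xi>) = (CLINT x|M. echar (\<xi> * x))"
  by (simp add: char_def iexp_eq_echar del: of_real_mult)

lemma continuous_on_echar: "continuous_on S (\<lambda>x. echar (\<xi> * x))"
  unfolding echar_def by (intro continuous_intros)

lemma isCont_echar: "isCont echar x"
  using continuous_on_echar[of UNIV 1] by (simp add: continuous_on_eq_continuous_at)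

lemma borel_measurable_echar [measurable]: "(\<lambda>x. echar (\<xi> * x)) \<in> borel_measurable borel"
  by (intro borel_measurable_continuous_onI continuous_on_echar)

context real_distribution
begin

text \<open>Divided by their common integral a, g and h become densities of probability measures
  with equal characteristic functions. By Levy's uniqueness theorem the measures agree, and
  disjointness of the supports leaves nothing.\<close>

lemma fourier_injective_nonneg:
  fixes g h :: "real \<Rightarrow> real"
  assumes g: "integrable M g" "\<And>x. 0 \<le> g x" and h: "integrable M h" "\<And>x. 0 \<le> h x"
    and eq: "\<And>\<xi>. (CLINT x|M. complex_of_real (g x) * echar (\<xi> * x)) = (CLINT x|M. complex_of_real (h x) * echar (\<xi> * x))"
    and disj: "\<And>x. g x = 0 \<or> h x = 0"
  shows "AE x in M. g x = 0"
proof -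
  define a where "a = (LINT x|M. g x)"
  have a: "a = (LINT x|M. h x)"
    \<comment> \<open>The transforms at 0 are the integrals.\<close>
    using eq[of 0] by (simp add: a_def)
  show ?thesis
  proof (cases "a = 0")
    case True
    then show ?thesis
      using integral_nonneg_eq_0_iff_AE[OF g(1)] g(2) by (simp add: a_def)
  next
    case False
    then have "a > 0" using Bochner_Integration.integral_nonneg[of M g] g by (simp add: a_def order_less_le)
    define \<nu> where "\<nu> f = density M (\<lambda>x. ennreal (f x / a))" for f
    have dist: "real_distribution (\<nu> f)" if f: "integrable M f" "\<And>x. 0 \<le> f x" "a = (LINT x|M. f x)" for f
    proof -
      have [measurable]: "f \<in> borel_measurable M" using f(1) by simp
      have "emeasure (\<nu> f) (space (\<nu> f)) = (\<integral>\<^sup>+ x. ennreal (f x / a) \<partial>M)"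
        by (simp add: \<nu>_def emeasure_density cong: nn_integral_cong)
      also have "\<dots> = ennreal (LINT x|M. f x / a)"
        using f \<open>a > 0\<close> by (intro nn_integral_eq_integral) auto
      also have "\<dots> = 1" using f(3) \<open>a > 0\<close> by simp
      finally show ?thesis
        by (intro real_distribution.intro prob_spaceI real_distribution_axioms.intro) (auto simp: \<nu>_def)
    qed
    have char: "char (\<nu> f) (2 * pi * \<xi>) = (CLINT x|M. complex_of_real (f x) * echar (\<xi> * x)) / complex_of_real a"
      if f: "integrable M f" "\<And>x. 0 \<le> f x" for f \<xi>
    proof -
      have [measurable]: "f \<in> borel_measurable M" using f(1) by simp
      have "char (\<nu> f) (2 * pi * \<xi>) = (CLINT x|M. (f x / a) *\<^sub>R echar (\<xi> * x))"
        unfolding \<nu>_def char_eq_echar using f \<open>a > 0\<close> by (intro integral_density) auto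
      also have "\<dots> = (CLINT x|M. complex_of_real (f x) * echar (\<xi> * x) / complex_of_real a)"
        by (simp add: scaleR_conv_of_real)
      finally show ?thesis by simp
    qed
    have "char (\<nu> g) t = char (\<nu> h) t" for t
      using char[OF g, of "t / (2 * pi)"] char[OF h, of "t / (2 * pi)"] eq[of "t / (2 * pi)"] by simp
    then have "char (\<nu> g) = char (\<nu> h)" by (simp add: fun_eq_iff)
    then have "\<nu> g = \<nu> h"
      using dist[OF g a_def] dist[OF h a] by (intro Levy_uniqueness)
    moreover have [measurable]: "g \<in> borel_measurable M" "h \<in> borel_measurable M" using g h by auto
    define A where "A = {x \<in> space M. g x \<noteq> 0}"
    have [measurable]: "A \<in> sets M" unfolding A_def by measurable
    have "(\<lambda>x. ennreal (h x / a) * indicator A x) = (\<lambda>_. 0)"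
      using disj by (force simp: A_def indicator_def fun_eq_iff)
    then have "emeasure (\<nu> h) A = 0"
      unfolding \<nu>_def using \<open>A \<in> sets M\<close> by (subst emeasure_density) auto
    then have "emeasure (\<nu> g) A = 0" using calculation by simp
    then have "(\<integral>\<^sup>+ x. ennreal (g x / a) * indicator A x \<partial>M) = 0"
      unfolding \<nu>_def using \<open>A \<in> sets M\<close> by (subst (asm) emeasure_density) auto
    then have "AE x in M. ennreal (g x / a) * indicator A x = 0"
      by (subst (asm) nn_integral_0_iff_AE) measurable
    then have "AE x in M. x \<in> A \<longrightarrow> ennreal (g x / a) = 0"
      by eventually_elim (auto simp: indicator_def)
    then show ?thesis
      using AE_space
    proof eventually_elim
      case (elim x)
      then have "g x \<noteq> 0 \<Longrightarrow> g x \<le> 0"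
        using \<open>a > 0\<close> by (auto simp: A_def ennreal_eq_0_iff divide_le_0_iff)
      with g(2)[of x] show ?case by fastforce
    qed
  qed
qed

lemma fourier_injective_real:
  fixes h :: "real \<Rightarrow> real"
  assumes h: "integrable M h" and eq: "\<And>\<xi>. (CLINT x|M. complex_of_real (h x) * echar (\<xi> * x)) = 0"
  shows "AE x in M. h x = 0"
proof -
  define g where "g s x = max 0 (s * h x)" for s x :: real
  have int: "integrable M (g s)" "0 \<le> g s x" for s x unfolding g_def using h by auto
  have int': "integrable M (\<lambda>x. complex_of_real (g s x) * echar (\<xi> * x))" for s \<xi>
    by (rule Bochner_Integration.integrable_bound[OF int(1)[of s]])
       (use int[of s] in \<open>auto simp: norm_mult\<close>)
  have "complex_of_real (h x) * echar (\<xi> * x) = complex_of_real (g 1 x) * echar (\<xi> * x) - complex_of_real (g (- 1) x) * echar (\<xi> * x)" for x \<xi>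
    by (auto simp: g_def max_def algebra_simps)
  then have eq': "(CLINT x|M. complex_of_real (g 1 x) * echar (\<xi> * x)) = (CLINT x|M. complex_of_real (g (- 1) x) * echar (\<xi> * x))" for \<xi>
    using eq[of \<xi>] int' by simp
  have disj: "g 1 x = 0 \<or> g (- 1) x = 0" for x by (auto simp: g_def max_def)
  have "AE x in M. g 1 x = 0"
    by (rule fourier_injective_nonneg[OF int int eq' disj])
  moreover have "AE x in M. g (- 1) x = 0"
    by (rule fourier_injective_nonneg[OF int int eq'[symmetric]]) (use disj in blast)
  ultimately show ?thesis
    by eventually_elim (auto simp: g_def max_def split: if_splits)
qed

lemma fourier_injective:
  fixes f :: "real \<Rightarrow> complex"
  assumes f: "integrable M f" and eq: "\<And>\<xi>. (CLINT x|M. f x * echar (\<xi> * x)) = 0"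
  shows "AE x in M. f x = 0"
proof -
  have int: "integrable M (\<lambda>x. f x * echar (\<xi> * x))" for \<xi>
    by (rule Bochner_Integration.integrable_bound[OF f]) (use f in \<open>auto simp: norm_mult\<close>)
  have int': "integrable M (\<lambda>x. cnj (f x) * echar (\<xi> * x))" for \<xi>
  proof (rule Bochner_Integration.integrable_bound[OF f])
    have [measurable]: "(\<lambda>x. cnj (f x)) \<in> borel_measurable M"
      by (rule borel_measurable_integrable[OF integrable_cnj[OF f]])
    show "(\<lambda>x. cnj (f x) * echar (\<xi> * x)) \<in> borel_measurable M" by measurable
  qed (simp add: norm_mult)
  have "(CLINT x|M. cnj (f x) * echar (\<xi> * x)) = cnj (CLINT x|M. f x * echar (- \<xi> * x))" for \<xi>
    by (subst Bochner_Integration.integral_cnj[symmetric]) (simp add: cnj_echar)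
  then have eq': "(CLINT x|M. cnj (f x) * echar (\<xi> * x)) = 0" for \<xi>
    using eq[of "- \<xi>"] by simp
  have "(CLINT x|M. complex_of_real (Re (f x)) * echar (\<xi> * x)) = 0" for \<xi>
  proof -
    have *: "complex_of_real (Re (f x)) * echar (\<xi> * x) = (f x * echar (\<xi> * x) + cnj (f x) * echar (\<xi> * x)) / 2" for x
      by (simp add: complex_add_cnj flip: distrib_right)
    show ?thesis unfolding * using int int' eq eq' by simp
  qed
  then have "AE x in M. Re (f x) = 0" using f by (intro fourier_injective_real) auto
  moreover have "(CLINT x|M. complex_of_real (Im (f x)) * echar (\<xi> * x)) = 0" for \<xi>
  proof -
    have *: "complex_of_real (Im (f x)) * echar (\<xi> * x) = (f x * echar (\<xi> * x) - cnj (f x) * echar (\<xi> * x)) / (2 * \<i>)" for x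
      by (simp only: left_diff_distrib[symmetric] complex_diff_cnj) (simp add: field_simps)
    show ?thesis unfolding * using int int' eq eq' by simp
  qed
  then have "AE x in M. Im (f x) = 0" using f by (intro fourier_injective_real) auto
  ultimately show ?thesis by eventually_elim (simp add: complex_eq_iff)
qed

text \<open>The transform of an integrable function is continuous. Restricting to rationals makes
  the frequencies countable, so that a construction that treats one frequency per step can reach all
  of them.\<close>

lemma fourier_zero_dense:
  fixes f :: "real \<Rightarrow> complex"
  assumes f: "integrable M f" and eq: "\<And>\<xi>. \<xi> \<in> \<rat> \<Longrightarrow> (CLINT x|M. f x * echar (\<xi> * x)) = 0"
  shows "AE x in M. f x = 0"
proof (rule fourier_injective[OF f])
  fix \<xi> :: real
  have "\<xi> \<in> closure \<rat>" by (simp add: Rats_closure_real)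
  then obtain q where q: "\<And>n. q n \<in> \<rat>" "q \<longlonglongrightarrow> \<xi>" by (auto simp: closure_sequential)
  have "(\<lambda>n. CLINT x|M. f x * echar (q n * x)) \<longlonglongrightarrow> (CLINT x|M. f x * echar (\<xi> * x))"
  proof (rule integral_dominated_convergence[where w = "\<lambda>x. cmod (f x)"])
    show "AE x in M. (\<lambda>n. f x * echar (q n * x)) \<longlonglongrightarrow> f x * echar (\<xi> * x)"
      by (intro AE_I2 tendsto_intros isCont_tendsto_compose[OF isCont_echar] q(2))
  qed (use f in \<open>auto simp: norm_mult\<close>)
  then show "(CLINT x|M. f x * echar (\<xi> * x)) = 0"
    using eq[OF q(1)] by (simp add: LIMSEQ_const_iff)
qed

lemma square_integrable_imp_integrable:
  assumes "square_integrable M f"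
  shows "integrable M f"
proof (rule Bochner_Integration.integrable_bound)
  show "integrable M (\<lambda>x. 1 + (cmod (f x))\<^sup>2)" using assms by (simp add: square_integrable_def)
  show "f \<in> borel_measurable M" using assms by (simp add: square_integrable_def)
  show "AE x in M. norm (f x) \<le> norm (1 + (cmod (f x))\<^sup>2)"
  proof (rule AE_I2)
    fix x
    have "0 \<le> (cmod (f x) - 1)\<^sup>2 + cmod (f x)" by (intro add_nonneg_nonneg) auto
    then have "cmod (f x) \<le> 1 + (cmod (f x))\<^sup>2" by (simp add: power2_diff)
    then show "norm (f x) \<le> norm (1 + (cmod (f x))\<^sup>2)" by simp
  qed
qed

text \<open>The function \<open>g k\<close> below is the exponential at \<xi> minus its projection
  onto the exponentials at - s for s in \<open>S k\<close>. By Pythagoras its squared norm is the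
  missing mass, which tends to 0, while f has the same integral against \<open>g k\<close> as
  against the exponential itself.\<close>

lemma spectralI:
  fixes \<Lambda> :: "real set" and S :: "nat \<Rightarrow> real set"
  assumes orth: "\<And>k a b. a \<in> S k \<Longrightarrow> b \<in> S k \<Longrightarrow> a \<noteq> b \<Longrightarrow> (CLINT x|M. echar ((a - b) * x)) = 0"
    and S: "incseq S" "\<And>k. finite (S k)"
    and compl: "\<And>\<xi>. \<xi> \<in> \<rat> \<Longrightarrow> (\<lambda>k. \<Sum>s\<in>S k. (cmod (CLINT x|M. echar ((\<xi> + s) * x)))\<^sup>2) \<longlonglongrightarrow> 1"
  shows "spectral M"
  unfolding spectral_def
proof (intro exI[of _ "\<Union>k. S k"] conjI ballI impI allI)
  have int: "integrable M (\<lambda>x. echar (a * x))" for a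
    by (rule integrable_const_bound[where B = 1]) auto
  have cis_eq: "cis (2 * pi * a * x) = echar (a * x)" for a x :: real
    by (simp add: echar_def mult.assoc)
  have cis_cnj: "cis (2 * pi * a * x) * cnj (cis (2 * pi * b * x)) = echar ((a - b) * x)" for a b x
    unfolding cis_eq cnj_echar by (simp add: algebra_simps flip: echar_add)
  have cnj_cis: "cnj (cis (2 * pi * b * x)) = echar (- b * x)" for b x
    unfolding cis_eq cnj_echar by simp
  show "countable (\<Union>k. S k)" using S(2) by (intro countable_UN) (auto simp: countable_finite)
  show "(CLINT x|M. cis (2 * pi * a * x) * cnj (cis (2 * pi * b * x))) = 0"
    if ab: "a \<in> (\<Union>k. S k)" "b \<in> (\<Union>k. S k)" "a \<noteq> b" for a b
  proof -
    obtain i j where "a \<in> S i" "b \<in> S j" using ab by auto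
    moreover have "S i \<subseteq> S (max i j)" "S j \<subseteq> S (max i j)" by (auto intro!: incseqD[OF S(1)])
    ultimately show ?thesis unfolding cis_cnj using orth ab(3) by blast
  qed
  fix f assume f: "square_integrable M f"
    and zero: "\<forall>c\<in>(\<Union>k. S k). (CLINT x|M. f x * cnj (cis (2 * pi * c * x))) = 0"
  have fint: "integrable M f" by (rule square_integrable_imp_integrable[OF f])
  have f2: "integrable M (\<lambda>x. (cmod (f x))\<^sup>2)" using f by (simp add: square_integrable_def)
  have fe: "integrable M (\<lambda>x. f x * echar (a * x))" for a
    by (rule Bochner_Integration.integrable_bound[OF fint]) (use fint in \<open>auto simp: norm_mult\<close>)
  define F where "F = (LINT x|M. (cmod (f x))\<^sup>2)"
  show "AE x in M. f x = 0"
  proof (rule fourier_zero_dense[OF fint])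
    fix \<xi> :: real assume \<xi>: "\<xi> \<in> \<rat>"
    define I where "I = (CLINT x|M. f x * echar (\<xi> * x))"
    define c where "c s = (CLINT x|M. echar ((\<xi> + s) * x))" for s
    \<comment> \<open>The orthogonality of f to the exponential at s carries a conjugate, so what
      may be subtracted is the exponential at - s; hence the argument \<xi> + s in
      \<open>c\<close>.\<close>
    define g where "g k x = echar (\<xi> * x) - (\<Sum>s\<in>S k. c s * echar (- s * x))" for k x
    have [measurable]: "g k \<in> borel_measurable M" for k unfolding g_def by measurable
    have I: "I = (CLINT x|M. f x * g k x)" for k
    proof -
      have "(CLINT x|M. f x * g k x) = (CLINT x|M. f x * echar (\<xi> * x) - (\<Sum>s\<in>S k. c s * (f x * echar (- s * x))))"
        by (simp add: g_def algebra_simps sum_distrib_left)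
      also have "\<dots> = I - (\<Sum>s\<in>S k. c s * (CLINT x|M. f x * echar (- s * x)))"
      proof -
        have "integrable M (\<lambda>x. f x * echar (- (s * x)))" for s using fe[of "- s"] by simp
        then show ?thesis using fe by (simp add: I_def)
      qed
      also have "(\<Sum>s\<in>S k. c s * (CLINT x|M. f x * echar (- s * x))) = 0"
        using zero unfolding cnj_cis by (intro sum.neutral) auto
      finally show ?thesis by simp
    qed
    have gsq: "complex_of_real ((cmod (g k x))\<^sup>2) = 1 - (\<Sum>s\<in>S k. cnj (c s) * echar ((\<xi> + s) * x))
        - (\<Sum>s\<in>S k. c s * echar (- ((\<xi> + s) * x))) + (\<Sum>s\<in>S k. \<Sum>t\<in>S k. c s * cnj (c t) * echar ((t - s) * x))" for k x
    proof -
      have "complex_of_real ((cmod (g k x))\<^sup>2) = g k x * cnj (g k x)" by (simp only: complex_norm_square)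
      also have "\<dots> = echar (\<xi> * x) * echar (- (\<xi> * x)) - (\<Sum>s\<in>S k. echar (\<xi> * x) * (cnj (c s) * echar (s * x)))
          - (\<Sum>s\<in>S k. c s * echar (- s * x) * echar (- (\<xi> * x)))
          + (\<Sum>s\<in>S k. \<Sum>t\<in>S k. (c s * echar (- s * x)) * (cnj (c t) * echar (t * x)))"
      proof -
        have "cnj (g k x) = echar (- (\<xi> * x)) - (\<Sum>s\<in>S k. cnj (c s) * echar (s * x))"
          by (simp add: g_def cnj_echar)
        moreover have "(u - v) * (u' - v') = u * u' - u * v' - v * u' + v * v'" for u v u' v' :: complex
          by (simp add: algebra_simps)
        ultimately show ?thesis
          unfolding g_def by (simp only: sum_product) (simp only: sum_distrib_left sum_distrib_right)
      qed
      also have "(\<lambda>s. echar (\<xi> * x) * (cnj (c s) * echar (s * x))) = (\<lambda>s. cnj (c s) * echar ((\<xi> + s) * x))"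
        by (simp add: fun_eq_iff distrib_right echar_add)
      also have "(\<lambda>s. c s * echar (- s * x) * echar (- (\<xi> * x))) = (\<lambda>s. c s * echar (- ((\<xi> + s) * x)))"
        by (simp add: fun_eq_iff algebra_simps flip: echar_add)
      also have "(\<lambda>s t. (c s * echar (- s * x)) * (cnj (c t) * echar (t * x))) = (\<lambda>s t. c s * cnj (c t) * echar ((t - s) * x))"
        by (simp add: fun_eq_iff algebra_simps flip: echar_add)
      finally show ?thesis by simp
    qed
    have cm: "(CLINT x|M. echar (- ((\<xi> + s) * x))) = cnj (c s)" for s
      unfolding c_def by (subst Bochner_Integration.integral_cnj[symmetric]) (simp only: cnj_echar)
    have g2: "(LINT x|M. (cmod (g k x))\<^sup>2) = 1 - (\<Sum>s\<in>S k. (cmod (c s))\<^sup>2)" for k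
    proof -
      have "complex_of_real (LINT x|M. (cmod (g k x))\<^sup>2) = (CLINT x|M. complex_of_real ((cmod (g k x))\<^sup>2))"
        by (rule integral_complex_of_real[symmetric])
      also have "\<dots> = 1 - (\<Sum>s\<in>S k. cnj (c s) * c s) - (\<Sum>s\<in>S k. c s * cnj (c s))
          + (\<Sum>s\<in>S k. \<Sum>t\<in>S k. c s * cnj (c t) * (CLINT x|M. echar ((t - s) * x)))"
      proof -
        have "integrable M (\<lambda>x. echar (- (a * x)))" for a using int[of "- a"] by simp
        then show ?thesis unfolding gsq using int prob_space by (simp add: cm c_def[symmetric])
      qed
      also have "(\<Sum>s\<in>S k. \<Sum>t\<in>S k. c s * cnj (c t) * (CLINT x|M. echar ((t - s) * x)))
          = (\<Sum>s\<in>S k. \<Sum>t\<in>S k. if t = s then c s * cnj (c s) else 0)"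
        using orth prob_space by (intro sum.cong refl) auto
      also have "\<dots> = (\<Sum>s\<in>S k. c s * cnj (c s))" using S(2) by simp
      finally have "complex_of_real (LINT x|M. (cmod (g k x))\<^sup>2) = 1 - (\<Sum>s\<in>S k. cnj (c s) * c s)" by simp
      also have "\<dots> = complex_of_real (1 - (\<Sum>s\<in>S k. (cmod (c s))\<^sup>2))"
        by (simp only: of_real_diff of_real_sum of_real_1 complex_norm_square mult.commute)
      finally show ?thesis by (simp only: of_real_eq_iff)
    qed
    have gbd: "cmod (g k x) \<le> 1 + (\<Sum>s\<in>S k. cmod (c s))" for k x
      unfolding g_def
      by (rule order.trans[OF norm_triangle_ineq4]) (auto intro!: sum_norm_le simp: norm_mult)
    have gint: "integrable M (\<lambda>x. (cmod (g k x))\<^sup>2)" for k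
      by (rule integrable_const_bound[where B = "(1 + (\<Sum>s\<in>S k. cmod (c s)))\<^sup>2"])
         (auto intro!: power_mono gbd)
    \<comment> \<open>Cauchy-Schwarz in the form 2ab \<le> t a^2 + b^2 / t. First k tends to
      infinity, which removes the second term, then t tends to 0.\<close>
    have bound: "2 * cmod I \<le> t * F + (1 - (\<Sum>s\<in>S k. (cmod (c s))\<^sup>2)) / t" if t: "t > 0" for t k
    proof -
      have pt: "2 * cmod (f x * g k x) \<le> t * (cmod (f x))\<^sup>2 + (cmod (g k x))\<^sup>2 / t" for x
      proof -
        have "0 \<le> (t * cmod (f x) - cmod (g k x))\<^sup>2 / t" using t by simp
        also have "\<dots> = t * (cmod (f x))\<^sup>2 + (cmod (g k x))\<^sup>2 / t - 2 * cmod (f x * g k x)"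
          using t by (simp add: power2_diff norm_mult power2_eq_square field_simps)
        finally show ?thesis by simp
      qed
      have fgint: "integrable M (\<lambda>x. f x * g k x)"
        by (rule Bochner_Integration.integrable_bound[where f = "\<lambda>x. t * (cmod (f x))\<^sup>2 + (cmod (g k x))\<^sup>2 / t"])
           (use f2 gint fint pt t in \<open>auto intro!: AE_I2 order.trans[OF _ abs_ge_self] order.trans[OF _ pt]\<close>)
      have "cmod I \<le> (LINT x|M. cmod (f x * g k x))"
        unfolding I[of k] by (rule integral_norm_bound)
      then have "2 * cmod I \<le> (LINT x|M. 2 * cmod (f x * g k x))" by simp
      also have "\<dots> \<le> (LINT x|M. t * (cmod (f x))\<^sup>2 + (cmod (g k x))\<^sup>2 / t)"
        using pt f2 gint fgint by (intro integral_mono) auto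
      also have "\<dots> = t * F + (1 - (\<Sum>s\<in>S k. (cmod (c s))\<^sup>2)) / t"
        using f2 gint by (simp add: F_def g2)
      finally show ?thesis .
    qed
    have tF: "2 * cmod I \<le> t * F" if "t > 0" for t
    proof -
      have "(\<lambda>k. t * F + (1 - (\<Sum>s\<in>S k. (cmod (c s))\<^sup>2)) / t) \<longlonglongrightarrow> t * F + (1 - 1) / t"
        unfolding c_def by (intro tendsto_intros compl \<xi>) (use that in simp)
      from LIMSEQ_le_const[OF this] bound[OF that] show ?thesis by simp
    qed
    have "((\<lambda>t. t * F) \<longlongrightarrow> 0 * F) (at_right 0)" by (intro tendsto_intros)
    then have "2 * cmod I \<le> 0 * F"
      by (rule tendsto_lowerbound) (auto simp: eventually_at_right_less intro!: eventually_mono[OF eventually_at_right_less] tF)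
    then show "(CLINT x|M. f x * echar (\<xi> * x)) = 0" by (simp add: I_def)
  qed
qed

end

section \<open>Tails of the infinite convolution\<close>

locale hadamard_sequence =
  fixes p :: "nat \<Rightarrow> nat" and D L :: "nat \<Rightarrow> int set" and C :: real and K :: nat
  assumes hadamard: "hadamard_triple (p n) (D n) (L n)"
    and zero_in: "0 \<in> D n"
    and nonneg: "D n \<subseteq> {0..}"
    and card_ge2: "card (D n) \<ge> 2"
    and digits_le: "d \<in> D n \<Longrightarrow> real_of_int d / real (p n) \<le> C"
    and card_le: "card (D n) \<le> K"
begin

lemma p_ge2: "p n \<ge> 2"
  using hadamard[of n] by (simp add: hadamard_triple_def)

lemma p_pos: "p n > 0"
  using p_ge2[of n] by simp

lemma finite_D: "finite (D n)" and finite_L: "finite (L n)" and card_L: "card (L n) = card (D n)"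
  using hadamard[of n] by (auto simp: hadamard_triple_def)

lemma D_nonempty: "D n \<noteq> {}"
  using zero_in by auto

lemma C_nonneg: "0 \<le> C"
  using digits_le[OF zero_in[of 0]] by simp

lemma digit_nonneg: "d \<in> D n \<Longrightarrow> 0 \<le> real_of_int d"
  using nonneg by auto

lemma digit_le: "d \<in> D n \<Longrightarrow> real_of_int d \<le> C * real (p n)"
  using digits_le[of d n] p_pos[of n] by (simp add: divide_le_eq)

lemma K_ge2: "K \<ge> 2"
  using card_ge2 card_le order.trans by blast

definition P :: "nat \<Rightarrow> nat \<Rightarrow> nat" where
  "P n m = (\<Prod>k\<in>{n..<m}. p k)"

lemma P_pos: "P n m > 0"
  by (auto simp: P_def p_pos)

lemma P_self [simp]: "P n n = 1"
  by (simp add: P_def)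

lemma P_one [simp]: "P n (Suc n) = p n"
  by (simp add: P_def)

lemma P_mult: "n \<le> m \<Longrightarrow> m \<le> r \<Longrightarrow> P n m * P m r = P n r"
  unfolding P_def by (rule prod.atLeastLessThan_concat)

lemma P_Suc: "n \<le> m \<Longrightarrow> P n (Suc m) = P n m * p m"
  by (simp add: P_def)

lemma P_ge: "2 ^ k \<le> P n (n + k)"
proof (induction k)
  case (Suc k)
  have "2 ^ k * 2 \<le> P n (n + k) * p (n + k)"
    using Suc p_ge2 by (intro mult_mono) auto
  then show ?case by (simp add: P_Suc mult.commute)
qed simp

text \<open>Fourier transform of the convolution of the levels n, ..., m - 1, rescaled so that level
  n has denominator p n. Its limit \<open>N n\<close> is the transform of the rescaled tail.\<close>

definition M :: "nat \<Rightarrow> nat \<Rightarrow> real \<Rightarrow> complex" where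
  "M n m x = (\<Prod>k\<in>{n..<m}. digit_mask (D k) (x / real (P n (Suc k))))"

definition N :: "nat \<Rightarrow> real \<Rightarrow> complex" where
  "N n x = lim (\<lambda>m. M n m x)"

lemma M_self [simp]: "M n n x = 1"
  by (simp add: M_def)

lemma M_Suc: "n \<le> m \<Longrightarrow> M n (Suc m) x = M n m x * digit_mask (D m) (x / real (P n (Suc m)))"
  by (simp add: M_def)

lemma M_one: "M n (Suc n) x = digit_mask (D n) (x / real (p n))"
  by (simp add: M_Suc)

lemma M_mult:
  assumes "n \<le> m" "m \<le> r"
  shows "M n m x * M m r (x / real (P n m)) = M n r x"
proof -
  have "M m r (x / real (P n m)) = (\<Prod>k\<in>{m..<r}. digit_mask (D k) (x / real (P n (Suc k))))"
    unfolding M_def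
  proof (rule prod.cong[OF refl])
    fix k assume "k \<in> {m..<r}"
    then have "P n (Suc k) = P n m * P m (Suc k)" using assms by (simp add: P_mult)
    then show "digit_mask (D k) (x / real (P n m) / real (P m (Suc k))) = digit_mask (D k) (x / real (P n (Suc k)))"
      by simp
  qed
  then show ?thesis
    unfolding M_def using assms by (simp add: prod.atLeastLessThan_concat)
qed

lemma M_0 [simp]: "M n m 0 = 1"
  by (simp add: M_def finite_D D_nonempty)

lemma norm_M_le: "cmod (M n m x) \<le> 1"
  unfolding M_def prod_norm[symmetric] by (intro prod_le_1) (simp add: norm_mask_le)

lemma M_periodic: "M n m (x + real (P n m) * of_int u) = M n m x"
  unfolding M_def
proof (rule prod.cong[OF refl])
  fix k assume "k \<in> {n..<m}"
  then have "P n m = P n (Suc k) * P (Suc k) m" by (simp add: P_mult)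
  then have "(x + real (P n m) * of_int u) / real (P n (Suc k)) =
      x / real (P n (Suc k)) + of_int (int (P (Suc k) m) * u)"
    using P_pos[of n "Suc k"] by (simp add: field_simps)
  then show "digit_mask (D k) ((x + real (P n m) * of_int u) / real (P n (Suc k))) = digit_mask (D k) (x / real (P n (Suc k)))"
    by (simp only: digit_mask_add_int)
qed

text \<open>The factor of level m differs from 1 by at most 2 pi C p_m |x| / P n (m + 1) = 2 pi C
  |x| / P n m. The unbounded p_m cancels and a geometric series remains.\<close>

lemma M_tendsto: "(\<lambda>m. M n m x) \<longlonglongrightarrow> N n x"
proof -
  define d where "d k = M n (n + Suc k) x - M n (n + k) x" for k
  have "norm (d k) \<le> 2 * pi * C * \<bar>x\<bar> * (1 / 2) ^ k" for k
  proof -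
    have "d k = M n (n + k) x * (digit_mask (D (n + k)) (x / real (P n (Suc (n + k)))) - 1)"
      by (simp add: d_def M_Suc algebra_simps)
    then have "norm (d k) \<le> 1 * cmod (digit_mask (D (n + k)) (x / real (P n (Suc (n + k)))) - 1)"
      using norm_M_le by (simp only: norm_mult mult_right_mono norm_ge_zero)
    also have "\<dots> \<le> 2 * pi * (C * real (p (n + k))) * \<bar>x / real (P n (Suc (n + k)))\<bar>"
      unfolding mult_1
      using digit_nonneg digit_le by (intro norm_mask_diff_le finite_D D_nonempty) auto
    also have "\<dots> = 2 * pi * C * \<bar>x\<bar> * (1 / real (P n (n + k)))"
      using p_pos[of "n + k"] by (simp add: P_Suc)
    also have "\<dots> \<le> 2 * pi * C * \<bar>x\<bar> * (1 / 2) ^ k"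
    proof (rule mult_left_mono)
      have "(2::real) ^ k \<le> real (P n (n + k))"
        using P_ge[of k n] by (metis of_nat_le_iff of_nat_numeral of_nat_power)
      then show "1 / real (P n (n + k)) \<le> (1 / 2) ^ k"
        by (simp add: power_one_over frac_le)
    qed (simp add: C_nonneg)
    finally show ?thesis .
  qed
  moreover have "summable (\<lambda>k. 2 * pi * C * \<bar>x\<bar> * (1 / 2 :: real) ^ k)"
    by (intro summable_mult summable_geometric) simp
  ultimately have "summable d"
    using summable_comparison_test'[of _ 0 d] by blast
  then have "(\<lambda>j. \<Sum>k<j. d k) \<longlonglongrightarrow> suminf d" by (rule summable_LIMSEQ)
  moreover have "(\<Sum>k<j. d k) = M n (n + j) x - 1" for j
    using sum_lessThan_telescope[of "\<lambda>k. M n (n + k) x" j] by (simp add: d_def)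
  ultimately have "(\<lambda>j. M n (n + j) x - 1 + 1) \<longlonglongrightarrow> suminf d + 1"
    by (intro tendsto_add tendsto_const) simp
  then have "(\<lambda>j. M n (j + n) x) \<longlonglongrightarrow> suminf d + 1" by (simp add: add.commute)
  then have "(\<lambda>m. M n m x) \<longlonglongrightarrow> suminf d + 1" by (rule LIMSEQ_offset)
  moreover from this have "N n x = suminf d + 1" unfolding N_def by (rule limI)
  ultimately show ?thesis by simp
qed

lemma N_split:
  assumes "n \<le> m"
  shows "N n x = M n m x * N m (x / real (P n m))"
proof (rule LIMSEQ_unique[OF M_tendsto])
  have "(\<lambda>r. M n m x * M m r (x / real (P n m))) \<longlonglongrightarrow> M n m x * N m (x / real (P n m))"
    by (intro tendsto_intros M_tendsto)
  moreover have "\<forall>\<^sub>F r in sequentially. M n m x * M m r (x / real (P n m)) = M n r x"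
    using eventually_ge_at_top[of m] by eventually_elim (simp add: M_mult assms)
  ultimately show "(\<lambda>r. M n r x) \<longlonglongrightarrow> M n m x * N m (x / real (P n m))"
    by (rule Lim_transform_eventually)
qed

lemma norm_N_le: "cmod (N n x) \<le> 1"
  by (rule LIMSEQ_le_const2[OF tendsto_norm[OF M_tendsto]]) (auto simp: norm_M_le)

lemma norm_N_le_M: "n \<le> m \<Longrightarrow> cmod (N n x) \<le> cmod (M n m x)"
  by (simp add: N_split norm_mult mult_left_le norm_N_le)

lemma N_0: "N n 0 = 1"
  using M_tendsto[of n 0] by (simp add: LIMSEQ_const_iff)

text \<open>The digits of level n + j, suitably scaled, are at most C / 2^j, and these bounds add up
  to less than 2 C.\<close>

lemma N_band_limited: "band_limited (2 * C) (N n)"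
proof -
  have 1: "band_limited (\<Sum>i<j. C * (1 / 2) ^ i) (M n (n + j))" for j
  proof (induction j)
    case 0
    have "M n n = (\<lambda>_. 1)" by (simp add: fun_eq_iff)
    then show ?case by (simp add: band_limited_one)
  next
    case (Suc j)
    have "band_limited ((\<Sum>i<j. C * (1 / 2) ^ i) + C * (1 / 2) ^ j)
        (\<lambda>x. M n (n + j) x * digit_mask (D (n + j)) (x / real (P n (Suc (n + j)))))"
    proof (rule band_limited_mult_mask[OF Suc finite_D D_nonempty])
      fix d assume d: "d \<in> D (n + j)"
      have "real_of_int d / real (P n (Suc (n + j))) = (real_of_int d / real (p (n + j))) * (1 / real (P n (n + j)))"
        by (simp add: P_Suc)
      also have "\<dots> \<le> C * (1 / 2) ^ j"
      proof (rule mult_mono)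
        have "(2::real) ^ j \<le> real (P n (n + j))"
          using P_ge[of j n] by (metis of_nat_le_iff of_nat_numeral of_nat_power)
        then show "1 / real (P n (n + j)) \<le> (1 / 2) ^ j"
          by (simp add: power_one_over frac_le)
      qed (auto simp: digits_le[OF d] C_nonneg)
      finally show "0 \<le> real_of_int d / real (P n (Suc (n + j))) \<and>
          real_of_int d / real (P n (Suc (n + j))) \<le> C * (1 / 2) ^ j"
        using digit_nonneg[OF d] by simp
    qed
    moreover have "M n (n + Suc j) = (\<lambda>x. M n (n + j) x * digit_mask (D (n + j)) (x / real (P n (Suc (n + j)))))"
      by (simp add: fun_eq_iff M_Suc)
    ultimately show ?case by simp
  qed
  have "(\<Sum>i<j. C * (1 / 2) ^ i) \<le> 2 * C" for j
    using C_nonneg by (simp add: sum_gp_strict flip: sum_distrib_left) (simp add: field_simps mult_left_le)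
  then have "band_limited (2 * C) (M n (j + n))" for j
    using band_limited_mono[OF 1] by (simp add: add.commute)
  moreover have "(\<lambda>j. M n (j + n) x) \<longlonglongrightarrow> N n x" for x
    by (rule LIMSEQ_ignore_initial_segment[OF M_tendsto])
  ultimately show ?thesis by (rule band_limited_limit)
qed

text \<open>Equivalently, \<open>T\<close> is a spectrum of the discrete measure formed by the levels \<open>n, \<dots>, m - 1\<close>,
  whose Fourier transform is \<open>M n m\<close>.\<close>
definition block_spectrum :: "nat \<Rightarrow> nat \<Rightarrow> int set \<Rightarrow> bool" where
  "block_spectrum n m T \<longleftrightarrow> n \<le> m \<and> finite T \<and> (\<forall>x. (\<Sum>t\<in>T. (cmod (M n m (x + of_int t)))\<^sup>2) = 1)"

lemma block_spectrum_refl: "block_spectrum n n {k}"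
  by (simp add: block_spectrum_def)

lemma block_spectrum_shift:
  assumes "block_spectrum n m T"
  shows "block_spectrum n m ((\<lambda>t. t + c) ` T)"
proof -
  have "(\<Sum>t\<in>(\<lambda>t. t + c) ` T. (cmod (M n m (x + of_int t)))\<^sup>2)
      = (\<Sum>t\<in>T. (cmod (M n m ((x + of_int c) + of_int t)))\<^sup>2)" for x
    by (subst sum.reindex) (auto simp: inj_on_def algebra_simps)
  with assms show ?thesis by (simp add: block_spectrum_def)
qed

lemma block_spectrum_L: "block_spectrum n (Suc n) (L n)"
  unfolding block_spectrum_def M_one
  using hadamard_sum_mask[OF hadamard D_nonempty] finite_L by auto

text \<open>At x = - t' the term of t' alone already exhausts the sum 1.\<close>

lemma block_spectrum_orthogonal:
  assumes "block_spectrum n m T" "t \<in> T" "t' \<in> T" "t \<noteq> t'"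
  shows "M n m (of_int (t - t')) = 0"
proof -
  have fin: "finite T" using assms(1) by (simp add: block_spectrum_def)
  have "1 = (\<Sum>s\<in>T. (cmod (M n m (of_int (s - t'))))\<^sup>2)"
    using assms(1)[unfolded block_spectrum_def, THEN conjunct2, THEN conjunct2, rule_format, of "- of_int t'"]
    by simp
  also have "\<dots> = 1 + (\<Sum>s\<in>T - {t'}. (cmod (M n m (of_int (s - t'))))\<^sup>2)"
    using fin assms(3) by (subst sum.remove[of _ t']) auto
  finally have "(\<Sum>s\<in>T - {t'}. (cmod (M n m (of_int (s - t'))))\<^sup>2) = 0" by simp
  then have "(cmod (M n m (of_int (t - t'))))\<^sup>2 = 0"
    using fin assms by (subst (asm) sum_nonneg_eq_0_iff) auto
  then show ?thesis by simp
qed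

text \<open>Every frequency t gets its own continuation \<open>U t\<close> in the later levels,
  scaled by the product of the earlier denominators.\<close>

definition extend :: "nat \<Rightarrow> nat \<Rightarrow> int set \<Rightarrow> (int \<Rightarrow> int set) \<Rightarrow> int set" where
  "extend n m T U = (\<Union>t\<in>T. (\<lambda>u. t + int (P n m) * u) ` U t)"

text \<open>The union is disjoint: elements of T congruent modulo \<open>P n m\<close> cannot be
  orthogonal, because \<open>M n m\<close> has this period and equals 1 at 0.\<close>

lemma sum_extend:
  assumes T: "block_spectrum n m T" and U: "\<And>t. t \<in> T \<Longrightarrow> finite (U t)" and "S \<subseteq> T"
  shows "(\<Sum>s\<in>extend n m S U. f s) = (\<Sum>t\<in>S. \<Sum>u\<in>U t. f (t + int (P n m) * u))"
proof -
  have fin: "finite S" using T finite_subset[OF \<open>S \<subseteq> T\<close>] by (simp add: block_spectrum_def)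
  have inj: "inj (\<lambda>u. t + int (P n m) * u)" for t
    using P_pos[of n m] by (auto simp: inj_on_def)
  have "t = t'" if "t \<in> S" "t' \<in> S" "t + int (P n m) * u = t' + int (P n m) * u'" for t t' u u'
  proof (rule ccontr)
    assume "t \<noteq> t'"
    then have "M n m (of_int (t - t')) = 0"
      using that \<open>S \<subseteq> T\<close> by (intro block_spectrum_orthogonal[OF T]) auto
    moreover have "t - t' = int (P n m) * (u' - u)" using that(3) by (simp add: algebra_simps)
    then have "M n m (of_int (t - t')) = 1"
      using M_periodic[of n m 0 "u' - u"] by simp
    ultimately show False by simp
  qed
  then have "(\<Sum>s\<in>extend n m S U. f s) = (\<Sum>t\<in>S. \<Sum>s\<in>(\<lambda>u. t + int (P n m) * u) ` U t. f s)"
    unfolding extend_def using fin U \<open>S \<subseteq> T\<close> by (intro sum.UNION_disjoint) blast+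
  then show ?thesis
    using inj by (simp add: sum.reindex inj_on_def)
qed

lemma extend_point:
  "(x + of_int (t + int (P n m) * u)) / real (P n m) = (x + of_int t) / real (P n m) + of_int u"
  using P_pos[of n m] by (simp add: field_simps)

lemma M_extend:
  assumes "n \<le> m" "m \<le> r"
  shows "M n r (x + of_int (t + int (P n m) * u)) =
    M n m (x + of_int t) * M m r ((x + of_int t) / real (P n m) + of_int u)"
  using M_mult[OF assms, of "x + of_int (t + int (P n m) * u)"] M_periodic[of n m "x + of_int t" u]
  unfolding extend_point by (simp add: algebra_simps)

lemma N_extend:
  assumes "n \<le> m"
  shows "N n (x + of_int (t + int (P n m) * u)) =
    M n m (x + of_int t) * N m ((x + of_int t) / real (P n m) + of_int u)"
  using N_split[OF assms, of "x + of_int (t + int (P n m) * u)"] M_periodic[of n m "x + of_int t" u]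
  unfolding extend_point by (simp add: algebra_simps)

lemma block_spectrum_extend:
  assumes T: "block_spectrum n m T" and U: "\<And>t. t \<in> T \<Longrightarrow> block_spectrum m r (U t)"
  shows "block_spectrum n r (extend n m T U)"
proof -
  have ne: "T \<noteq> {}" using T by (auto simp: block_spectrum_def)
  have le: "n \<le> m" "m \<le> r" using T U ne by (auto simp: block_spectrum_def)
  have fin: "finite T" "\<And>t. t \<in> T \<Longrightarrow> finite (U t)" using T U by (auto simp: block_spectrum_def)
  have "(\<Sum>s\<in>extend n m T U. (cmod (M n r (x + of_int s)))\<^sup>2) = 1" for x
  proof -
    have "(\<Sum>s\<in>extend n m T U. (cmod (M n r (x + of_int s)))\<^sup>2) =
        (\<Sum>t\<in>T. (cmod (M n m (x + of_int t)))\<^sup>2 *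
          (\<Sum>u\<in>U t. (cmod (M m r ((x + of_int t) / real (P n m) + of_int u)))\<^sup>2))"
      by (subst sum_extend[OF T fin(2)]) (auto simp: M_extend[OF le] norm_mult power_mult_distrib sum_distrib_left simp del: of_int_add)
    also have "\<dots> = (\<Sum>t\<in>T. (cmod (M n m (x + of_int t)))\<^sup>2)"
      using U by (intro sum.cong) (auto simp: block_spectrum_def)
    finally show ?thesis using T by (simp add: block_spectrum_def)
  qed
  moreover have "finite (extend n m T U)" using fin by (simp add: extend_def)
  ultimately show ?thesis using le by (simp add: block_spectrum_def)
qed

lemma sum_N_extend:
  assumes T: "block_spectrum n m T" and U: "\<And>t. t \<in> T \<Longrightarrow> finite (U t)" and S: "S \<subseteq> T"
  shows "(\<Sum>s\<in>extend n m S U. (cmod (N n (x + of_int s)))\<^sup>2) =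
        (\<Sum>t\<in>S. (cmod (M n m (x + of_int t)))\<^sup>2 *
          (\<Sum>u\<in>U t. (cmod (N m ((x + of_int t) / real (P n m) + of_int u)))\<^sup>2))"
proof -
  have "n \<le> m" using T by (simp add: block_spectrum_def)
  show ?thesis
    by (subst sum_extend[OF T U S])
       (auto simp: N_extend[OF \<open>n \<le> m\<close>] norm_mult power_mult_distrib sum_distrib_left simp del: of_int_add)
qed

text \<open>Continuation by 0 leaves a frequency unchanged; this is how the spectra become
  nested.\<close>

lemma subset_extend: "(\<And>t. t \<in> S \<Longrightarrow> 0 \<in> U t) \<Longrightarrow> S \<subseteq> T \<Longrightarrow> S \<subseteq> extend n m T U"
  by (force simp: extend_def)

text \<open>A Hadamard partner need not contain 0, but its translate by the negative of one of its
  elements does.\<close>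

lemma block_spectrum_zero:
  assumes "n \<le> m"
  obtains T where "block_spectrum n m T" "0 \<in> T"
proof -
  have "\<exists>T. block_spectrum n (n + k) T \<and> 0 \<in> T" for k
  proof (induction k)
    case 0
    then show ?case using block_spectrum_refl[of n 0] by auto
  next
    case (Suc k)
    then obtain T where T: "block_spectrum n (n + k) T" "0 \<in> T" by blast
    have "L (n + k) \<noteq> {}" using card_L[of "n + k"] card_ge2[of "n + k"] by auto
    then obtain l where l: "l \<in> L (n + k)" by blast
    have "block_spectrum n (Suc (n + k)) (extend n (n + k) T (\<lambda>_. (\<lambda>t. t + (- l)) ` L (n + k)))"
      by (intro block_spectrum_extend[OF T(1)] block_spectrum_shift block_spectrum_L)
    moreover have "0 \<in> extend n (n + k) T (\<lambda>_. (\<lambda>t. t + (- l)) ` L (n + k))"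
      using T(2) l subset_extend[of "{0}" "\<lambda>_. (\<lambda>t. t + (- l)) ` L (n + k)" T] by force
    ultimately show ?case by auto
  qed
  from this[of "m - n"] show thesis using that assms by auto
qed

end

section \<open>Bad frequencies\<close>

text \<open>Greedy choice: take the minimum and discard B consecutive integers from it on, which
  costs at most B elements.\<close>

lemma separated_subset:
  fixes A :: "nat set"
  assumes "finite A" "B > 0" "k * B \<le> card A"
  shows "\<exists>S\<subseteq>A. card S = k \<and> (\<forall>a\<in>S. \<forall>b\<in>S. a < b \<longrightarrow> a + B \<le> b)"
  using assms
proof (induction k arbitrary: A)
  case (Suc k)
  define a where "a = Min A"
  define A' where "A' = A - {a..<a + B}"
  have "A \<noteq> {}" using Suc.prems by auto
  then have a: "a \<in> A" "\<And>x. x \<in> A \<Longrightarrow> a \<le> x" using Suc.prems(1) by (auto simp: a_def)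
  have "card A - card {a..<a + B} \<le> card A'" unfolding A'_def by (rule diff_card_le_card_Diff) simp
  then have "k * B \<le> card A'" using Suc.prems(3) by simp
  then obtain S where S: "S \<subseteq> A'" "card S = k" "\<forall>a\<in>S. \<forall>b\<in>S. a < b \<longrightarrow> a + B \<le> b"
    using Suc.IH[of A'] Suc.prems by (auto simp: A'_def)
  have far: "a + B \<le> x" if "x \<in> S" for x
    using that S(1) a(2)[of x] by (auto simp: A'_def not_less)
  have fin: "finite S" using S(1) Suc.prems(1) finite_subset[of S A] by (auto simp: A'_def)
  have "a \<notin> S" using far[of a] Suc.prems(2) by auto
  then have "card (insert a S) = Suc k" using S(2) fin by simp
  moreover have "insert a S \<subseteq> A" using S(1) a by (auto simp: A'_def)
  moreover have "\<forall>x\<in>insert a S. \<forall>y\<in>insert a S. x < y \<longrightarrow> x + B \<le> y"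
    using S(3) far by force
  ultimately show ?case by blast
qed (intro exI[of _ "{}"], simp)

context hadamard_sequence
begin

definition bad :: "real \<Rightarrow> nat \<Rightarrow> real \<Rightarrow> bool" where
  "bad \<epsilon> n x \<longleftrightarrow> (\<forall>m T. block_spectrum n m T \<longrightarrow> (\<Sum>t\<in>T. (cmod (N n (x + of_int t)))\<^sup>2) < \<epsilon>)"

definition child :: "nat \<Rightarrow> real \<Rightarrow> int \<Rightarrow> real" where
  "child n x l = (x + of_int l) / real (p n)"

definition weight :: "nat \<Rightarrow> real \<Rightarrow> int \<Rightarrow> real" where
  "weight n x l = (cmod (digit_mask (D n) (child n x l)))\<^sup>2"

lemma weight_bounds: "0 \<le> weight n x l" "weight n x l \<le> 1"
  using norm_mask_le by (auto simp: weight_def power_le_one)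

lemma sum_weight: "block_spectrum n (Suc n) T \<Longrightarrow> (\<Sum>l\<in>T. weight n x l) = 1"
  by (simp add: block_spectrum_def M_one weight_def child_def)

lemma sum_weight_residues: "(\<Sum>l<p n. weight n x (int l)) = real (p n) / real (card (D n))"
  using hadamard_sum_residues[OF hadamard D_nonempty] by (simp add: weight_def child_def)

lemma sum_N_extend_step:
  assumes T: "block_spectrum n (Suc n) T" and U: "\<And>t. t \<in> T \<Longrightarrow> finite (U t)"
  shows "(\<Sum>s\<in>extend n (Suc n) T U. (cmod (N n (x + of_int s)))\<^sup>2) =
    (\<Sum>l\<in>T. weight n x l * (\<Sum>u\<in>U l. (cmod (N (Suc n) (child n x l + of_int u)))\<^sup>2))"
  using sum_N_extend[OF T U order.refl] by (simp add: M_one weight_def child_def)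

lemma bad_mono: "bad \<epsilon> n x \<Longrightarrow> \<epsilon> \<le> \<epsilon>' \<Longrightarrow> bad \<epsilon>' n x"
  unfolding bad_def using order.strict_trans2 by blast

text \<open>A singleton is a spectrum of the empty block m = n, so at a bad point all values at
  integer translates are small.\<close>

lemma bad_N: "bad \<epsilon> n x \<Longrightarrow> (cmod (N n (x + of_int k)))\<^sup>2 < \<epsilon>"
proof -
  assume "bad \<epsilon> n x"
  then have "(\<Sum>t\<in>{k}. (cmod (N n (x + of_int t)))\<^sup>2) < \<epsilon>"
    using block_spectrum_refl unfolding bad_def by blast
  then show ?thesis by simp
qed

lemma bad_pos: "bad \<epsilon> n x \<Longrightarrow> \<epsilon> > 0"
  using bad_N[of \<epsilon> n x 0] zero_le_power2[of "cmod (N n (x + of_int 0))"] by linarith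

lemma bad_shift:
  assumes "bad \<epsilon> n x"
  shows "bad \<epsilon> n (x + of_int k)"
  unfolding bad_def
proof (intro allI impI)
  fix m T assume "block_spectrum n m T"
  then have "(\<Sum>t\<in>(\<lambda>t. t + k) ` T. (cmod (N n (x + of_int t)))\<^sup>2) < \<epsilon>"
    using assms block_spectrum_shift unfolding bad_def by blast
  also have "(\<Sum>t\<in>(\<lambda>t. t + k) ` T. (cmod (N n (x + of_int t)))\<^sup>2)
      = (\<Sum>t\<in>T. (cmod (N n (x + of_int k + of_int t)))\<^sup>2)"
    by (subst sum.reindex) (auto simp: inj_on_def algebra_simps)
  finally show "(\<Sum>t\<in>T. (cmod (N n (x + of_int k + of_int t)))\<^sup>2) < \<epsilon>" .
qed

lemma bad_frac: "bad \<epsilon> n x \<Longrightarrow> bad \<epsilon> n (frac x)"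
  using bad_shift[of \<epsilon> n x "- \<lfloor>x\<rfloor>"] by (simp add: frac_def)

text \<open>A witness prolonged by sets that contain 0 remains a witness. Finitely many witnesses
  can thus be brought to a common level.\<close>

lemma not_bad_eventually:
  assumes "\<not> bad \<epsilon> n x"
  shows "\<forall>\<^sub>F m in sequentially. \<exists>T. block_spectrum n m T \<and> \<epsilon> \<le> (\<Sum>t\<in>T. (cmod (N n (x + of_int t)))\<^sup>2)"
proof -
  obtain r T where T: "block_spectrum n r T" and ge: "\<epsilon> \<le> (\<Sum>t\<in>T. (cmod (N n (x + of_int t)))\<^sup>2)"
    using assms by (auto simp: bad_def not_less)
  show ?thesis
    using eventually_ge_at_top[of r]
  proof eventually_elim
    case (elim m)
    then obtain Z where Z: "block_spectrum r m Z" "0 \<in> Z" by (rule block_spectrum_zero)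
    have "T \<subseteq> extend n r T (\<lambda>_. Z)" using Z by (intro subset_extend) auto
    moreover have bs: "block_spectrum n m (extend n r T (\<lambda>_. Z))" by (rule block_spectrum_extend[OF T Z(1)])
    ultimately have "(\<Sum>t\<in>T. (cmod (N n (x + of_int t)))\<^sup>2)
        \<le> (\<Sum>t\<in>extend n r T (\<lambda>_. Z). (cmod (N n (x + of_int t)))\<^sup>2)"
      by (intro sum_mono2) (auto simp: block_spectrum_def)
    with bs ge show ?case by (intro exI[of _ "extend n r T (\<lambda>_. Z)"]) auto
  qed
qed

text \<open>Witnesses against the badness of all children, taken at one level, combine by
  \<open>extend\<close> to a witness for x: the amount captured for x is the weighted mean of the
  amounts captured for the children.\<close>

lemma bad_child:
  assumes "bad \<epsilon> n x" and T: "block_spectrum n (Suc n) T"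
  shows "\<exists>l\<in>T. bad \<epsilon> (Suc n) (child n x l)"
proof (rule ccontr)
  assume "\<not> ?thesis"
  then have "\<forall>l\<in>T. \<forall>\<^sub>F m in sequentially. \<exists>U. block_spectrum (Suc n) m U \<and>
      \<epsilon> \<le> (\<Sum>t\<in>U. (cmod (N (Suc n) (child n x l + of_int t)))\<^sup>2)"
    using not_bad_eventually by blast
  moreover have fin: "finite T" using T by (simp add: block_spectrum_def)
  ultimately have "\<forall>\<^sub>F m in sequentially. \<forall>l\<in>T. \<exists>U. block_spectrum (Suc n) m U \<and>
      \<epsilon> \<le> (\<Sum>t\<in>U. (cmod (N (Suc n) (child n x l + of_int t)))\<^sup>2)"
    by (simp add: eventually_ball_finite_distrib)
  then obtain m where "\<forall>l\<in>T. \<exists>U. block_spectrum (Suc n) m U \<and>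
      \<epsilon> \<le> (\<Sum>t\<in>U. (cmod (N (Suc n) (child n x l + of_int t)))\<^sup>2)"
    using eventually_happens' sequentially_bot by blast
  then obtain U where U: "\<And>l. l \<in> T \<Longrightarrow> block_spectrum (Suc n) m (U l)"
      and ge: "\<And>l. l \<in> T \<Longrightarrow> \<epsilon> \<le> (\<Sum>t\<in>U l. (cmod (N (Suc n) (child n x l + of_int t)))\<^sup>2)"
    by metis
  have "\<epsilon> = (\<Sum>l\<in>T. weight n x l * \<epsilon>)"
    using sum_weight[OF T] by (simp flip: sum_distrib_right)
  also have "\<dots> \<le> (\<Sum>l\<in>T. weight n x l * (\<Sum>u\<in>U l. (cmod (N (Suc n) (child n x l + of_int u)))\<^sup>2))"
    using ge by (intro sum_mono mult_left_mono weight_bounds) auto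
  also have "\<dots> = (\<Sum>s\<in>extend n (Suc n) T U. (cmod (N n (x + of_int s)))\<^sup>2)"
    using U by (intro sum_N_extend_step[OF T, symmetric]) (auto simp: block_spectrum_def)
  also have "\<dots> < \<epsilon>"
    using assms(1) block_spectrum_extend[OF T, of m U] U unfolding bad_def by blast
  finally show False by simp
qed

lemma block_spectrum_containing:
  obtains T where "block_spectrum n (Suc n) T" "l \<in> T"
proof -
  obtain T where T: "block_spectrum n (Suc n) T" "0 \<in> T" using block_spectrum_zero[of n "Suc n"] by auto
  then have "l \<in> (\<lambda>t. t + l) ` T" by force
  with that block_spectrum_shift[OF T(1)] show thesis by blast
qed

text \<open>Every integer l lies in some translate of a partner. If its child were not that bad, the
  single branch l would capture c * (\<epsilon> / c) for x.\<close>

lemma bad_child_weight: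
  assumes "bad \<epsilon> n x" "c > 0" "c \<le> weight n x l"
  shows "bad (\<epsilon> / c) (Suc n) (child n x l)"
proof (rule ccontr)
  assume "\<not> ?thesis"
  then obtain m V where V: "block_spectrum (Suc n) m V"
    and ge: "\<epsilon> / c \<le> (\<Sum>t\<in>V. (cmod (N (Suc n) (child n x l + of_int t)))\<^sup>2)"
    by (auto simp: bad_def not_less)
  obtain T where T: "block_spectrum n (Suc n) T" "l \<in> T" by (rule block_spectrum_containing)
  have fin: "finite T" using T by (simp add: block_spectrum_def)
  have bs: "block_spectrum n m (extend n (Suc n) T (\<lambda>_. V))"
    by (rule block_spectrum_extend[OF T(1) V])
  have "\<epsilon> = c * (\<epsilon> / c)" using assms by simp
  also have "\<dots> \<le> weight n x l * (\<Sum>t\<in>V. (cmod (N (Suc n) (child n x l + of_int t)))\<^sup>2)"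
    using assms ge bad_pos[OF assms(1)] by (intro mult_mono) (auto simp: weight_bounds)
  also have "\<dots> \<le> (\<Sum>l\<in>T. weight n x l * (\<Sum>u\<in>V. (cmod (N (Suc n) (child n x l + of_int u)))\<^sup>2))"
    by (rule member_le_sum[OF T(2) _ fin]) (auto intro!: mult_nonneg_nonneg sum_nonneg weight_bounds)
  also have "\<dots> = (\<Sum>s\<in>extend n (Suc n) T (\<lambda>_. V). (cmod (N n (x + of_int s)))\<^sup>2)"
    using V by (intro sum_N_extend_step[OF T(1), symmetric]) (auto simp: block_spectrum_def)
  also have "\<dots> < \<epsilon>"
    using assms(1) bs unfolding bad_def by blast
  finally show False by simp
qed

text \<open>The child comes from the partner \<open>L n\<close>. Its other elements are incongruent
  to l modulo p n; if they all weigh less than c, they leave at least 1 - K c for l.\<close>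

lemma bad_dichotomy:
  assumes "bad \<epsilon> n x" "c > 0"
  obtains l where "bad \<epsilon> (Suc n) (child n x l)"
    and "(\<exists>l'. \<not> int (p n) dvd l' - l \<and> c \<le> weight n x l') \<or> 1 - real K * c \<le> weight n x l"
proof -
  have bs: "block_spectrum n (Suc n) (L n)" by (rule block_spectrum_L)
  obtain l where l: "l \<in> L n" "bad \<epsilon> (Suc n) (child n x l)"
    using bad_child[OF assms(1) bs] by blast
  have "1 - real K * c \<le> weight n x l" if no: "\<And>l'. \<not> int (p n) dvd l' - l \<Longrightarrow> weight n x l' < c"
  proof -
    have "weight n x l' \<le> c" if "l' \<in> L n - {l}" for l'
    proof -
      have "\<not> int (p n) dvd l' - l"
      proof
        assume "int (p n) dvd l' - l"
        then obtain k where "l' - l = int (p n) * k" ..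
        then have "M n (Suc n) (of_int (l' - l)) = 1" using M_periodic[of n "Suc n" 0 k] by simp
        then show False using block_spectrum_orthogonal[OF bs, of l' l] that l by simp
      qed
      then show ?thesis using no by (simp add: less_imp_le)
    qed
    then have "(\<Sum>l'\<in>L n - {l}. weight n x l') \<le> (\<Sum>l'\<in>L n - {l}. c)"
      by (rule sum_mono)
    also have "\<dots> \<le> real K * c"
      using card_L[of n] card_le[of n] assms(2) card_mono[of "L n" "L n - {l}"] finite_L[of n]
      by (simp add: mult_right_mono)
    finally show ?thesis
      using sum_weight[OF bs, of x] l finite_L[of n] by (simp add: sum.remove)
  qed
  then have "(\<exists>l'. \<not> int (p n) dvd l' - l \<and> c \<le> weight n x l') \<or> 1 - real K * c \<le> weight n x l"
    by (metis not_less)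
  with that[OF l(2)] show thesis .
qed

text \<open>The weights sum to p / card D \<ge> 1 + 1 / K. The residue of l carries at most 1, so
  the remaining residues, fewer than B in number, share at least 1 / K.\<close>

lemma second_child:
  assumes "p n > card (D n)" "p n \<le> B"
  shows "\<exists>l'. \<not> int (p n) dvd l' - l \<and> 1 / (real K * real B) \<le> weight n x l'"
proof (rule ccontr)
  assume no: "\<not> ?thesis"
  define r where "r = nat (l mod int (p n))"
  have r: "r < p n" "int r = l mod int (p n)"
    using p_pos[of n] by (auto simp: r_def nat_less_iff)
  have q: "card (D n) > 0" using card_ge2[of n] by simp
  have B: "real B > 0" "real K > 0" using p_pos[of n] assms K_ge2 by auto
  have "weight n x (int i) \<le> 1 / (real K * real B)" if "i \<in> {..<p n} - {r}" for i
  proof -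
    have "\<not> int (p n) dvd int i - l"
      using that r by (auto simp: mod_eq_dvd_iff[symmetric])
    with no show ?thesis by (auto simp: not_le less_imp_le)
  qed
  then have "(\<Sum>i\<in>{..<p n} - {r}. weight n x (int i)) \<le> (\<Sum>i\<in>{..<p n} - {r}. 1 / (real K * real B))"
    by (rule sum_mono)
  also have "\<dots> = real (p n - 1) / (real K * real B)" using r by simp
  also have "\<dots> < real B / (real K * real B)"
    using assms B p_pos[of n] by (intro divide_strict_right_mono) auto
  also have "\<dots> = 1 / real K" using B by simp
  finally have "(\<Sum>i<p n. weight n x (int i)) < 1 + 1 / real K"
    using weight_bounds(2)[of n x "int r"] r by (simp add: sum.remove)
  moreover have "1 + 1 / real K \<le> real (p n) / real (card (D n))"
  proof -
    have "1 / real K \<le> 1 / real (card (D n))" using q card_le[of n] by (intro divide_left_mono) auto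
    then have "1 + 1 / real K \<le> (real (card (D n)) + 1) / real (card (D n))" using q by (simp add: add_divide_distrib)
    also have "\<dots> \<le> real (p n) / real (card (D n))" using assms by (intro divide_right_mono) auto
    finally show ?thesis .
  qed
  ultimately show False by (simp add: sum_weight_residues)
qed

text \<open>By averaging: the weights sum to at least p / K and the light residues contribute at
  most p / (2 K), so at least p / (2 K) residues are heavy.\<close>

lemma few_large_weights:
  assumes "Suc 0 \<le> k" "2 * K * k \<le> p n"
  obtains S where "S \<subseteq> {l. l < p n \<and> 1 / (2 * real K) \<le> weight n x (int l)}" "card S = k"
    "\<And>a b. a \<in> S \<Longrightarrow> b \<in> S \<Longrightarrow> a \<noteq> b \<Longrightarrow>
       1 / (4 * real K * real k) \<le> \<bar>child n x (int a) - child n x (int b)\<bar>"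
proof -
  define A where "A = {l. l < p n \<and> 1 / (2 * real K) \<le> weight n x (int l)}"
  \<comment> \<open>The gap that p / (2 K) heavy residues allow for k choices. By assumption it is
    at least 1, so rounding down loses at most a factor 2; hence 4 in the separation.\<close>
  define B where "B = p n div (2 * K * k)"
  have K: "real K > 0" using K_ge2 by simp
  have fin: "finite A" by (simp add: A_def)
  have sub: "A \<subseteq> {..<p n}" by (auto simp: A_def)
  have "real (p n) / real K \<le> real (p n) / real (card (D n))"
    using card_le[of n] card_ge2[of n] K by (intro divide_left_mono) auto
  also have "\<dots> = (\<Sum>l<p n. weight n x (int l))" by (simp add: sum_weight_residues)
  also have "\<dots> = (\<Sum>l\<in>A. weight n x (int l)) + (\<Sum>l\<in>{..<p n} - A. weight n x (int l))"
    using sum.subset_diff[OF sub] by (simp add: add.commute)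
  also have "\<dots> \<le> (\<Sum>l\<in>A. 1) + (\<Sum>l\<in>{..<p n} - A. 1 / (2 * real K))"
    by (intro add_mono sum_mono weight_bounds) (auto simp: A_def)
  also have "\<dots> \<le> real (card A) + real (p n) / (2 * real K)"
    using K card_mono[of "{..<p n}" "{..<p n} - A"] by (simp add: divide_right_mono)
  finally have "real (p n) \<le> real (2 * K * card A)"
    using K by (simp add: field_simps)
  then have cardA: "p n \<le> 2 * K * card A" by (simp only: of_nat_le_iff)
  have "2 * K * (k * B) \<le> p n"
    using div_times_less_eq_dividend[of "p n" "2 * K * k"] by (simp add: B_def mult_ac)
  then have "2 * K * (k * B) \<le> 2 * K * card A" using cardA by (rule order.trans)
  then have kB: "k * B \<le> card A" using K_ge2 by simp
  have pos: "0 < 2 * K * k" using assms(1) K_ge2 by simp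
  have B: "B > 0" unfolding B_def using assms(2) pos by (simp add: div_greater_zero_iff)
  have "p n < 2 * K * k * (B + 1)"
    using dividend_less_times_div[OF pos, of "p n"] by (simp add: B_def)
  also have "\<dots> \<le> 2 * K * k * (B + B)" using B by (intro mult_left_mono) auto
  finally have "real (p n) < real (2 * K * k * (B + B))" by (simp only: of_nat_less_iff)
  then have Bp: "1 / (4 * real K * real k) \<le> real B / real (p n)"
    using p_pos[of n] assms(1) K by (simp add: field_simps)
  obtain S where S: "S \<subseteq> A" "card S = k" "\<forall>a\<in>S. \<forall>b\<in>S. a < b \<longrightarrow> a + B \<le> b"
    using separated_subset[OF fin B kB] by blast
  show thesis
  proof (rule that[OF S(1)[unfolded A_def] S(2)])
    fix a b assume ab: "a \<in> S" "b \<in> S" "a \<noteq> b"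
    then have "a + B \<le> b \<or> b + B \<le> a" using S(3) by (meson linorder_neqE_nat)
    then have "real B \<le> \<bar>real a - real b\<bar>" by linarith
    then have "real B / real (p n) \<le> \<bar>real a - real b\<bar> / real (p n)"
      by (intro divide_right_mono) auto
    also have "\<dots> = \<bar>child n x (int a) - child n x (int b)\<bar>"
      using p_pos[of n] by (simp add: child_def flip: diff_divide_distrib)
    finally show "1 / (4 * real K * real k) \<le> \<bar>child n x (int a) - child n x (int b)\<bar>"
      using Bp by simp
  qed
qed

section \<open>Counting separated bad frequencies\<close>

definition zero_bound :: "nat \<Rightarrow> bool" where
  "zero_bound k \<longleftrightarrow> k > 0 \<and> (\<forall>s>0. \<exists>\<delta>>0. \<forall>n X. finite X \<longrightarrow> card X = k \<longrightarrow> X \<subseteq> {0..1} \<longrightarrow>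
     (\<forall>x\<in>X. \<forall>y\<in>X. x \<noteq> y \<longrightarrow> s \<le> \<bar>x - y\<bar>) \<longrightarrow> (\<exists>x\<in>X. \<delta> < (cmod (N n x))\<^sup>2))"

lemma zero_bound_ex: "\<exists>k. zero_bound k"
proof -
  have "0 \<le> 2 * C" using C_nonneg by simp
  then obtain k where k: "k > 0" "\<And>s. s > 0 \<Longrightarrow> \<exists>\<delta>>0. \<forall>f X. band_limited (2 * C) f \<longrightarrow> f 0 = 1 \<longrightarrow> finite X \<longrightarrow>
      card X = k \<longrightarrow> X \<subseteq> {0..1} \<longrightarrow> (\<forall>x\<in>X. \<forall>y\<in>X. x \<noteq> y \<longrightarrow> s \<le> \<bar>x - y\<bar>) \<longrightarrow> (\<exists>x\<in>X. \<delta> < (cmod (f x))\<^sup>2)"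
    by (rule band_limited_not_small) blast
  have "zero_bound k"
    unfolding zero_bound_def
  proof (intro conjI allI impI k(1))
    fix s :: real assume "s > 0"
    from k(2)[OF this] obtain \<delta> where \<delta>: "\<delta> > 0" "\<And>f X. band_limited (2 * C) f \<Longrightarrow> f 0 = 1 \<Longrightarrow> finite X \<Longrightarrow>
      card X = k \<Longrightarrow> X \<subseteq> {0..1} \<Longrightarrow> (\<forall>x\<in>X. \<forall>y\<in>X. x \<noteq> y \<longrightarrow> s \<le> \<bar>x - y\<bar>) \<Longrightarrow> \<exists>x\<in>X. \<delta> < (cmod (f x))\<^sup>2"
      by auto
    show "\<exists>\<delta>>0. \<forall>n X. finite X \<longrightarrow> card X = k \<longrightarrow> X \<subseteq> {0..1} \<longrightarrow>
     (\<forall>x\<in>X. \<forall>y\<in>X. x \<noteq> y \<longrightarrow> s \<le> \<bar>x - y\<bar>) \<longrightarrow> (\<exists>x\<in>X. \<delta> < (cmod (N n x))\<^sup>2)"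
      using \<delta>(1) \<delta>(2)[OF N_band_limited N_0] by (intro exI[of _ \<delta>] conjI allI impI)
  qed
  then show ?thesis ..
qed

lemma zero_boundE:
  assumes "zero_bound k" "s > 0"
  obtains \<delta> where "\<delta> > 0" "\<And>n X. finite X \<Longrightarrow> card X = k \<Longrightarrow> X \<subseteq> {0..1} \<Longrightarrow>
     (\<And>x y. x \<in> X \<Longrightarrow> y \<in> X \<Longrightarrow> x \<noteq> y \<Longrightarrow> s \<le> \<bar>x - y\<bar>) \<Longrightarrow> \<exists>x\<in>X. \<delta> < (cmod (N n x))\<^sup>2"
  using assms unfolding zero_bound_def by auto

text \<open>For larger p n a bad point has k heavy, well separated children. All of them are bad and
  thus near-zeros of one tail transform, which contradicts the choice of k.\<close>

lemma bad_scale_bounded: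
  assumes k: "zero_bound k"
  shows "\<exists>\<epsilon>>0. \<forall>n x. bad \<epsilon> n x \<longrightarrow> p n \<le> 2 * K * k"
proof -
  have K: "real K > 0" "real k > 0" using K_ge2 k by (auto simp: zero_bound_def)
  then have "1 / (4 * real K * real k) > 0" by simp
  then obtain \<delta> where \<delta>: "\<delta> > 0" and sep: "\<And>n X. finite X \<Longrightarrow> card X = k \<Longrightarrow> X \<subseteq> {0..1} \<Longrightarrow>
     (\<And>x y. x \<in> X \<Longrightarrow> y \<in> X \<Longrightarrow> x \<noteq> y \<Longrightarrow> 1 / (4 * real K * real k) \<le> \<bar>x - y\<bar>) \<Longrightarrow> \<exists>x\<in>X. \<delta> < (cmod (N n x))\<^sup>2"
    using zero_boundE[OF k] by blast
  show ?thesis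
  \<comment> \<open>A heavy child weighs at least 1 / (2 K), which turns this badness into
    \<delta>.\<close>
  proof (intro exI[of _ "\<delta> / (2 * real K)"] conjI allI impI)
    show "0 < \<delta> / (2 * real K)" using \<delta> K by simp
    fix n x assume "bad (\<delta> / (2 * real K)) n x"
    \<comment> \<open>The reduction modulo 1 puts the children of the residues 0, ..., p n - 1 into
      [0, 1].\<close>
    then have b: "bad (\<delta> / (2 * real K)) n (frac x)" by (rule bad_frac)
    show "p n \<le> 2 * K * k"
    proof (rule ccontr)
      assume "\<not> ?thesis"
      then obtain S where S: "S \<subseteq> {l. l < p n \<and> 1 / (2 * real K) \<le> weight n (frac x) (int l)}" "card S = k"
        and far: "\<And>a b. a \<in> S \<Longrightarrow> b \<in> S \<Longrightarrow> a \<noteq> b \<Longrightarrow>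
           1 / (4 * real K * real k) \<le> \<bar>child n (frac x) (int a) - child n (frac x) (int b)\<bar>"
        using few_large_weights[of k n "frac x"] K by auto
      define X where "X = (\<lambda>l. child n (frac x) (int l)) ` S"
      have fin: "finite S" using S(2) K by (intro card_ge_0_finite) simp
      have "inj_on (\<lambda>l. child n (frac x) (int l)) S"
        using p_pos[of n] by (auto simp: inj_on_def child_def)
      then have "card X = k" using S(2) by (simp add: X_def card_image)
      moreover have "X \<subseteq> {0..1}"
      proof -
        have "child n (frac x) (int l) \<in> {0..1}" if "l \<in> S" for l
        proof -
          have "real l + 1 \<le> real (p n)" using S(1) that by auto
          moreover have "0 \<le> frac x" "frac x < 1" by (auto simp: frac_lt_1)
          ultimately show ?thesis using p_pos[of n] by (simp add: child_def divide_le_eq)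
        qed
        then show ?thesis by (auto simp: X_def)
      qed
      moreover have "1 / (4 * real K * real k) \<le> \<bar>x - y\<bar>" if "x \<in> X" "y \<in> X" "x \<noteq> y" for x y
        using far that by (auto simp: X_def)
      moreover have "finite X" using fin by (simp add: X_def)
      ultimately obtain y where y: "y \<in> X" "\<delta> < (cmod (N (Suc n) y))\<^sup>2"
        using sep[of X "Suc n"] by blast
      then obtain l where l: "l \<in> S" "y = child n (frac x) (int l)" by (auto simp: X_def)
      then have "bad (\<delta> / (2 * real K) / (1 / (2 * real K))) (Suc n) y"
        unfolding l(2) using S(1) K by (intro bad_child_weight[OF b]) auto
      then have "bad \<delta> (Suc n) y" using K by simp
      from bad_N[OF this, of 0] y(2) show False by simp
    qed
  qed
qed

text \<open>Separation is measured on the circle: badness is invariant under integer translation,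
  and this separation passes to fractional parts, to which the bound on near-zeros applies.\<close>

definition config :: "real \<Rightarrow> real \<Rightarrow> nat \<Rightarrow> real set \<Rightarrow> bool" where
  "config \<epsilon> s n Y \<longleftrightarrow> finite Y \<and> (\<forall>y\<in>Y. bad \<epsilon> n y) \<and>
     (\<forall>y\<in>Y. \<forall>y'\<in>Y. y \<noteq> y' \<longrightarrow> (\<forall>k::int. s \<le> \<bar>y - y' - of_int k\<bar>))"

text \<open>Integer translates of children correspond to integer translates of parents, so distances
  on the circle shrink by a factor p n at most.\<close>

lemma child_diff:
  "child n y l - child n y' l' - of_int k = (y - y' - of_int (l' - l + int (p n) * k)) / real (p n)"
  using p_pos[of n] by (simp add: child_def field_simps)

text \<open>A weight close to \<open>1\<close> forces all exponentials in the mask to be close to the constant term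
  contributed by the digit \<open>0\<close>.\<close>
lemma weight_near_one:
  assumes "1 - real K * c \<le> weight n x l" "d \<in> D n" "d \<noteq> 0" "c \<ge> 0" "(real K)\<^sup>2 * c \<le> 2"
  shows "(cmod (echar (real_of_int d * child n x l) - 1))\<^sup>2 \<le> 4 * (real K)\<^sup>2 * c"
proof -
  let ?u = "child n x l"
  define q where "q = card (D n)"
  have q: "2 \<le> real q" "real q \<le> real K" using card_ge2[of n] card_le[of n] by (auto simp: q_def)
  have "1 - real K * c \<le> (cmod (digit_mask (D n) ?u))\<^sup>2" using assms(1) by (simp add: weight_def)
  also have "\<dots> \<le> cmod (digit_mask (D n) ?u)"
    using norm_mask_le[of "D n" ?u] by (simp add: power2_eq_square mult_left_le)
  finally have "real q * (1 - real K * c) \<le> real q * cmod (digit_mask (D n) ?u)"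
    by (intro mult_left_mono) auto
  also have "real q * cmod (digit_mask (D n) ?u) = cmod (\<Sum>d\<in>D n. echar (real_of_int d * ?u))"
    using q by (simp add: digit_mask_def q_def norm_divide)
  \<comment> \<open>With the digits 0 and d split off, the other q - 2 terms have modulus at most 1.
    So the modulus of 1 + e(dy) is nearly 2, and the parallelogram identity bounds that of e(dy) -
    1.\<close>
  also have "(\<Sum>d\<in>D n. echar (real_of_int d * ?u)) =
      (1 + echar (real_of_int d * ?u)) + (\<Sum>d\<in>D n - {0, d}. echar (real_of_int d * ?u))"
    using sum.subset_diff[of "{0, d}" "D n" "\<lambda>d. echar (real_of_int d * ?u)"] assms(2,3) zero_in[of n] finite_D[of n]
    by (simp add: add.commute)
  also have "cmod \<dots> \<le> cmod (1 + echar (real_of_int d * ?u)) + cmod (\<Sum>d\<in>D n - {0, d}. echar (real_of_int d * ?u))"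
    by (rule norm_triangle_ineq)
  also have "cmod (\<Sum>d\<in>D n - {0, d}. echar (real_of_int d * ?u)) \<le> (\<Sum>d\<in>D n - {0, d}. 1)"
    by (rule sum_norm_le) simp
  also have "(\<Sum>d\<in>D n - {0, d}. 1 :: real) = real q - 2"
    using assms(2,3) zero_in[of n] finite_D[of n] card_ge2[of n]
    by (simp add: q_def card_Diff_subset of_nat_diff)
  finally have "2 - real q * real K * c \<le> cmod (1 + echar (real_of_int d * ?u))" by (simp add: algebra_simps)
  moreover have "real q * real K * c \<le> (real K)\<^sup>2 * c"
    using q assms(4) by (simp add: power2_eq_square mult_right_mono)
  ultimately have "2 - (real K)\<^sup>2 * c \<le> cmod (1 + echar (real_of_int d * ?u))" by simp
  then have "(2 - (real K)\<^sup>2 * c)\<^sup>2 \<le> (cmod (1 + echar (real_of_int d * ?u)))\<^sup>2"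
    using assms(5) by (intro power_mono) auto
  moreover have "(2 - (real K)\<^sup>2 * c)\<^sup>2 \<ge> 4 - 4 * ((real K)\<^sup>2 * c)"
    by (simp add: power2_diff)
  ultimately show ?thesis
    using norm_echar_parallelogram[of "real_of_int d * ?u"] by simp
qed

text \<open>Let r be the difference of the children modulo integers. Both weights are near 1, so e(d
  r) is within 2 s / B of 1. If |r| < s, then |d r| \<le> 1/2 by the second condition on s, and
  Jordan's inequality gives 4 |r| \<le> 4 |d r| \<le> 2 s / B. But the separation of the parents
  gives |r| \<ge> s / B.\<close>

lemma separation_preserved:
  assumes B: "p n \<le> B" and s: "0 < s" "2 * (C * real B + 1) * s \<le> 1" "s \<le> 1"
    and c: "c = (s / (2 * real B * real K))\<^sup>2"
    and sep: "\<And>k::int. s \<le> \<bar>y - y' - of_int k\<bar>"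
    and w: "1 - real K * c \<le> weight n y l" "1 - real K * c \<le> weight n y' l'"
  shows "s \<le> \<bar>child n y l - child n y' l' - of_int k\<bar>"
proof (rule ccontr)
  assume "\<not> ?thesis"
  then have small: "\<bar>child n y l - child n y' l' - of_int k\<bar> < s" by simp
  define r where "r = child n y l - child n y' l' - of_int k"
  have B1: "real B \<ge> 2" using B p_ge2[of n] by linarith
  have K: "real K \<ge> 2" using K_ge2 by simp
  have c0: "c \<ge> 0" by (simp add: c)
  \<comment> \<open>The origin of the constant c: it makes the bound of
    \<open>weight_near_one\<close> equal to (s / B)^2.\<close>
  have Kc: "(2 * real K)\<^sup>2 * c = (s / real B)\<^sup>2"
    using K B1 by (simp add: c power_divide power_mult_distrib)
  have sB: "0 \<le> s / real B" "s / real B \<le> 1" using s B1 by (auto simp: divide_le_eq)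
  have "(real K)\<^sup>2 * c \<le> 2"
    using Kc power_le_one[OF sB, of 2] by (simp add: power_mult_distrib)
  obtain d where d: "d \<in> D n" "d \<noteq> 0"
  proof -
    have "\<not> D n \<subseteq> {0}" using card_ge2[of n] card_mono[of "{0}" "D n"] by auto
    then show thesis using that by auto
  qed
  have near: "cmod (echar (real_of_int d * child n x l) - 1) \<le> s / real B"
    if "1 - real K * c \<le> weight n x l" for x l
  proof (rule power2_le_imp_le)
    show "(cmod (echar (real_of_int d * child n x l) - 1))\<^sup>2 \<le> (s / real B)\<^sup>2"
      using weight_near_one[OF that d c0 \<open>(real K)\<^sup>2 * c \<le> 2\<close>] Kc by (simp add: power_mult_distrib)
  qed (use sB in auto)
  have d1: "1 \<le> real_of_int d" using digit_nonneg[OF d(1)] d(2) by simp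
  have "real_of_int d \<le> C * real B"
    using digit_le[OF d(1)] B C_nonneg by (meson mult_left_mono of_nat_le_iff order.trans)
  then have "\<bar>real_of_int d * r\<bar> \<le> (C * real B + 1) * s"
    using small d1 s C_nonneg unfolding abs_mult by (intro mult_mono) (auto simp: r_def)
  moreover have "2 * ((C * real B + 1) * s) \<le> 1" using s(2) by (simp only: mult.assoc)
  ultimately have half: "\<bar>real_of_int d * r\<bar> \<le> 1 / 2" by linarith
  have "echar (real_of_int d * child n y l) - echar (real_of_int d * child n y' l')
      = echar (real_of_int d * child n y' l') * (echar (real_of_int d * r) - 1)"
  proof -
    have "real_of_int d * child n y l = real_of_int d * child n y' l' + real_of_int d * r + of_int (d * k)"
      by (simp add: r_def algebra_simps)
    then show ?thesis by (simp only: echar_add echar_of_int) (simp add: algebra_simps)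
  qed
  then have "cmod (echar (real_of_int d * r) - 1) =
      cmod (echar (real_of_int d * child n y l) - echar (real_of_int d * child n y' l'))"
    by (simp add: norm_mult)
  also have "\<dots> \<le> s / real B + s / real B"
    using near[OF w(1)] near[OF w(2)] norm_triangle_ineq4[of "echar (real_of_int d * child n y l) - 1"
        "echar (real_of_int d * child n y' l') - 1"] by simp
  finally have "4 * \<bar>real_of_int d * r\<bar> \<le> 2 * (s / real B)"
    using norm_echar_diff_ge[OF half] by simp
  moreover have "\<bar>r\<bar> \<le> \<bar>real_of_int d * r\<bar>"
    using d1 mult_right_mono[of 1 "real_of_int d" "\<bar>r\<bar>"] by (simp add: abs_mult)
  moreover have "s / real B \<le> \<bar>r\<bar>"
  proof -
    have "s / real B \<le> s / real (p n)" using B s p_pos[of n] by (intro divide_left_mono) auto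
    also have "\<dots> \<le> \<bar>y - y' - of_int (l' - l + int (p n) * k)\<bar> / real (p n)"
      by (intro divide_right_mono sep) auto
    also have "\<dots> = \<bar>r\<bar>" unfolding r_def child_diff by simp
    finally show ?thesis .
  qed
  ultimately have "4 * (s / real B) \<le> 2 * (s / real B)" by linarith
  moreover have "s / real B > 0" using s B1 by simp
  ultimately show False by simp
qed

section \<open>Branching of bad frequencies\<close>

lemma card_image_separated:
  fixes f :: "real \<Rightarrow> real"
  assumes "s > 0" "\<And>y y'. y \<in> Y \<Longrightarrow> y' \<in> Y \<Longrightarrow> y \<noteq> y' \<Longrightarrow> s \<le> \<bar>f y - f y'\<bar>"
  shows "card (f ` Y) = card Y"
proof (rule card_image, rule inj_onI, rule ccontr)
  fix y y' assume "y \<in> Y" "y' \<in> Y" "f y = f y'" "y \<noteq> y'"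
  then show False using assms(1) assms(2)[of y y'] by simp
qed

text \<open>Every point passes to a child as bad as itself. If some point has a second child of
  weight at least c, that child is added, at the price of the factors c and B. Otherwise all chosen
  children have weight near 1, so nothing is lost, and \<open>second_child\<close> excludes p n >
  card (D n).\<close>

lemma branching_step:
  assumes Y: "config \<epsilon> s n Y" "Y \<noteq> {}" and bnd: "\<forall>x. bad \<epsilon> n x \<longrightarrow> p n \<le> B"
    and B: "B > 0" and s: "0 < s" "2 * (C * real B + 1) * s \<le> 1" "s \<le> 1"
    and c: "c = (s / (2 * real B * real K))\<^sup>2"
  shows "(\<exists>Y'. config (\<epsilon> / c) (s / real B) (Suc n) Y' \<and> card Y' = Suc (card Y)) \<or>
    (p n \<le> card (D n) \<and> (\<exists>Y'. config \<epsilon> s (Suc n) Y' \<and> card Y' = card Y))"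
proof -
  have K: "real K \<ge> 2" using K_ge2 by simp
  have B1: "real B \<ge> 1" using B by simp
  have finY: "finite Y" and badY: "\<And>y. y \<in> Y \<Longrightarrow> bad \<epsilon> n y"
    and sepY: "\<And>y y' k. y \<in> Y \<Longrightarrow> y' \<in> Y \<Longrightarrow> y \<noteq> y' \<Longrightarrow> s \<le> \<bar>y - y' - of_int k\<bar>"
    using Y(1) by (auto simp: config_def)
  have pB: "p n \<le> B" using Y(2) badY bnd by blast
  have c0: "c > 0" using s K B1 by (simp add: c)
  \<comment> \<open>The weight guaranteed by \<open>second_child\<close> must reach the threshold
    c.\<close>
  have c1: "c \<le> 1 / (real K * real B)"
  proof -
    have "s / (2 * real B * real K) \<le> 1 / (real K * real B)"
      using s K B1 by (simp add: divide_le_eq field_simps)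
    moreover have "s / (2 * real B * real K) \<le> 1"
      using s K B1 mult_mono[of 1 "real B" 1 "real K"] by (simp add: divide_le_eq)
    moreover have "0 \<le> s / (2 * real B * real K)" using s by simp
    ultimately show ?thesis
      unfolding c power2_eq_square by (meson mult_left_le order.trans)
  qed
  have eps: "\<epsilon> \<le> \<epsilon> / c"
  proof -
    obtain y where "y \<in> Y" using Y(2) by blast
    then have "\<epsilon> > 0" using badY bad_pos by blast
    moreover have "1 / (real K * real B) \<le> 1"
      using K B1 mult_mono[of 1 "real K" 1 "real B"] by (simp add: divide_le_eq)
    then have "c \<le> 1" using c1 by linarith
    ultimately show ?thesis using c0 by (simp add: le_divide_eq mult_left_le)
  qed
  obtain l where l: "\<And>y. y \<in> Y \<Longrightarrow> bad \<epsilon> (Suc n) (child n y (l y))"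
    and dich: "\<And>y. y \<in> Y \<Longrightarrow> (\<exists>l'. \<not> int (p n) dvd l' - l y \<and> c \<le> weight n y l') \<or> 1 - real K * c \<le> weight n y (l y)"
  proof -
    have "\<exists>l. bad \<epsilon> (Suc n) (child n y l) \<and>
        ((\<exists>l'. \<not> int (p n) dvd l' - l \<and> c \<le> weight n y l') \<or> 1 - real K * c \<le> weight n y l)" if "y \<in> Y" for y
      using bad_dichotomy[OF badY[OF that] c0] by blast
    then show thesis using that by metis
  qed
  have sep_diff: "s / real B \<le> \<bar>child n y a - child n y' b - of_int k\<bar>"
    if "y \<in> Y" "y' \<in> Y" "y \<noteq> y'" for y y' a b k
  proof -
    have "s / real B \<le> s / real (p n)" using pB s p_pos[of n] by (intro divide_left_mono) auto
    also have "\<dots> \<le> \<bar>y - y' - of_int (b - a + int (p n) * k)\<bar> / real (p n)"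
      by (intro divide_right_mono sepY that) auto
    also have "\<dots> = \<bar>child n y a - child n y' b - of_int k\<bar>" unfolding child_diff by simp
    finally show ?thesis .
  qed
  \<comment> \<open>Two children of one parent at incongruent residues are at least 1 / p n apart on
    the circle, and s \<le> 1.\<close>
  have sep_same: "s / real B \<le> \<bar>child n y a - child n y b - of_int k\<bar>"
    if "\<not> int (p n) dvd a - b" for y a b k
  proof -
    have "b - a + int (p n) * k \<noteq> 0"
    proof
      assume "b - a + int (p n) * k = 0"
      then have "a - b = int (p n) * k" by simp
      with that show False by simp
    qed
    then have "1 \<le> \<bar>b - a + int (p n) * k\<bar>" by linarith
    then have "(1::real) \<le> \<bar>of_int (b - a + int (p n) * k)\<bar>"
      by (metis of_int_1_le_iff of_int_abs)
    have "s / real B \<le> 1 / real (p n)" using pB s p_pos[of n] by (intro frac_le) auto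
    also have "\<dots> \<le> \<bar>of_int (b - a + int (p n) * k)\<bar> / real (p n)"
      by (rule divide_right_mono) (fact, simp)
    also have "\<dots> = \<bar>child n y a - child n y b - of_int k\<bar>"
      unfolding child_diff by (simp del: of_int_add of_int_diff of_int_mult)
    finally show ?thesis .
  qed
  define Z where "Z = (\<lambda>y. child n y (l y)) ` Y"
  have sB: "s / real B > 0" using s B1 by simp
  have cardZ: "card Z = card Y"
    unfolding Z_def
  proof (rule card_image_separated[OF sB])
    fix y y' assume "y \<in> Y" "y' \<in> Y" "y \<noteq> y'"
    from sep_diff[OF this, of "l y" "l y'" 0] show "s / real B \<le> \<bar>child n y (l y) - child n y' (l y')\<bar>"
      by simp
  qed
  have finZ: "finite Z" using finY by (simp add: Z_def)
  show ?thesis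
  proof (cases "\<exists>y\<in>Y. \<exists>l'. \<not> int (p n) dvd l' - l y \<and> c \<le> weight n y l'")
    case True
    then obtain y l' where y: "y \<in> Y" and l': "\<not> int (p n) dvd l' - l y" "c \<le> weight n y l'" by blast
    define z where "z = child n y l'"
    have bad_z: "bad (\<epsilon> / c) (Suc n) z"
      unfolding z_def by (rule bad_child_weight[OF badY[OF y] c0 l'(2)])
    have z_sep: "s / real B \<le> \<bar>z - child n y' (l y') - of_int k\<bar>" if "y' \<in> Y" for y' k
      using sep_same[OF l'(1)] sep_diff[OF y that] by (cases "y = y'") (auto simp: z_def)
    have z_sep': "s / real B \<le> \<bar>child n y' (l y') - z - of_int k\<bar>" if "y' \<in> Y" for y' k
      using z_sep[OF that, of "- k"] by (simp add: abs_minus_commute algebra_simps)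
    have "z \<notin> Z"
    proof
      assume "z \<in> Z"
      then obtain y' where "y' \<in> Y" "z = child n y' (l y')" by (auto simp: Z_def)
      with z_sep[of y' 0] sB show False by simp
    qed
    then have "card (insert z Z) = Suc (card Y)" using finZ cardZ by simp
    moreover have "config (\<epsilon> / c) (s / real B) (Suc n) (insert z Z)"
      unfolding config_def
    proof (intro conjI ballI impI allI)
      show "finite (insert z Z)" using finZ by simp
      show "bad (\<epsilon> / c) (Suc n) u" if "u \<in> insert z Z" for u
        using that bad_z bad_mono[OF l eps] by (auto simp: Z_def)
      show "s / real B \<le> \<bar>u - v - of_int k\<bar>" if "u \<in> insert z Z" "v \<in> insert z Z" "u \<noteq> v" for u v k
        using that z_sep z_sep' sep_diff unfolding Z_def by blast
    qed
    ultimately show ?thesis by blast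
  next
    case False
    have "p n \<le> card (D n)"
    proof (rule ccontr)
      assume "\<not> ?thesis"
      obtain y where y: "y \<in> Y" using Y(2) by blast
      obtain l' where l': "\<not> int (p n) dvd l' - l y" "1 / (real K * real B) \<le> weight n y l'"
        using second_child[of n B "l y" y] pB \<open>\<not> p n \<le> card (D n)\<close> by (auto simp: not_le)
      then have "c \<le> weight n y l'" using c1 by linarith
      with l'(1) y False show False by blast
    qed
    moreover have "config \<epsilon> s (Suc n) Z"
      unfolding config_def
    proof (intro conjI ballI impI allI)
      show "finite Z" by (rule finZ)
      show "bad \<epsilon> (Suc n) u" if "u \<in> Z" for u
        using that l by (auto simp: Z_def)
      show "s \<le> \<bar>u - v - of_int k\<bar>" if uv: "u \<in> Z" "v \<in> Z" "u \<noteq> v" for u v k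
      proof -
        obtain y y' where y: "y \<in> Y" "y' \<in> Y" "u = child n y (l y)" "v = child n y' (l y')" "y \<noteq> y'"
          using uv by (auto simp: Z_def)
        have "1 - real K * c \<le> weight n y (l y)" "1 - real K * c \<le> weight n y' (l y')"
          using False dich y by blast+
        with separation_preserved[OF pB s c sepY[OF y(1,2,5)]] show ?thesis by (simp add: y)
      qed
    qed
    ultimately show ?thesis using cardZ by blast
  qed
qed

text \<open>Induction on the distance to a level with p > card D. Before it, a step that does not
  branch keeps both parameters, however long the wait; at that level branching is forced.\<close>

lemma branching:
  assumes bnd: "\<And>n x. bad \<epsilon> n x \<Longrightarrow> p n \<le> B"
    and B: "B > 0" and s: "0 < s" "2 * (C * real B + 1) * s \<le> 1" "s \<le> 1"
    and c: "c = (s / (2 * real B * real K))\<^sup>2"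
    and inf: "infinite {j. p j > card (D j)}"
    and Y: "config \<epsilon> s n Y" "Y \<noteq> {}"
  shows "\<exists>m Y'. config (\<epsilon> / c) (s / real B) m Y' \<and> card Y' = Suc (card Y)"
proof -
  have bnd': "\<forall>x. bad \<epsilon> n x \<longrightarrow> p n \<le> B" for n
    using bnd by blast
  have "\<exists>m Y'. config (\<epsilon> / c) (s / real B) m Y' \<and> card Y' = Suc (card Y)"
    if "p (n + j) > card (D (n + j))" "config \<epsilon> s n Y" "Y \<noteq> {}" for j n Y
    using that
  proof (induction j arbitrary: n Y)
    case 0
    with branching_step[OF 0(2,3) bnd' B s c] show ?case by auto
  next
    case (Suc j)
    consider Y' where "config (\<epsilon> / c) (s / real B) (Suc n) Y'" "card Y' = Suc (card Y)"
      | Y' where "config \<epsilon> s (Suc n) Y'" "card Y' = card Y"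
      using branching_step[OF Suc.prems(2,3) bnd' B s c] by auto
    then show ?case
    proof cases
      case 1
      then show ?thesis by blast
    next
      case 2
      have "card Y > 0" using Suc.prems(2,3) by (auto simp: config_def card_gt_0_iff)
      then have "Y' \<noteq> {}" using 2(2) by auto
      with Suc.IH[of "Suc n" Y'] Suc.prems(1) 2 show ?thesis by auto
    qed
  qed
  moreover obtain r where "r \<ge> n" "p r > card (D r)"
    using inf by (auto simp: infinite_nat_iff_unbounded_le)
  then have "p (n + (r - n)) > card (D (n + (r - n)))" by simp
  ultimately show ?thesis using Y by blast
qed

text \<open>The constants s and c depend on the number of branchings but not on the bad point, its
  level or \<epsilon>; this gives uniformity in the end.\<close>

lemma large_configs:
  assumes inf: "infinite {j. p j > card (D j)}" and "B > 0" "\<epsilon>0 > 0"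
    and bnd: "\<forall>n x. bad \<epsilon>0 n x \<longrightarrow> p n \<le> B"
  shows "\<exists>s c. 0 < s \<and> 2 * (C * real B + 1) * s \<le> 1 \<and> s \<le> 1 \<and> 0 < c \<and>
    (\<forall>\<epsilon> n x. \<epsilon> \<le> c * \<epsilon>0 \<longrightarrow> bad \<epsilon> n x \<longrightarrow> (\<exists>m Y. config (\<epsilon> / c) s m Y \<and> card Y = Suc j))"
proof (induction j)
  case 0
  \<comment> \<open>The largest value that \<open>separation_preserved\<close> admits. Later values
    are smaller and satisfy the same conditions.\<close>
  define s where "s = 1 / (2 * (C * real B + 1))"
  have pos: "2 * (C * real B + 1) \<ge> 2" using C_nonneg by simp
  then have "0 < s" "2 * (C * real B + 1) * s \<le> 1" "s \<le> 1" by (auto simp: s_def)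
  moreover have "config (\<epsilon> / 1) s n {x} \<and> card {x} = Suc 0" if "bad \<epsilon> n x" for \<epsilon> n x
    using that by (simp add: config_def)
  ultimately show ?case by (rule_tac x = s in exI, rule_tac x = 1 in exI) force
next
  case (Suc j)
  then obtain s c where s: "0 < s" "2 * (C * real B + 1) * s \<le> 1" "s \<le> 1" and c: "0 < c"
    and IH: "\<And>\<epsilon> n x. \<epsilon> \<le> c * \<epsilon>0 \<Longrightarrow> bad \<epsilon> n x \<Longrightarrow> \<exists>m Y. config (\<epsilon> / c) s m Y \<and> card Y = Suc j"
    by blast
  define c' where "c' = (s / (2 * real B * real K))\<^sup>2"
  have B1: "real B \<ge> 1" using \<open>B > 0\<close> by simp
  have K: "real K \<ge> 2" using K_ge2 by simp
  have c'0: "0 < c'" using s(1) B1 K by (simp add: c'_def)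
  have c'1: "c' \<le> 1"
    unfolding c'_def using s B1 K mult_mono[of 1 "real B" 1 "real K"]
    by (intro power_le_one) (auto simp: divide_le_eq)
  have sB: "0 < s / real B" "s / real B \<le> s" using s B1 by (auto simp: divide_le_eq mult_left_le)
  have "2 * (C * real B + 1) * (s / real B) \<le> 2 * (C * real B + 1) * s"
    using C_nonneg sB by (intro mult_left_mono) auto
  then have "2 * (C * real B + 1) * (s / real B) \<le> 1" using s by linarith
  moreover have "s / real B \<le> 1" using sB s by linarith
  moreover have "\<exists>m Y. config (\<epsilon> / (c * c')) (s / real B) m Y \<and> card Y = Suc (Suc j)"
    if \<epsilon>: "\<epsilon> \<le> c * c' * \<epsilon>0" and b: "bad \<epsilon> n x" for \<epsilon> n x
  proof -
    \<comment> \<open>The points reached so far must still be \<epsilon>0-bad, since only there is p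
      n bounded by B.\<close>
    have "\<epsilon> / c \<le> c' * \<epsilon>0" using \<epsilon> c by (simp add: divide_le_eq mult_ac)
    also have "\<dots> \<le> \<epsilon>0" using c'1 \<open>\<epsilon>0 > 0\<close> by (simp add: mult_left_le_one_le)
    finally have le: "\<epsilon> / c \<le> \<epsilon>0" .
    then have "\<epsilon> \<le> c * \<epsilon>0" using c by (simp add: divide_le_eq mult_ac)
    from IH[OF this b] obtain m Y where Y: "config (\<epsilon> / c) s m Y" "card Y = Suc j" by blast
    have "Y \<noteq> {}" using Y(2) by auto
    have "\<And>n x. bad (\<epsilon> / c) n x \<Longrightarrow> p n \<le> B" using bnd bad_mono[OF _ le] by blast
    from branching[OF this \<open>B > 0\<close> s c'_def inf Y(1) \<open>Y \<noteq> {}\<close>] Y(2) show ?thesis by simp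
  qed
  ultimately show ?case
    using sB c c'0 by (rule_tac x = "s / real B" in exI, rule_tac x = "c * c'" in exI) simp
qed

text \<open>After k - 1 branchings a bad point would yield k separated near-zeros of one tail
  transform.\<close>

lemma uniformly_not_bad:
  assumes inf: "infinite {j. p j > card (D j)}"
  shows "\<exists>\<epsilon>>0. \<forall>n x. \<not> bad \<epsilon> n x"
proof -
  obtain k where k: "zero_bound k" using zero_bound_ex by blast
  then have "k > 0" by (simp add: zero_bound_def)
  obtain \<epsilon>0 where \<epsilon>0: "\<epsilon>0 > 0" "\<forall>n x. bad \<epsilon>0 n x \<longrightarrow> p n \<le> 2 * K * k"
    using bad_scale_bounded[OF k] by blast
  have "2 * K * k > 0" using \<open>k > 0\<close> K_ge2 by simp
  from large_configs[OF inf this \<epsilon>0, where j = "k - 1"] obtain s c where s: "0 < s" "0 < c"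
    and large': "\<forall>\<epsilon> n x. \<epsilon> \<le> c * \<epsilon>0 \<longrightarrow> bad \<epsilon> n x \<longrightarrow> (\<exists>m Y. config (\<epsilon> / c) s m Y \<and> card Y = Suc (k - 1))"
    by blast
  have large: "\<exists>m Y. config (\<epsilon> / c) s m Y \<and> card Y = k" if "\<epsilon> \<le> c * \<epsilon>0" "bad \<epsilon> n x" for \<epsilon> n x
    using large' that \<open>k > 0\<close> by (metis Suc_diff_1)
  obtain \<delta> where \<delta>: "\<delta> > 0" and zb: "\<And>n X. finite X \<Longrightarrow> card X = k \<Longrightarrow> X \<subseteq> {0..1} \<Longrightarrow>
     (\<And>x y. x \<in> X \<Longrightarrow> y \<in> X \<Longrightarrow> x \<noteq> y \<Longrightarrow> s \<le> \<bar>x - y\<bar>) \<Longrightarrow> \<exists>x\<in>X. \<delta> < (cmod (N n x))\<^sup>2"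
    using zero_boundE[OF k s(1)] by blast
  \<comment> \<open>The factor c pays for the branchings; \<epsilon>0 keeps p n bounded on the way,
    and \<delta> makes the final points contradict the bound on near-zeros.\<close>
  define \<epsilon> where "\<epsilon> = c * min \<epsilon>0 \<delta>"
  have \<epsilon>: "\<epsilon> > 0" "\<epsilon> \<le> c * \<epsilon>0" "\<epsilon> / c \<le> \<delta>"
    using s \<epsilon>0 \<delta> by (auto simp: \<epsilon>_def)
  have False if bad: "bad \<epsilon> n x" for n x
  proof -
    obtain m Y where Y: "config (\<epsilon> / c) s m Y" "card Y = k"
      using large[OF \<epsilon>(2) bad] by blast
    have sep: "s \<le> \<bar>frac y - frac y'\<bar>" if "y \<in> Y" "y' \<in> Y" "y \<noteq> y'" for y y'
    proof -
      have "s \<le> \<bar>y - y' - of_int (\<lfloor>y\<rfloor> - \<lfloor>y'\<rfloor>)\<bar>" using Y(1) that unfolding config_def by blast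
      then show ?thesis by (simp add: frac_def algebra_simps)
    qed
    have "card (frac ` Y) = k" using card_image_separated[OF s(1) sep] Y(2) by simp
    moreover have "finite (frac ` Y)" using Y(1) by (simp add: config_def)
    moreover have "frac ` Y \<subseteq> {0..1}" by (auto simp: less_imp_le[OF frac_lt_1])
    moreover have "s \<le> \<bar>u - v\<bar>" if "u \<in> frac ` Y" "v \<in> frac ` Y" "u \<noteq> v" for u v
      using that sep by blast
    ultimately obtain u where u: "u \<in> frac ` Y" "\<delta> < (cmod (N m u))\<^sup>2"
      using zb[of "frac ` Y" m] by blast
    then have "bad (\<epsilon> / c) m u" using Y(1) bad_frac by (auto simp: config_def)
    from bad_N[OF this, of 0] u(2) \<epsilon>(3) show False by simp
  qed
  then show ?thesis using \<epsilon>(1) by blast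
qed

section \<open>Construction of the spectrum\<close>

definition mass :: "int set \<Rightarrow> real \<Rightarrow> real" where
  "mass S \<xi> = (\<Sum>s\<in>S. (cmod (N 0 (\<xi> + of_int s)))\<^sup>2)"

text \<open>Bessel's inequality: the tail factor of \<open>N 0\<close> has modulus at most
  1.\<close>

lemma mass_le_1: "block_spectrum 0 n S \<Longrightarrow> mass S \<xi> \<le> 1"
proof -
  assume S: "block_spectrum 0 n S"
  have "mass S \<xi> \<le> (\<Sum>s\<in>S. (cmod (M 0 n (\<xi> + of_int s)))\<^sup>2)"
    unfolding mass_def by (intro sum_mono power_mono norm_N_le_M) auto
  then show ?thesis using S by (simp add: block_spectrum_def)
qed

lemma mass_mono: "finite S' \<Longrightarrow> S \<subseteq> S' \<Longrightarrow> mass S \<xi> \<le> mass S' \<xi>"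
  unfolding mass_def by (intro sum_mono2) auto

text \<open>First extend by \<open>0\<close> to a level \<open>m\<close> at which almost all of the mass missing from \<open>S\<close> sits on new
  frequencies; then prolong each new frequency so that it keeps the fraction \<open>\<epsilon>\<close> of its mass.\<close>
lemma mass_increase:
  assumes good: "\<And>n x. \<not> bad \<epsilon> n x" and "\<epsilon> > 0" and S: "block_spectrum 0 n S" and "\<delta> > 0"
  shows "\<exists>n' S'. block_spectrum 0 n' S' \<and> S \<subseteq> S' \<and> mass S \<xi> + \<epsilon> * (1 - mass S \<xi> - \<delta>) \<le> mass S' \<xi>"
proof -
  have "(\<lambda>m. \<Sum>s\<in>S. (cmod (M 0 m (\<xi> + of_int s)))\<^sup>2) \<longlonglongrightarrow> mass S \<xi>"
    unfolding mass_def by (intro tendsto_intros M_tendsto)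
  then have "\<forall>\<^sub>F m in sequentially. (\<Sum>s\<in>S. (cmod (M 0 m (\<xi> + of_int s)))\<^sup>2) < mass S \<xi> + \<delta>"
    by (rule order_tendstoD) (use \<open>\<delta> > 0\<close> in simp)
  then have "\<forall>\<^sub>F m in sequentially. n \<le> m \<and> (\<Sum>s\<in>S. (cmod (M 0 m (\<xi> + of_int s)))\<^sup>2) < mass S \<xi> + \<delta>"
    using eventually_ge_at_top[of n] by eventually_elim simp
  then obtain m where m: "n \<le> m" "(\<Sum>s\<in>S. (cmod (M 0 m (\<xi> + of_int s)))\<^sup>2) < mass S \<xi> + \<delta>"
    using eventually_happens' sequentially_bot by blast
  obtain Z where Z: "block_spectrum n m Z" "0 \<in> Z" using block_spectrum_zero[OF m(1)] .
  define T where "T = extend 0 n S (\<lambda>_. Z)"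
  have T: "block_spectrum 0 m T" unfolding T_def by (rule block_spectrum_extend[OF S Z(1)])
  have ST: "S \<subseteq> T" unfolding T_def using Z by (intro subset_extend) auto
  have fin: "finite T" using T by (simp add: block_spectrum_def)
  define x where "x s = (\<xi> + of_int s) / real (P 0 m)" for s
  have "\<forall>s\<in>T. \<forall>\<^sub>F r in sequentially. \<exists>U. block_spectrum m r U \<and>
      \<epsilon> \<le> (\<Sum>u\<in>U. (cmod (N m (x s + of_int u)))\<^sup>2)"
    using not_bad_eventually[OF good] by blast
  then have "\<forall>\<^sub>F r in sequentially. \<forall>s\<in>T. \<exists>U. block_spectrum m r U \<and>
      \<epsilon> \<le> (\<Sum>u\<in>U. (cmod (N m (x s + of_int u)))\<^sup>2)"
    using fin by (simp add: eventually_ball_finite_distrib)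
  then have "\<forall>\<^sub>F r in sequentially. m \<le> r \<and> (\<forall>s\<in>T. \<exists>U. block_spectrum m r U \<and>
      \<epsilon> \<le> (\<Sum>u\<in>U. (cmod (N m (x s + of_int u)))\<^sup>2))"
    using eventually_ge_at_top[of m] by eventually_elim simp
  then obtain r where "m \<le> r" "\<forall>s\<in>T. \<exists>U. block_spectrum m r U \<and>
      \<epsilon> \<le> (\<Sum>u\<in>U. (cmod (N m (x s + of_int u)))\<^sup>2)"
    using eventually_happens' sequentially_bot by blast
  then obtain V where V: "\<And>s. s \<in> T \<Longrightarrow> block_spectrum m r (V s)"
      and ge: "\<And>s. s \<in> T \<Longrightarrow> \<epsilon> \<le> (\<Sum>u\<in>V s. (cmod (N m (x s + of_int u)))\<^sup>2)"
    by metis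
  obtain W where W: "block_spectrum m r W" "0 \<in> W" using block_spectrum_zero[OF \<open>m \<le> r\<close>] .
  define U where "U s = (if s \<in> S then W else V s)" for s
  have U: "block_spectrum m r (U s)" if "s \<in> T" for s using V W that by (simp add: U_def)
  have finU: "finite (U s)" if "s \<in> T" for s using U[OF that] by (simp add: block_spectrum_def)
  define S' where "S' = extend 0 m T U"
  have "block_spectrum 0 r S'" unfolding S'_def by (rule block_spectrum_extend[OF T U])
  moreover have "S \<subseteq> S'" unfolding S'_def using W ST by (intro subset_extend) (auto simp: U_def)
  moreover have "mass S \<xi> + \<epsilon> * (1 - mass S \<xi> - \<delta>) \<le> mass S' \<xi>"
  proof -
    define w where "w s = (cmod (M 0 m (\<xi> + of_int s)))\<^sup>2" for s
    define v where "v s = (\<Sum>u\<in>U s. (cmod (N m (x s + of_int u)))\<^sup>2)" for s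
    have "(\<Sum>s\<in>T. w s) = 1" using T by (simp add: block_spectrum_def w_def)
    then have "(\<Sum>s\<in>T - S. w s) = 1 - (\<Sum>s\<in>S. w s)"
      using sum.subset_diff[OF ST fin, of w] by simp
    also have "\<dots> \<ge> 1 - mass S \<xi> - \<delta>" using m(2) by (simp add: w_def)
    finally have "\<epsilon> * (1 - mass S \<xi> - \<delta>) \<le> \<epsilon> * (\<Sum>s\<in>T - S. w s)"
      using \<open>\<epsilon> > 0\<close> by simp
    also have "\<dots> = (\<Sum>s\<in>T - S. w s * \<epsilon>)" by (simp add: sum_distrib_left mult.commute)
    also have "\<dots> \<le> (\<Sum>s\<in>T - S. w s * v s)"
      using ge by (intro sum_mono mult_left_mono) (auto simp: w_def v_def U_def)
    finally have 1: "\<epsilon> * (1 - mass S \<xi> - \<delta>) \<le> (\<Sum>s\<in>T - S. w s * v s)" .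
    have "mass S \<xi> \<le> (\<Sum>s\<in>S. w s * v s)"
      unfolding mass_def
    proof (rule sum_mono)
      fix s assume "s \<in> S"
      have "(cmod (N 0 (\<xi> + of_int s)))\<^sup>2 = w s * (cmod (N m (x s + of_int 0)))\<^sup>2"
        using N_split[of 0 m "\<xi> + of_int s"] by (simp add: w_def x_def norm_mult power_mult_distrib)
      also have "\<dots> \<le> w s * v s"
        unfolding v_def using W \<open>s \<in> S\<close> finU[of s] ST
        by (intro mult_left_mono member_le_sum) (auto simp: U_def w_def)
      finally show "(cmod (N 0 (\<xi> + of_int s)))\<^sup>2 \<le> w s * v s" .
    qed
    with 1 have "mass S \<xi> + \<epsilon> * (1 - mass S \<xi> - \<delta>) \<le> (\<Sum>s\<in>T. w s * v s)"
      using sum.subset_diff[OF ST fin, of "\<lambda>s. w s * v s"] by simp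
    also have "\<dots> = mass S' \<xi>"
      unfolding S'_def mass_def using sum_N_extend[OF T finU order.refl, where x = \<xi>] by (simp add: w_def v_def x_def)
    finally show ?thesis .
  qed
  ultimately show ?thesis by blast
qed

text \<open>Each step serves one rational frequency. The masses of a fixed frequency increase to
  some l; along the steps devoted to it the gain forces l + \<epsilon> (1 - l) \<le> l, hence l =
  1.\<close>

lemma spectrum_sequence:
  assumes inf: "infinite {j. p j > card (D j)}"
  obtains S :: "nat \<Rightarrow> int set" where "incseq S" "\<And>k. finite (S k)"
    "\<And>k a b. a \<in> S k \<Longrightarrow> b \<in> S k \<Longrightarrow> a \<noteq> b \<Longrightarrow> N 0 (of_int (a - b)) = 0"
    "\<And>\<xi>. \<xi> \<in> \<rat> \<Longrightarrow> (\<lambda>k. mass (S k) \<xi>) \<longlonglongrightarrow> 1"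
proof -
  obtain \<epsilon> where \<epsilon>: "\<epsilon> > 0" "\<And>n x. \<not> bad \<epsilon> n x" using uniformly_not_bad[OF inf] by blast
  define q :: "nat \<Rightarrow> real" where "q = from_nat_into \<rat>"
  \<comment> \<open>Pair decoding makes every rational recur infinitely often.\<close>
  define \<xi> where "\<xi> k = q (fst (prod_decode k))" for k
  define \<delta> :: "nat \<Rightarrow> real" where "\<delta> k = (1 / 2) ^ k" for k
  define R where "R k a b \<longleftrightarrow> snd a \<subseteq> snd b \<and>
    mass (snd a) (\<xi> k) + \<epsilon> * (1 - mass (snd a) (\<xi> k) - \<delta> k) \<le> mass (snd b) (\<xi> k)"
    for k and a b :: "nat \<times> int set"
  have "\<exists>f. \<forall>k. block_spectrum 0 (fst (f k)) (snd (f k)) \<and> R k (f k) (f (Suc k))"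
  proof (rule dependent_nat_choice)
    show "\<exists>x. block_spectrum 0 (fst x) (snd x)"
      using block_spectrum_refl[of 0 0] by (intro exI[of _ "(0, {0})"]) simp
  next
    fix a :: "nat \<times> int set" and k
    assume "block_spectrum 0 (fst a) (snd a)"
    from mass_increase[OF \<epsilon>(2,1) this, of "\<delta> k" "\<xi> k"]
    show "\<exists>b. block_spectrum 0 (fst b) (snd b) \<and> R k a b"
      by (auto simp: R_def \<delta>_def)
  qed
  then obtain f where bs: "\<And>k. block_spectrum 0 (fst (f k)) (snd (f k))" and R: "\<And>k. R k (f k) (f (Suc k))"
    by blast
  define S where "S k = snd (f k)" for k
  have fin: "finite (S k)" for k using bs[of k] by (simp add: S_def block_spectrum_def)
  have inc: "incseq S" by (rule incseq_SucI) (use R in \<open>auto simp: R_def S_def\<close>)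
  show thesis
  proof (rule that[OF inc fin])
    fix k a b assume "a \<in> S k" "b \<in> S k" "a \<noteq> b"
    then have "M 0 (fst (f k)) (of_int (a - b)) = 0"
      unfolding S_def by (intro block_spectrum_orthogonal[OF bs])
    then show "N 0 (of_int (a - b)) = 0"
      using N_split[of 0 "fst (f k)" "of_int (a - b)"] by simp
  next
    fix \<eta> :: real assume "\<eta> \<in> \<rat>"
    then obtain i where i: "q i = \<eta>"
      unfolding q_def using from_nat_into_surj[OF countable_rat] by blast
    have mono: "incseq (\<lambda>k. mass (S k) \<eta>)"
      using inc fin by (intro incseq_SucI mass_mono) (auto simp: incseq_Suc_iff)
    have "\<forall>k. mass (S k) \<eta> \<le> 1" using mass_le_1[OF bs] by (simp add: S_def)
    then obtain l where l: "(\<lambda>k. mass (S k) \<eta>) \<longlonglongrightarrow> l"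
      using incseq_convergent[OF mono] by metis
    define g where "g j = prod_encode (i, j)" for j
    have "j \<le> g j" for j by (simp add: g_def le_prod_encode_2)
    then have g: "filterlim g at_top sequentially"
      by (intro filterlim_at_top_mono[OF filterlim_ident]) auto
    have g': "filterlim (\<lambda>j. Suc (g j)) at_top sequentially"
      by (rule filterlim_compose[OF filterlim_Suc g])
    have "\<xi> (g j) = \<eta>" for j by (simp add: \<xi>_def g_def i)
    then have step: "mass (S (g j)) \<eta> + \<epsilon> * (1 - mass (S (g j)) \<eta> - \<delta> (g j)) \<le> mass (S (Suc (g j))) \<eta>" for j
      using R[of "g j"] by (simp add: R_def S_def)
    have \<delta>: "\<delta> \<longlonglongrightarrow> 0" unfolding \<delta>_def by (rule LIMSEQ_power_zero) simp
    have "(\<lambda>j. mass (S (g j)) \<eta> + \<epsilon> * (1 - mass (S (g j)) \<eta> - \<delta> (g j))) \<longlonglongrightarrow> l + \<epsilon> * (1 - l - 0)"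
      by (intro tendsto_intros filterlim_compose[OF l g] filterlim_compose[OF \<delta> g])
    moreover have "(\<lambda>j. mass (S (Suc (g j))) \<eta>) \<longlonglongrightarrow> l" by (rule filterlim_compose[OF l g'])
    ultimately have "l + \<epsilon> * (1 - l - 0) \<le> l"
      using step by (intro LIMSEQ_le) auto
    then have "1 \<le> l" using \<epsilon> by (simp add: mult_le_0_iff)
    moreover have "l \<le> 1"
      using mass_le_1[OF bs] by (intro LIMSEQ_le_const2[OF l]) (auto simp: S_def)
    ultimately show "(\<lambda>k. mass (S k) \<eta>) \<longlonglongrightarrow> 1" using l by simp
  qed
qed

end

section \<open>Measures on the line\<close>

text \<open>Let \<open>V h\<close> consist of the points at distance at least h from the complement
  of U. For y in \<open>V h\<close> the interval of radius h about y lies in U, so by Fubini 2 h M(V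
  h) is at most the integral over U of M(x - h, x + h), which is at most 2 h \<kappa> |U|. Then h
  tends to 0.\<close>

lemma measure_lborel_dominated:
  assumes M: "real_distribution M" and "0 \<le> \<kappa>"
    and bound: "\<And>a b. a \<le> b \<Longrightarrow> measure M {a<..<b} \<le> \<kappa> * (b - a)" and U: "open U"
  shows "emeasure M U \<le> ennreal \<kappa> * emeasure lborel U"
proof -
  interpret real_distribution M by fact
  interpret pair_sigma_finite M lborel ..
  define V where "V h = - (\<Union>y\<in>- U. ball y h)" for h :: real
  have V_closed: "closed (V h)" for h unfolding V_def by (intro closed_Compl open_UN ballI open_ball)
  have V_ball: "x \<in> V h \<Longrightarrow> \<bar>x - y\<bar> < h \<Longrightarrow> y \<in> U" for x y h
    by (auto simp: V_def dist_real_def abs_minus_commute)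
  have [measurable]: "U \<in> sets borel" "V h \<in> sets borel" for h using U V_closed by auto
  have V_bound: "emeasure M (V h) \<le> ennreal \<kappa> * emeasure lborel U" if h: "h > 0" for h
  proof -
    have "ennreal (2 * h) * emeasure M (V h) = (\<integral>\<^sup>+ y. ennreal (2 * h) * indicator (V h) y \<partial>M)"
      by (subst nn_integral_cmult_indicator) auto
    also have "\<dots> \<le> (\<integral>\<^sup>+ y. (\<integral>\<^sup>+ x. indicator U x * indicator {z. \<bar>fst z - snd z\<bar> < h} (y, x) \<partial>lborel) \<partial>M)"
    proof (rule nn_integral_mono)
      fix y
      show "ennreal (2 * h) * indicator (V h) y \<le> (\<integral>\<^sup>+ x. indicator U x * indicator {z. \<bar>fst z - snd z\<bar> < h} (y, x) \<partial>lborel)"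
      proof (cases "y \<in> V h")
        case True
        have "ennreal (2 * h) = (\<integral>\<^sup>+ x. indicator {y - h<..<y + h} x \<partial>lborel)" using h by simp
        also have "\<dots> \<le> (\<integral>\<^sup>+ x. indicator U x * indicator {z. \<bar>fst z - snd z\<bar> < h} (y, x) \<partial>lborel)"
        proof (rule nn_integral_mono)
          fix x
          show "indicator {y - h<..<y + h} x \<le> indicator U x * (indicator {z. \<bar>fst z - snd z\<bar> < h} (y, x) :: ennreal)"
            using V_ball[OF True, of x] by (auto simp: indicator_def abs_less_iff)
        qed
        finally show ?thesis using True by simp
      qed simp
    qed
    also have "\<dots> = (\<integral>\<^sup>+ x. (\<integral>\<^sup>+ y. indicator U x * indicator {z. \<bar>fst z - snd z\<bar> < h} (y, x) \<partial>M) \<partial>lborel)"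
      by (rule Fubini'[symmetric]) measurable
    also have "\<dots> \<le> (\<integral>\<^sup>+ x. ennreal (2 * h * \<kappa>) * indicator U x \<partial>lborel)"
    proof (rule nn_integral_mono)
      fix x
      have "(\<integral>\<^sup>+ y. indicator U x * indicator {z. \<bar>fst z - snd z\<bar> < h} (y, x) \<partial>M)
          = (\<integral>\<^sup>+ y. indicator U x * indicator {x - h<..<x + h} y \<partial>M)"
        by (intro nn_integral_cong) (auto simp: indicator_def abs_less_iff)
      also have "\<dots> = indicator U x * emeasure M {x - h<..<x + h}"
        by (subst nn_integral_cmult_indicator) auto
      also have "\<dots> \<le> indicator U x * ennreal (2 * h * \<kappa>)"
        using bound[of "x - h" "x + h"] h by (intro mult_left_mono) (auto simp: emeasure_eq_measure algebra_simps intro!: ennreal_leI)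
      finally show "(\<integral>\<^sup>+ y. indicator U x * indicator {z. \<bar>fst z - snd z\<bar> < h} (y, x) \<partial>M) \<le> ennreal (2 * h * \<kappa>) * indicator U x"
        by (simp add: mult.commute)
    qed
    also have "\<dots> = ennreal (2 * h) * (ennreal \<kappa> * emeasure lborel U)"
      using h \<open>0 \<le> \<kappa>\<close> by (subst nn_integral_cmult_indicator) (auto simp: ennreal_mult mult.assoc)
    finally show ?thesis
      using h by (subst (asm) ennreal_mult_le_mult_iff) auto
  qed
  have "(\<Union>k. V (1 / real (Suc k))) = U"
  proof (intro subset_antisym subsetI)
    fix x assume "x \<in> U"
    then obtain e where e: "e > 0" "ball x e \<subseteq> U" using U open_contains_ball by blast
    then obtain k where k: "1 / real (Suc k) < e" using nat_approx_posE by blast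
    have "x \<in> V (1 / real (Suc k))"
      unfolding V_def
    proof
      assume "x \<in> (\<Union>y\<in>- U. ball y (1 / real (Suc k)))"
      then obtain y where "y \<notin> U" "dist y x < 1 / real (Suc k)" by auto
      with k have "y \<in> ball x e" by (simp add: dist_commute)
      with e \<open>y \<notin> U\<close> show False by blast
    qed
    then show "x \<in> (\<Union>k. V (1 / real (Suc k)))" by blast
  qed (use V_ball in force)
  moreover have "incseq (\<lambda>k. V (1 / real (Suc k)))"
  proof (rule incseq_SucI)
    show "V (1 / real (Suc k)) \<subseteq> V (1 / real (Suc (Suc k)))" for k
      using subset_ball[of "1 / real (Suc (Suc k))" "1 / real (Suc k)"] unfolding V_def
      by (fastforce simp: frac_le)
  qed
  moreover have "range (\<lambda>k. V (1 / real (Suc k))) \<subseteq> sets M" by (auto simp del: of_nat_Suc)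
  ultimately have "emeasure M U = (SUP k. emeasure M (V (1 / real (Suc k))))"
    using SUP_emeasure_incseq[of "\<lambda>k. V (1 / real (Suc k))" M] by (simp del: of_nat_Suc)
  also have "\<dots> \<le> ennreal \<kappa> * emeasure lborel U"
    by (intro SUP_least V_bound) simp
  finally show ?thesis .
qed

text \<open>Outer regularity of Lebesgue measure reduces the claim to open sets.\<close>

lemma null_lborel_imp_null:
  assumes M: "real_distribution M" and "0 \<le> \<kappa>"
    and bound: "\<And>a b. a \<le> b \<Longrightarrow> measure M {a<..<b} \<le> \<kappa> * (b - a)"
    and A: "A \<in> sets borel" "emeasure lborel A = 0"
  shows "emeasure M A = 0"
proof -
  interpret real_distribution M by fact
  have "emeasure M A \<le> 0"
  proof (rule ennreal_le_epsilon)
    fix e :: real assume "e > 0"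
    have "A \<in> sets lebesgue" using A by auto
    \<comment> \<open>Dividing by \<kappa> + 1 admits \<kappa> = 0.\<close>
    moreover have "e / (\<kappa> + 1) > 0" using \<open>e > 0\<close> \<open>0 \<le> \<kappa>\<close> by simp
    ultimately obtain U where U: "open U" "A \<subseteq> U" "U - A \<in> lmeasurable" "emeasure lebesgue (U - A) < ennreal (e / (\<kappa> + 1))"
      by (rule sets_lebesgue_outer_open)
    have [measurable]: "U \<in> sets borel" using U by simp
    have "emeasure lborel U = emeasure lborel A + emeasure lborel (U - A)"
      using A U by (subst plus_emeasure) (auto simp: Un_absorb1)
    also have "\<dots> \<le> ennreal (e / (\<kappa> + 1))" using A U by (simp add: less_imp_le)
    finally have lU: "emeasure lborel U \<le> ennreal (e / (\<kappa> + 1))" .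
    have "emeasure M A \<le> emeasure M U" using U by (intro emeasure_mono) auto
    also have "\<dots> \<le> ennreal \<kappa> * emeasure lborel U"
      by (rule measure_lborel_dominated[OF M \<open>0 \<le> \<kappa>\<close> bound U(1)])
    also have "\<dots> \<le> ennreal \<kappa> * ennreal (e / (\<kappa> + 1))" by (intro mult_left_mono lU) simp
    also have "\<dots> = ennreal (\<kappa> * (e / (\<kappa> + 1)))" using \<open>0 \<le> \<kappa>\<close> \<open>e > 0\<close> by (simp flip: ennreal_mult)
    also have "\<kappa> * (e / (\<kappa> + 1)) \<le> e" using \<open>0 \<le> \<kappa>\<close> \<open>e > 0\<close> by (simp add: divide_le_eq algebra_simps)
    finally show "emeasure M A \<le> 0 + ennreal e" by (simp add: ennreal_leI)
  qed
  then show ?thesis by simp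
qed

text \<open>The portmanteau inequality for open sets: the continuous functions \<open>f k\<close>
  increase to the indicator of U.\<close>

lemma weak_conv_open_le:
  fixes \<mu> :: "nat \<Rightarrow> real measure"
  assumes dist: "\<And>n. real_distribution (\<mu> n)" "real_distribution M" and conv: "weak_conv_m \<mu> M"
    and U: "open U" and le: "\<And>n. n \<ge> n0 \<Longrightarrow> measure (\<mu> n) U \<le> B"
  shows "measure M U \<le> B"
proof (cases "U = UNIV")
  \<comment> \<open>The distance to the empty complement is 0 by convention, so the functions
    \<open>f k\<close> would not approximate the indicator.\<close>
  case True
  interpret M: real_distribution M by fact
  interpret N: real_distribution "\<mu> n0" by (rule dist)
  show ?thesis using le[of n0] True M.prob_space N.prob_space by simp
next
  case False
  interpret M: real_distribution M by fact
  have "- U \<noteq> {}" using False by auto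
  define f where "f k x = min 1 (real k * infdist x (- U))" for k x
  have [measurable]: "U \<in> sets borel" using U by simp
  have cont: "continuous_on UNIV (f k)" for k unfolding f_def by (intro continuous_intros)
  have [measurable]: "f k \<in> borel_measurable borel" for k by (intro borel_measurable_continuous_onI cont)
  have f_bd: "0 \<le> f k x" "f k x \<le> 1" for k x by (auto simp: f_def infdist_nonneg)
  have f_out: "f k x \<le> indicator U x" for k x
    using False f_bd(2)[of k x] by (cases "x \<in> U") (auto simp: f_def)
  have "integral\<^sup>L M (f k) \<le> B" for k
  proof (rule LIMSEQ_le_const2)
    show "(\<lambda>n. integral\<^sup>L (\<mu> n) (f k)) \<longlonglongrightarrow> integral\<^sup>L M (f k)"
    proof (rule weak_conv_imp_integral_bdd_continuous_conv[OF dist conv])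
      show "isCont (f k) x" for x using cont by (simp add: continuous_on_eq_continuous_at)
      show "norm (f k x) \<le> 1" for x using f_bd[of k x] by simp
    qed
    show "\<exists>N. \<forall>n\<ge>N. integral\<^sup>L (\<mu> n) (f k) \<le> B"
    proof (intro exI allI impI)
      fix n assume n: "n \<ge> n0"
      interpret N: real_distribution "\<mu> n" by (rule dist)
      have "integral\<^sup>L (\<mu> n) (f k) \<le> integral\<^sup>L (\<mu> n) (indicator U)"
      proof (rule integral_mono)
        show "integrable (\<mu> n) (f k)"
          by (rule N.integrable_const_bound[where B = 1]) (use f_bd in auto)
        show "integrable (\<mu> n) (indicator U :: real \<Rightarrow> real)"
          by (rule N.integrable_const_bound[where B = 1]) auto
      qed (rule f_out)
      also have "\<dots> = measure (\<mu> n) U" by simp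
      finally show "integral\<^sup>L (\<mu> n) (f k) \<le> B" using le[OF n] by simp
    qed
  qed
  moreover have "(\<lambda>k. integral\<^sup>L M (f k)) \<longlonglongrightarrow> integral\<^sup>L M (indicator U)"
  proof (rule integral_dominated_convergence[where w = "\<lambda>_. 1"])
    show "AE x in M. (\<lambda>k. f k x) \<longlonglongrightarrow> indicator U x"
    proof (rule AE_I2)
      fix x
      show "(\<lambda>k. f k x) \<longlonglongrightarrow> indicator U x"
      proof (cases "x \<in> U")
        case True
        have "infdist x (- U) > 0"
          using True U \<open>- U \<noteq> {}\<close> in_closed_iff_infdist_zero[of "- U" x] infdist_nonneg[of x "- U"] by (auto simp: closed_Compl)
        then obtain N where N: "1 / infdist x (- U) < real N" using reals_Archimedean2 by blast
        have "f k x = 1" if "k \<ge> N" for k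
        proof -
          have "1 \<le> real N * infdist x (- U)" using N \<open>infdist x (- U) > 0\<close> by (simp add: divide_less_eq)
          also have "\<dots> \<le> real k * infdist x (- U)" using that \<open>infdist x (- U) > 0\<close> by simp
          finally show ?thesis by (simp add: f_def)
        qed
        then have "\<forall>\<^sub>F k in sequentially. f k x = indicator U x"
          using True by (auto simp: eventually_sequentially)
        then show ?thesis by (rule tendsto_eventually)
      next
        case nU: False
        then have "f k x = 0" for k by (simp add: f_def)
        then show ?thesis using nU by simp
      qed
    qed
  qed (use f_bd in auto)
  ultimately have "integral\<^sup>L M (indicator U :: real \<Rightarrow> real) \<le> B"
    by (intro LIMSEQ_le_const2) auto
  then show ?thesis by simp
qed

section \<open>Uniform measures on finite sets, convolution with them, and the Double Points
  Condition\<close>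

lemma real_distribution_delta_set: "real_distribution (delta_set A)"
  unfolding delta_set_def
  by (intro real_distribution.intro measure_pmf.prob_space_distr real_distribution_axioms.intro) auto

lemma integral_delta_set:
  fixes f :: "real \<Rightarrow> 'a :: {banach, second_countable_topology}"
  assumes A: "finite A" "A \<noteq> {}" and [measurable]: "f \<in> borel_measurable borel"
  shows "integral\<^sup>L (delta_set A) f = (\<Sum>a\<in>A. f a) /\<^sub>R real (card A)"
proof -
  have "integral\<^sup>L (delta_set A) f = integral\<^sup>L (measure_pmf (pmf_of_set A)) f"
    unfolding delta_set_def by (subst integral_distr) auto
  also have "\<dots> = (\<Sum>a\<in>A. pmf (pmf_of_set A) a *\<^sub>R f a)"
    using A by (subst integral_measure_pmf[where A = A]) auto
  also have "\<dots> = (\<Sum>a\<in>A. f a) /\<^sub>R real (card A)"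
    using A by (simp add: scaleR_sum_right divide_inverse)
  finally show ?thesis .
qed

lemma integral_convolution_delta_set:
  fixes f :: "real \<Rightarrow> 'a :: {banach, second_countable_topology}"
  assumes M: "real_distribution M" and A: "finite A" "A \<noteq> {}"
    and [measurable]: "f \<in> borel_measurable borel" and B: "\<And>x. norm (f x) \<le> B"
  shows "integral\<^sup>L (M \<star> delta_set A) f = (\<Sum>a\<in>A. LINT x|M. f (x + a)) /\<^sub>R real (card A)"
proof -
  interpret M: real_distribution M by fact
  interpret N: real_distribution "delta_set A" by (rule real_distribution_delta_set)
  interpret pair_prob_space M "delta_set A" ..
  have [measurable]: "(\<lambda>(x, y). x + y) \<in> borel_measurable (M \<Otimes>\<^sub>M delta_set A)"
    by measurable
  have "integral\<^sup>L (M \<star> delta_set A) f = (LINT (x, y)|(M \<Otimes>\<^sub>M delta_set A). f (x + y))"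
    unfolding convolution_def by (subst integral_distr) (auto simp: case_prod_beta')
  also have "\<dots> = (LINT y|delta_set A. LINT x|M. f (x + y))"
  proof (rule integral_snd[symmetric])
    show "integrable (M \<Otimes>\<^sub>M delta_set A) (\<lambda>(x, y). f (x + y))"
      by (rule P.integrable_const_bound[where B = B]) (use B in \<open>auto simp: case_prod_beta\<close>)
  qed
  also have "\<dots> = (\<Sum>a\<in>A. LINT x|M. f (x + a)) /\<^sub>R real (card A)"
    by (rule integral_delta_set[OF A]) measurable
  finally show ?thesis .
qed

lemma real_distribution_convolution:
  assumes "real_distribution M" "real_distribution N"
  shows "real_distribution (M \<star> N)"
proof -
  interpret M: real_distribution M by fact
  interpret N: real_distribution N by fact
  interpret pair_prob_space M N ..
  show ?thesis
    unfolding convolution_def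
    by (intro real_distribution.intro P.prob_space_distr real_distribution_axioms.intro) auto
qed

lemma fourier_delta_set:
  assumes "finite D" "D \<noteq> {}" "p > 0"
  shows "fourier (delta_set (scaled_digits p D)) \<xi> = digit_mask D (\<xi> / real p)"
proof -
  have inj: "inj_on (\<lambda>d. real_of_int d / real p) D" using assms(3) by (auto simp: inj_on_def)
  have "fourier (delta_set (scaled_digits p D)) \<xi> = (\<Sum>a\<in>scaled_digits p D. echar (a * \<xi>)) /\<^sub>R real (card (scaled_digits p D))"
    unfolding fourier_def echar_def mult.assoc[symmetric]
    using assms by (intro integral_delta_set) (auto simp: scaled_digits_def intro!: borel_measurable_continuous_onI continuous_intros)
  also have "\<dots> = digit_mask D (\<xi> / real p)"
    using inj by (simp add: scaled_digits_def sum.reindex card_image digit_mask_def scaleR_conv_of_real divide_inverse mult_ac)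
  finally show ?thesis .
qed

text \<open>The squared masks over the residues are at most 1 and sum to p / card D. If this exceeds
  1, two of them are nonzero for every \<xi>. If p = card D, the residue 0 exhausts the sum at \<xi>
  = 0, so 0 is not in the set T.\<close>

lemma hadamard_DPC_iff:
  assumes H: "hadamard_triple p D L" and ne: "D \<noteq> {}"
  shows "DPC p D \<longleftrightarrow> p > card D"
proof
  have fin: "finite D" and p: "p > 0" and card: "card D > 0"
    using H ne by (auto simp: hadamard_triple_def card_gt_0_iff)
  note ft = fourier_delta_set[OF fin ne p]
  define w where "w \<xi> l = (cmod (digit_mask D ((\<xi> + real l) / real p)))\<^sup>2" for \<xi> l
  have sum: "(\<Sum>l<p. w \<xi> l) = real p / real (card D)" for \<xi>
    using hadamard_sum_residues[OF H ne] by (simp add: w_def)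
  have w: "0 \<le> w \<xi> l" "w \<xi> l \<le> 1" for \<xi> l using norm_mask_le by (auto simp: w_def power_le_one)
  show "p > card D" if "DPC p D"
  proof (rule ccontr)
    assume "\<not> p > card D"
    then have "p = card D" using hadamard_card_le[OF H] by simp
    then have "(\<Sum>l<p. w 0 l) = 1" using sum[of 0] p by simp
    moreover have "w 0 0 = 1" using fin ne by (simp add: w_def)
    ultimately have "(\<Sum>l\<in>{..<p} - {0}. w 0 l) = 0" using p by (simp add: sum.remove[of _ 0])
    then have zero: "w 0 l = 0" if "l \<in> {..<p} - {0}" for l
      using that w by (subst (asm) sum_nonneg_eq_0_iff) auto
    have "0 \<in> T_set p D" using that by (simp add: DPC_def)
    then obtain l1 l2 where l: "l1 < p" "l2 < p" "l1 \<noteq> l2" "w 0 l1 \<noteq> 0" "w 0 l2 \<noteq> 0"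
      by (auto simp: T_set_def ft w_def)
    then show False using zero[of l1] zero[of l2] by (cases "l1 = 0") auto
  qed
  show "DPC p D" if "p > card D"
  proof -
    have "\<xi> \<in> T_set p D" if "\<xi> \<in> {0..<1}" for \<xi>
    proof (rule ccontr)
      assume "\<xi> \<notin> T_set p D"
      have uniq: "l1 = l2" if "l1 < p" "l2 < p" "w \<xi> l1 \<noteq> 0" "w \<xi> l2 \<noteq> 0" for l1 l2
      proof (rule ccontr)
        assume "l1 \<noteq> l2"
        moreover have "l1 \<in> {0..<p}" "l2 \<in> {0..<p}" using that by auto
        ultimately have "\<xi> \<in> T_set p D"
          using that(3,4) \<open>\<xi> \<in> {0..<1}\<close> unfolding T_set_def ft w_def by fastforce
        with \<open>\<xi> \<notin> T_set p D\<close> show False by contradiction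
      qed
      have "(\<Sum>l<p. w \<xi> l) \<le> 1"
      proof (cases "\<exists>l<p. w \<xi> l \<noteq> 0")
        case True
        then obtain l where l: "l < p" "w \<xi> l \<noteq> 0" by blast
        have "(\<Sum>l'\<in>{..<p} - {l}. w \<xi> l') = 0" using l uniq by (intro sum.neutral) auto
        then show ?thesis using l w by (simp add: sum.remove[of _ l])
      next
        case False
        then have "(\<Sum>l<p. w \<xi> l) = 0" by (intro sum.neutral) auto
        then show ?thesis by simp
      qed
      then show False using sum \<open>p > card D\<close> card by (simp add: divide_le_eq)
    qed
    then have "{0..<1} \<subseteq> T_set p D" by blast
    then show ?thesis unfolding DPC_def by (auto simp: T_set_def)
  qed
qed

section \<open>Atoms and interval masses of the finite convolutions\<close>

context hadamard_sequence
begin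

abbreviation moran :: "nat \<Rightarrow> real measure" where "moran \<equiv> moran_partial p D"

definition offset :: "nat \<Rightarrow> int \<Rightarrow> real" where
  "offset n d = real_of_int d / real (P 0 (Suc n))"

lemma moran_partial_Suc: "moran (Suc n) = (moran n \<star> delta_set (offset n ` D n))"
proof -
  have "(\<Prod>k\<le>n. real (p k)) = real (P 0 (Suc n))"
    by (simp add: P_def atLeast0LessThan lessThan_Suc_atMost)
  then show ?thesis by (simp add: offset_def)
qed

declare moran_partial.simps(2) [simp del]

lemma real_distribution_moran: "real_distribution (moran n)"
proof (induction n)
  case 0
  show ?case
    by (intro real_distribution.intro real_distribution_axioms.intro) (auto intro!: prob_space_return)
next
  case (Suc n)
  then show ?case
    unfolding moran_partial_Suc by (intro real_distribution_convolution real_distribution_delta_set)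
qed

lemma inj_offset: "inj_on (offset n) A"
  using P_pos[of 0 "Suc n"] by (auto simp: inj_on_def offset_def)

lemma moran_integral:
  fixes f :: "real \<Rightarrow> 'a :: {banach, second_countable_topology}"
  assumes "f \<in> borel_measurable borel" "\<And>x. norm (f x) \<le> B"
  shows "integral\<^sup>L (moran (Suc n)) f = (\<Sum>d\<in>D n. LINT x|moran n. f (x + offset n d)) /\<^sub>R real (card (D n))"
  unfolding moran_partial_Suc using inj_offset[of n "D n"] finite_D D_nonempty
  by (subst integral_convolution_delta_set[OF real_distribution_moran _ _ assms])
     (auto simp: sum.reindex card_image)

lemma moran_fourier: "(CLINT x|moran n. echar (\<xi> * x)) = M 0 n \<xi>"
proof (induction n)
  case 0
  then show ?case by (simp add: integral_return)
next
  case (Suc n)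
  have "(CLINT x|moran (Suc n). echar (\<xi> * x))
      = (\<Sum>d\<in>D n. CLINT x|moran n. echar (\<xi> * (x + offset n d))) /\<^sub>R real (card (D n))"
    by (rule moran_integral[where B = 1]) auto
  also have "(\<lambda>d x. echar (\<xi> * (x + offset n d))) = (\<lambda>d x. echar (\<xi> * x) * echar (real_of_int d * (\<xi> / real (P 0 (Suc n)))))"
    by (simp add: fun_eq_iff offset_def distrib_left echar_add mult_ac)
  also have "(\<Sum>d\<in>D n. CLINT x|moran n. echar (\<xi> * x) * echar (real_of_int d * (\<xi> / real (P 0 (Suc n))))) /\<^sub>R real (card (D n))
      = M 0 (Suc n) \<xi>"
  proof -
    have "(CLINT x|moran n. echar (\<xi> * x) * c) = M 0 n \<xi> * c" for c
      using Suc by simp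
    then show ?thesis
      by (simp only: M_Suc digit_mask_def scaleR_conv_of_real sum_distrib_left[symmetric])
         (simp add: divide_inverse mult_ac)
  qed
  finally show ?case .
qed

lemma moran_measure:
  assumes [measurable]: "E \<in> sets borel"
  shows "measure (moran (Suc n)) E = (\<Sum>d\<in>D n. measure (moran n) {x. x + offset n d \<in> E}) / real (card (D n))"
proof -
  interpret N: real_distribution "moran k" for k by (rule real_distribution_moran)
  have "measure (moran (Suc n)) E = integral\<^sup>L (moran (Suc n)) (indicator E)" by simp
  also have "\<dots> = (\<Sum>d\<in>D n. LINT x|moran n. indicator E (x + offset n d)) /\<^sub>R real (card (D n))"
    by (rule moran_integral[where B = 1]) auto
  also have "(\<lambda>d. LINT x|moran n. indicator E (x + offset n d) :: real) = (\<lambda>d. measure (moran n) {x. x + offset n d \<in> E})"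
  proof
    fix d
    have "(\<lambda>x. indicator E (x + offset n d) :: real) = indicator {x. x + offset n d \<in> E}"
      by (auto simp: indicator_def fun_eq_iff)
    moreover have "{x. x + offset n d \<in> E} \<in> sets borel" by measurable
    ultimately show "(LINT x|moran n. indicator E (x + offset n d) :: real) = measure (moran n) {x. x + offset n d \<in> E}"
      by simp
  qed
  also have "(\<Sum>d\<in>D n. measure (moran n) {x. x + offset n d \<in> E}) /\<^sub>R real (card (D n))
      = (\<Sum>d\<in>D n. measure (moran n) {x. x + offset n d \<in> E}) / real (card (D n))"
    by (simp add: divide_inverse mult.commute)
  finally show ?thesis .
qed

definition Q :: "nat \<Rightarrow> nat" where
  "Q n = (\<Prod>k<n. card (D k))"

lemma Q_pos: "Q n > 0"
  using card_ge2 by (auto simp: Q_def intro!: prod_pos) (meson less_le_trans zero_less_numeral)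

lemma Q_ge: "2 ^ n \<le> Q n"
proof -
  have "(\<Prod>k<n. 2) \<le> Q n" unfolding Q_def by (rule prod_mono) (use card_ge2 in auto)
  then show ?thesis by simp
qed

lemma borel_off_lattice: "{x::real. x * c \<notin> \<int>} \<in> sets borel"
proof -
  have "closed ((\<lambda>x::real. x * c) -` \<int>)"
    by (intro continuous_closed_vimage closed_Ints continuous_intros)
  then have "- ((\<lambda>x::real. x * c) -` \<int>) \<in> sets borel" by auto
  then show ?thesis by (simp add: vimage_def Collect_neg_eq)
qed

text \<open>Level n is concentrated on the integer multiples of 1 / \<open>P 0 n\<close>; the
  counting of atoms rests on this.\<close>

lemma moran_lattice: "measure (moran n) {x. x * real (P 0 n) \<notin> \<int>} = 0"
proof (induction n)
  case 0
  then show ?case using borel_off_lattice[of 1] by (simp add: measure_return)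
next
  case (Suc n)
  interpret N: real_distribution "moran k" for k by (rule real_distribution_moran)
  have "measure (moran n) {x. x + offset n d \<in> {x. x * real (P 0 (Suc n)) \<notin> \<int>}} = 0" for d
  proof -
    have "x * real (P 0 n) \<notin> \<int>" if "(x + offset n d) * real (P 0 (Suc n)) \<notin> \<int>" for x
    proof
      assume "x * real (P 0 n) \<in> \<int>"
      moreover have "(x + offset n d) * real (P 0 (Suc n)) = x * real (P 0 n) * of_nat (p n) + of_int d"
        using P_pos[of 0 n] p_pos[of n] by (simp add: offset_def P_Suc field_simps)
      moreover have "x * real (P 0 n) * of_nat (p n) + of_int d \<in> \<int>"
        by (rule Ints_add[OF Ints_mult[OF \<open>x * real (P 0 n) \<in> \<int>\<close> Ints_of_nat] Ints_of_int])
      ultimately show False using that by simp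
    qed
    then have "measure (moran n) {x. x + offset n d \<in> {x. x * real (P 0 (Suc n)) \<notin> \<int>}}
        \<le> measure (moran n) {x. x * real (P 0 n) \<notin> \<int>}"
      using borel_off_lattice by (intro N.finite_measure_mono) auto
    then show ?thesis using Suc measure_nonneg[of "moran n"] by (metis order_antisym)
  qed
  then show ?case by (subst moran_measure[OF borel_off_lattice]) simp
qed

text \<open>Digits are distinct modulo p n, so at most one d makes x - \<open>offset n d\<close> a
  point of the coarser lattice. An atom thus arises in one way and loses the factor card (D n) at
  each level.\<close>

lemma moran_atom: "measure (moran n) {x} \<le> 1 / real (Q n)"
proof (induction n arbitrary: x)
  case 0
  then show ?case by (simp add: Q_def measure_return indicator_def)
next
  case (Suc n)
  interpret N: real_distribution "moran k" for k by (rule real_distribution_moran)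
  define m where "m d = measure (moran n) {x - offset n d}" for d
  have m_zero: "m d = 0" if "(x - offset n d) * real (P 0 n) \<notin> \<int>" for d
  proof -
    have "m d \<le> 0"
      using that moran_lattice[of n] borel_off_lattice[of "real (P 0 n)"] N.finite_measure_mono[of "{x - offset n d}" "{x. x * real (P 0 n) \<notin> \<int>}" n]
      by (simp add: m_def)
    then show ?thesis by (simp add: m_def order_antisym)
  qed
  have uniq: "d = d'" if dd: "d \<in> D n" "d' \<in> D n" "m d \<noteq> 0" "m d' \<noteq> 0" for d d'
  proof (rule hadamard_inj_mod[OF hadamard[of n] dd(1,2)])
    have "(x - offset n d) * real (P 0 n) \<in> \<int>" "(x - offset n d') * real (P 0 n) \<in> \<int>"
      using m_zero dd by blast+
    then have "(x - offset n d') * real (P 0 n) - (x - offset n d) * real (P 0 n) \<in> \<int>" by (rule Ints_diff[rotated])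
    moreover have "(x - offset n d') * real (P 0 n) - (x - offset n d) * real (P 0 n) = real_of_int (d - d') / real (p n)"
      using P_pos[of 0 n] p_pos[of n] by (simp add: offset_def P_Suc field_simps)
    ultimately obtain k where "real_of_int (d - d') / real (p n) = of_int k" by (auto elim: Ints_cases)
    then have "real_of_int (d - d') = real_of_int (int (p n) * k)" using p_pos[of n] by (simp add: field_simps)
    then have "d - d' = int (p n) * k" by (simp only: of_int_eq_iff)
    then show "int (p n) dvd d - d'" by simp
  qed
  have "(\<Sum>d\<in>D n. m d) \<le> 1 / real (Q n)"
  proof (cases "\<exists>d\<in>D n. m d \<noteq> 0")
    case True
    then obtain d where d: "d \<in> D n" "m d \<noteq> 0" by blast
    have "(\<Sum>d'\<in>D n - {d}. m d') = 0" using d uniq by (intro sum.neutral) auto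
    then have "(\<Sum>d\<in>D n. m d) = m d" using d finite_D by (simp add: sum.remove)
    then show ?thesis using Suc by (simp add: m_def)
  next
    case False
    then have "(\<Sum>d\<in>D n. m d) = 0" by (intro sum.neutral) auto
    then show ?thesis by simp
  qed
  then have "(\<Sum>d\<in>D n. m d) / real (card (D n)) \<le> 1 / real (Q n) / real (card (D n))"
    by (rule divide_right_mono) simp
  moreover have "{y. y + offset n d \<in> {x}} = {x - offset n d}" for d by auto
  ultimately show ?case by (subst moran_measure) (auto simp: m_def Q_def mult.commute)
qed

lemma offset_bounds:
  assumes d: "d \<in> D (n + j)"
  shows "0 \<le> offset (n + j) d" "offset (n + j) d \<le> C / real (P 0 n) * (1 / 2) ^ j"
proof -
  show "0 \<le> offset (n + j) d" using digit_nonneg[OF d] by (simp add: offset_def)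
  have "offset (n + j) d = (real_of_int d / real (p (n + j))) * (1 / real (P 0 n)) * (1 / real (P n (n + j)))"
    by (simp add: offset_def P_Suc P_mult[of 0 n "n + j", symmetric])
  also have "\<dots> \<le> C * (1 / real (P 0 n)) * (1 / 2) ^ j"
  proof (intro mult_mono)
    have "(2::real) ^ j \<le> real (P n (n + j))"
      using P_ge[of j n] by (metis of_nat_le_iff of_nat_numeral of_nat_power)
    then show "1 / real (P n (n + j)) \<le> (1 / 2) ^ j"
      by (simp add: power_one_over frac_le)
  qed (auto simp: digits_le[OF d] C_nonneg)
  finally show "offset (n + j) d \<le> C / real (P 0 n) * (1 / 2) ^ j" by simp
qed

text \<open>Later digits are nonnegative and move mass to the right only, by geometrically
  decreasing amounts; so the interval grows at its left end alone.\<close>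

lemma moran_interval_mono:
  assumes "a \<le> b"
  shows "measure (moran (n + j)) {a<..<b} \<le> measure (moran n) {a - C / real (P 0 n) * (\<Sum>i<j. (1 / 2) ^ i)<..<b}"
  using assms
proof (induction j arbitrary: a b)
  case (Suc j)
  interpret N: real_distribution "moran k" for k by (rule real_distribution_moran)
  let ?r = "C / real (P 0 n) * (1 / 2) ^ j"
  have r: "?r \<ge> 0" using C_nonneg by simp
  have "measure (moran (n + j)) {x. x + offset (n + j) d \<in> {a<..<b}}
      \<le> measure (moran n) {a - C / real (P 0 n) * (\<Sum>i<Suc j. (1 / 2) ^ i)<..<b}" if d: "d \<in> D (n + j)" for d
  proof -
    have "{x. x + offset (n + j) d \<in> {a<..<b}} \<subseteq> {a - ?r<..<b}" using offset_bounds[OF d] by auto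
    then have "measure (moran (n + j)) {x. x + offset (n + j) d \<in> {a<..<b}} \<le> measure (moran (n + j)) {a - ?r<..<b}"
      by (intro N.finite_measure_mono) auto
    also have "\<dots> \<le> measure (moran n) {a - ?r - C / real (P 0 n) * (\<Sum>i<j. (1 / 2) ^ i)<..<b}"
      using Suc.prems r by (intro Suc.IH) simp
    finally show ?thesis by (simp add: algebra_simps)
  qed
  then have "(\<Sum>d\<in>D (n + j). measure (moran (n + j)) {x. x + offset (n + j) d \<in> {a<..<b}})
      \<le> (\<Sum>d\<in>D (n + j). measure (moran n) {a - C / real (P 0 n) * (\<Sum>i<Suc j. (1 / 2) ^ i)<..<b})"
    by (rule sum_mono)
  then show ?case
    using card_ge2[of "n + j"] unfolding add_Suc_right
    by (subst moran_measure) (auto simp: divide_le_eq mult.commute)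
qed simp

lemma geometric_le_2: "(\<Sum>i<j. (1 / 2 :: real) ^ i) \<le> 2"
  unfolding sum_gp_strict by simp

text \<open>The enlarged interval contains at most (b - a) P + 2 C + 1 lattice points of spacing 1 /
  P with P = \<open>P 0 n\<close>, each of mass at most 1 / \<open>Q n\<close>. The bound does not
  depend on m and therefore reaches the weak limit.\<close>

lemma moran_interval:
  assumes "a \<le> b" "n \<le> m"
  shows "measure (moran m) {a<..<b} \<le> ((b - a) * real (P 0 n) + 2 * C + 1) / real (Q n)"
proof -
  interpret N: real_distribution "moran k" for k by (rule real_distribution_moran)
  have P: "real (P 0 n) > 0" using P_pos[of 0 n] by simp
  define a' where "a' = a - C / real (P 0 n) * (\<Sum>i<m - n. (1 / 2) ^ i)"
  have "C * (\<Sum>i<m - n. (1 / 2) ^ i) \<le> C * 2" by (rule mult_left_mono[OF geometric_le_2 C_nonneg])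
  then have a': "(b - a') * real (P 0 n) \<le> (b - a) * real (P 0 n) + 2 * C"
    using P by (simp add: a'_def algebra_simps)
  have "0 \<le> C / real (P 0 n) * (\<Sum>i<m - n. (1 / 2 :: real) ^ i)"
    using C_nonneg by (intro mult_nonneg_nonneg sum_nonneg) auto
  then have "a' \<le> b" using assms(1) unfolding a'_def by linarith
  \<comment> \<open>Exactly the integers strictly between the scaled end points.\<close>
  define I where "I = {\<lfloor>a' * real (P 0 n)\<rfloor> + 1..\<lceil>b * real (P 0 n)\<rceil> - 1}"
  define F where "F = (\<lambda>k. real_of_int k / real (P 0 n)) ` I"
  have finF: "finite F" by (simp add: F_def I_def)
  have "card F \<le> card I" unfolding F_def by (rule card_image_le) (simp add: I_def)
  also have "card I = nat (\<lceil>b * real (P 0 n)\<rceil> - 1 - \<lfloor>a' * real (P 0 n)\<rfloor>)" by (simp add: I_def)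
  finally have "real (card F) \<le> real (nat (\<lceil>b * real (P 0 n)\<rceil> - 1 - \<lfloor>a' * real (P 0 n)\<rfloor>))" by simp
  also have "\<dots> \<le> b * real (P 0 n) - a' * real (P 0 n) + 1"
  proof -
    have "a' * real (P 0 n) \<le> b * real (P 0 n)" using \<open>a' \<le> b\<close> P by simp
    then show ?thesis by linarith
  qed
  also have "\<dots> \<le> (b - a) * real (P 0 n) + 2 * C + 1" using a' by (simp add: algebra_simps)
  finally have cardF: "real (card F) \<le> (b - a) * real (P 0 n) + 2 * C + 1" .
  have sub: "{a'<..<b} \<subseteq> F \<union> {x. x * real (P 0 n) \<notin> \<int>}"
  proof
    fix x assume x: "x \<in> {a'<..<b}"
    show "x \<in> F \<union> {x. x * real (P 0 n) \<notin> \<int>}"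
    proof (cases "x * real (P 0 n) \<in> \<int>")
      case True
      then obtain k where k: "x * real (P 0 n) = of_int k" by (auto elim: Ints_cases)
      have "a' * real (P 0 n) < of_int k" "of_int k < b * real (P 0 n)" using x P by (auto simp flip: k)
      then have "k \<in> I" unfolding I_def by (simp add: floor_less_iff less_ceiling_iff) linarith
      moreover have "x = real_of_int k / real (P 0 n)" using k P by (simp add: field_simps)
      ultimately show ?thesis by (auto simp: F_def)
    qed simp
  qed
  have meas: "{x::real. x * real (P 0 n) \<notin> \<int>} \<in> sets borel" by (rule borel_off_lattice)
  have Fm: "F \<in> sets borel" using finF by (simp add: borel_closed finite_imp_closed)
  have "measure (moran m) {a<..<b} \<le> measure (moran n) {a'<..<b}"
    using moran_interval_mono[OF assms(1), of n "m - n"] assms(2) by (simp add: a'_def)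
  also have "\<dots> \<le> measure (moran n) (F \<union> {x. x * real (P 0 n) \<notin> \<int>})"
    using sub Fm meas by (intro N.finite_measure_mono) auto
  also have "\<dots> \<le> measure (moran n) F + measure (moran n) {x. x * real (P 0 n) \<notin> \<int>}"
    using Fm meas by (intro measure_Un_le) auto
  also have "\<dots> = measure (moran n) F" by (simp add: moran_lattice)
  also have "\<dots> = (\<Sum>x\<in>F. measure (moran n) {x})"
    using finF by (intro N.finite_measure_eq_sum_singleton) auto
  also have "\<dots> \<le> (\<Sum>x\<in>F. 1 / real (Q n))" by (intro sum_mono moran_atom)
  also have "\<dots> \<le> ((b - a) * real (P 0 n) + 2 * C + 1) / real (Q n)"
    using cardF by (simp add: divide_right_mono)
  finally show ?thesis .
qed

end

section \<open>The Cantor-Moran measure\<close>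

locale cantor_moran = hadamard_sequence +
  fixes \<mu> :: "real measure"
  assumes mu_distr: "real_distribution \<mu>"
    and mu_limit: "weak_conv_m (moran_partial p D) \<mu>"
begin

sublocale real_distribution \<mu> by (rule mu_distr)

lemma mu_fourier: "(CLINT x|\<mu>. echar (\<xi> * x)) = N 0 \<xi>"
proof -
  have "(\<lambda>n. char (moran n) (2 * pi * \<xi>)) \<longlonglongrightarrow> char \<mu> (2 * pi * \<xi>)"
    by (rule levy_continuity1[OF real_distribution_moran mu_distr mu_limit])
  then have "(\<lambda>n. M 0 n \<xi>) \<longlonglongrightarrow> (CLINT x|\<mu>. echar (\<xi> * x))"
    by (simp add: char_eq_echar moran_fourier)
  then show ?thesis by (rule LIMSEQ_unique[OF _ M_tendsto])
qed

lemma mu_spectral: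
  assumes "infinite {j. p j > card (D j)}"
  shows "spectral \<mu>"
proof -
  obtain S where S: "incseq S" "\<And>k. finite (S k)"
    "\<And>k a b. a \<in> S k \<Longrightarrow> b \<in> S k \<Longrightarrow> a \<noteq> b \<Longrightarrow> N 0 (of_int (a - b)) = 0"
    "\<And>\<xi>. \<xi> \<in> \<rat> \<Longrightarrow> (\<lambda>k. mass (S k) \<xi>) \<longlonglongrightarrow> 1"
    using spectrum_sequence[OF assms] by blast
  show ?thesis
  proof (rule spectralI[where S = "\<lambda>k. real_of_int ` S k"])
    show "incseq (\<lambda>k. real_of_int ` S k)" using S(1) by (force simp: incseq_def)
    show "(CLINT x|\<mu>. echar ((a - b) * x)) = 0"
      if "a \<in> real_of_int ` S k" "b \<in> real_of_int ` S k" "a \<noteq> b" for k a b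
      using that S(3) unfolding mu_fourier by (auto simp flip: of_int_diff)
    show "(\<lambda>k. \<Sum>s\<in>real_of_int ` S k. (cmod (CLINT x|\<mu>. echar ((\<xi> + s) * x)))\<^sup>2) \<longlonglongrightarrow> 1"
      if "\<xi> \<in> \<rat>" for \<xi>
      using S(4)[OF that] by (simp add: mu_fourier mass_def sum.reindex inj_on_def)
  qed (use S(2) in auto)
qed

lemma mu_interval:
  assumes "a \<le> b"
  shows "measure \<mu> {a<..<b} \<le> ((b - a) * real (P 0 n) + 2 * C + 1) / real (Q n)"
  by (rule weak_conv_open_le[OF real_distribution_moran mu_distr mu_limit, of _ n])
     (auto intro: moran_interval[OF assms])

lemma Q_tendsto: "filterlim (\<lambda>n. real (Q n)) at_top sequentially"
proof (rule filterlim_at_top_mono[OF filterlim_real_sequentially])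
  have "n \<le> Q n" for n using Q_ge[of n] less_exp[of n] by linarith
  then show "\<forall>\<^sub>F n in sequentially. real n \<le> real (Q n)" by simp
qed

text \<open>An interval of the size of the lattice spacing has mass at most (2 C + 3) /
  \<open>Q n\<close>, and \<open>Q n\<close> grows at least like 2^n.\<close>

lemma mu_no_atoms: "emeasure \<mu> {x} = 0"
proof -
  have "measure \<mu> {x} \<le> (2 * C + 3) / real (Q n)" for n
  proof -
    let ?r = "1 / real (P 0 n)"
    have P: "real (P 0 n) > 0" using P_pos[of 0 n] by simp
    have "measure \<mu> {x} \<le> measure \<mu> {x - ?r<..<x + ?r}"
      using P by (intro finite_measure_mono) auto
    also have "\<dots> \<le> ((x + ?r - (x - ?r)) * real (P 0 n) + 2 * C + 1) / real (Q n)"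
      using P by (intro mu_interval) simp
    also have "(x + ?r - (x - ?r)) * real (P 0 n) = 2" using P by (simp add: field_simps)
    finally show ?thesis by (simp add: add.commute)
  qed
  moreover have "(\<lambda>n. (2 * C + 3) / real (Q n)) \<longlonglongrightarrow> 0"
    by (rule tendsto_divide_0[OF tendsto_const filterlim_at_top_imp_at_infinity[OF Q_tendsto]])
  ultimately have "measure \<mu> {x} \<le> 0" by (intro LIMSEQ_le_const) auto
  then show ?thesis by (simp add: emeasure_eq_measure measure_le_0_iff)
qed

text \<open>From some level on p = card D, so \<open>P 0 n\<close> / \<open>Q n\<close> is a
  constant \<kappa> and the interval bound tends to \<kappa> (b - a): the measure is at most
  \<kappa> times Lebesgue measure on intervals.\<close>

lemma mu_absolutely_continuous:
  assumes fin: "finite {j. p j > card (D j)}" and A: "A \<in> sets borel" "emeasure lborel A = 0"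
  shows "emeasure \<mu> A = 0"
proof -
  obtain n0 where n0: "\<And>j. p j > card (D j) \<Longrightarrow> j < n0"
    using fin finite_nat_set_iff_bounded by auto
  have eq: "p j = card (D j)" if "j \<ge> n0" for j
    using n0[of j] that hadamard_card_le[OF hadamard[of j]] by force
  define \<kappa> where "\<kappa> = real (P 0 n0) / real (Q n0)"
  have ratio: "real (P 0 n) = \<kappa> * real (Q n)" if "n \<ge> n0" for n
    using that
  proof (induction n rule: dec_induct)
    case base
    then show ?case using Q_pos[of n0] by (simp add: \<kappa>_def)
  next
    case (step n)
    then show ?case by (simp add: P_Suc Q_def eq)
  qed
  have bound: "measure \<mu> {a<..<b} \<le> \<kappa> * (b - a)" if "a \<le> b" for a b
  proof -
    have "measure \<mu> {a<..<b} \<le> \<kappa> * (b - a) + (2 * C + 1) / real (Q n)" if "n \<ge> n0" for n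
      using mu_interval[OF \<open>a \<le> b\<close>, of n] Q_pos[of n] by (simp add: ratio[OF that] field_simps)
    moreover have "(\<lambda>n. \<kappa> * (b - a) + (2 * C + 1) / real (Q n)) \<longlonglongrightarrow> \<kappa> * (b - a) + 0"
      by (intro tendsto_intros tendsto_divide_0[OF tendsto_const filterlim_at_top_imp_at_infinity[OF Q_tendsto]])
    ultimately show ?thesis by (intro LIMSEQ_le_const) auto
  qed
  show ?thesis
    by (rule null_lborel_imp_null[OF mu_distr _ bound A]) (simp add: \<kappa>_def)
qed

section \<open>Covers by short intervals and singularity\<close>

primrec support :: "nat \<Rightarrow> real set" where
  "support 0 = {0}"
| "support (Suc n) = (\<lambda>(x, d). x + offset n d) ` (support n \<times> D n)"

lemma finite_support: "finite (support n)" and card_support: "card (support n) \<le> Q n"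
proof (induction n)
  case (Suc n)
  show "finite (support (Suc n))" using Suc finite_D by simp
  have "card (support (Suc n)) \<le> card (support n \<times> D n)" 
    unfolding support.simps using Suc finite_D by (intro card_image_le) auto
  also have "\<dots> \<le> Q (Suc n)" using Suc by (simp add: card_cartesian_product Q_def mult.commute)
  finally show "card (support (Suc n)) \<le> Q (Suc n)" .
qed (auto simp: Q_def)

definition cover :: "nat \<Rightarrow> real \<Rightarrow> real set" where
  "cover n r = (\<Union>s\<in>support n. {s..s + r})"

lemma closed_cover: "closed (cover n r)"
  unfolding cover_def using finite_support by (intro closed_UN) auto

lemma cover_measurable [measurable]: "cover n r \<in> sets borel"
  using closed_cover by auto

lemma moran_full:
  assumes [measurable]: "E \<in> sets borel" "F \<in> sets borel" and F: "measure (moran n) F = 1"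
    and sub: "\<And>x d. x \<in> F \<Longrightarrow> d \<in> D n \<Longrightarrow> x + offset n d \<in> E"
  shows "measure (moran (Suc n)) E = 1"
proof -
  interpret N: real_distribution "moran n" by (rule real_distribution_moran)
  have "measure (moran n) {x. x + offset n d \<in> E} = 1" if "d \<in> D n" for d
  proof (rule antisym)
    have "{x. x + offset n d \<in> E} \<in> sets borel" by measurable
    then show "1 \<le> measure (moran n) {x. x + offset n d \<in> E}"
      unfolding F[symmetric] using sub that by (intro N.finite_measure_mono) auto
  qed (rule N.prob_le_1)
  then show ?thesis
    using card_ge2[of n] by (subst moran_measure) auto
qed

lemma moran_support: "measure (moran n) (cover n 0) = 1"
proof (induction n)
  case 0
  then show ?case by (simp add: measure_return cover_def)
next
  case (Suc n)
  show ?case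
  proof (rule moran_full[OF cover_measurable cover_measurable Suc])
    show "x + offset n d \<in> cover (Suc n) 0" if "x \<in> cover n 0" "d \<in> D n" for x d
      using that by (force simp: cover_def)
  qed
qed

lemma moran_cover: "measure (moran (n + j)) (cover n (C / real (P 0 n) * (\<Sum>i<j. (1 / 2) ^ i))) = 1"
proof (induction j)
  case 0
  then show ?case using moran_support by simp
next
  case (Suc j)
  show ?case
    unfolding add_Suc_right
  proof (rule moran_full[OF cover_measurable cover_measurable Suc])
    fix x d assume x: "x \<in> cover n (C / real (P 0 n) * (\<Sum>i<j. (1 / 2) ^ i))" and d: "d \<in> D (n + j)"
    from x obtain s where s: "s \<in> support n" "s \<le> x" "x \<le> s + C / real (P 0 n) * (\<Sum>i<j. (1 / 2) ^ i)"
      by (auto simp: cover_def)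
    have "s \<le> x + offset (n + j) d" "x + offset (n + j) d \<le> s + C / real (P 0 n) * (\<Sum>i<Suc j. (1 / 2) ^ i)"
      using s offset_bounds[OF d] by (auto simp: distrib_left)
    then show "x + offset (n + j) d \<in> cover n (C / real (P 0 n) * (\<Sum>i<Suc j. (1 / 2) ^ i))"
      using s(1) by (auto simp: cover_def)
  qed
qed

text \<open>The cover is closed, so its complement is open and stays null in the weak limit. The
  radius 2 C / \<open>P 0 n\<close> bounds the sum of all later offsets.\<close>

lemma mu_cover: "measure \<mu> (- cover n (2 * C / real (P 0 n))) = 0"
proof -
  have "measure \<mu> (- cover n (2 * C / real (P 0 n))) \<le> 0"
  proof (rule weak_conv_open_le[OF real_distribution_moran mu_distr mu_limit, of _ n])
    show "open (- cover n (2 * C / real (P 0 n)))" using closed_cover by auto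
    fix m assume "m \<ge> n"
    interpret N: real_distribution "moran m" by (rule real_distribution_moran)
    have "C / real (P 0 n) * (\<Sum>i<m - n. (1 / 2) ^ i) \<le> C / real (P 0 n) * 2"
      using C_nonneg by (intro mult_left_mono geometric_le_2) auto
    then have "cover n (C / real (P 0 n) * (\<Sum>i<m - n. (1 / 2) ^ i)) \<subseteq> cover n (2 * C / real (P 0 n))"
      unfolding cover_def by (intro UN_mono) (auto simp: mult.commute)
    then have "measure (moran m) (cover n (C / real (P 0 n) * (\<Sum>i<m - n. (1 / 2) ^ i))) \<le> measure (moran m) (cover n (2 * C / real (P 0 n)))"
      by (intro N.finite_measure_mono) auto
    moreover have "measure (moran m) (cover n (C / real (P 0 n) * (\<Sum>i<m - n. (1 / 2) ^ i))) = 1"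
      using moran_cover[of n "m - n"] \<open>m \<ge> n\<close> by simp
    ultimately show "measure (moran m) (- cover n (2 * C / real (P 0 n))) \<le> 0"
      using N.prob_compl[of "cover n (2 * C / real (P 0 n))"] by (simp add: Compl_eq_Diff_UNIV)
  qed
  then show ?thesis by (simp add: measure_le_0_iff)
qed

lemma lborel_cover:
  assumes "r \<ge> 0"
  shows "emeasure lborel (cover n r) \<le> ennreal (real (Q n) * r)"
proof -
  have "emeasure lborel (cover n r) \<le> (\<Sum>s\<in>support n. emeasure lborel {s..s + r})"
    unfolding cover_def using finite_support by (intro emeasure_subadditive_finite) auto
  also have "\<dots> = ennreal (real (card (support n)) * r)"
    using assms by (simp add: ennreal_of_nat_eq_real_of_nat ennreal_mult)
  also have "\<dots> \<le> ennreal (real (Q n) * r)"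
    using card_support[of n] assms by (intro ennreal_leI mult_right_mono) auto
  finally show ?thesis .
qed

text \<open>With q = card D, a level with p > q contributes the factor q / p \<le> q / (q + 1) \<le>
  K / (K + 1), every other level at most 1. The bound K on the cardinalities keeps these factors
  away from 1.\<close>

lemma ratio_tendsto_0:
  assumes inf: "infinite {j. p j > card (D j)}"
  shows "(\<lambda>n. real (Q n) / real (P 0 n)) \<longlonglongrightarrow> 0"
proof -
  define \<theta> where "\<theta> = real K / (real K + 1)"
  have \<theta>: "0 < \<theta>" "\<theta> < 1" using K_ge2 by (auto simp: \<theta>_def)
  define c where "c n = card {j\<in>{..<n}. p j > card (D j)}" for n
  have cSuc: "c (Suc n) = (if p n > card (D n) then Suc (c n) else c n)" for n
  proof -
    have "{j\<in>{..<Suc n}. p j > card (D j)} = (if p n > card (D n) then insert n {j\<in>{..<n}. p j > card (D j)} else {j\<in>{..<n}. p j > card (D j)})"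
      by (auto simp: less_Suc_eq)
    then show ?thesis by (simp add: c_def)
  qed
  have bound: "real (Q n) / real (P 0 n) \<le> \<theta> ^ c n" for n
  proof (induction n)
    case 0
    then show ?case by (simp add: Q_def c_def)
  next
    case (Suc n)
    have step: "real (card (D n)) / real (p n) \<le> (if p n > card (D n) then \<theta> else 1)"
    proof (cases "p n > card (D n)")
      case True
      have "real (card (D n)) * (real K + 1) \<le> real K * real (p n)"
      proof -
        have "real K * (real (card (D n)) + 1) \<le> real K * real (p n)"
          using True by (intro mult_left_mono) auto
        then show ?thesis using card_le[of n] by (simp add: algebra_simps)
      qed
      then show ?thesis using True p_pos[of n] by (simp add: \<theta>_def field_simps)
    next
      case False
      then show ?thesis using hadamard_card_le[OF hadamard[of n]] p_pos[of n] by simp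
    qed
    have "real (Q (Suc n)) / real (P 0 (Suc n)) = (real (Q n) / real (P 0 n)) * (real (card (D n)) / real (p n))"
      by (simp add: Q_def P_Suc)
    also have "\<dots> \<le> \<theta> ^ c n * (if p n > card (D n) then \<theta> else 1)"
      using Suc step \<theta> by (intro mult_mono) auto
    also have "\<dots> = \<theta> ^ c (Suc n)" by (simp add: cSuc)
    finally show ?case .
  qed
  have "filterlim c at_top sequentially"
  proof (subst filterlim_at_top, intro allI)
    fix Z
    obtain B where B: "finite B" "card B = Z" "B \<subseteq> {j. p j > card (D j)}"
      using infinite_arbitrarily_large[OF inf] by blast
    obtain n0 where n0: "B \<subseteq> {..<n0}" using B(1) finite_nat_iff_bounded by blast
    show "\<forall>\<^sub>F n in sequentially. Z \<le> c n"
      using eventually_ge_at_top[of n0]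
    proof eventually_elim
      case (elim n)
      then have "B \<subseteq> {j\<in>{..<n}. p j > card (D j)}" using n0 B(3) by auto
      then have "card B \<le> c n" unfolding c_def by (intro card_mono) auto
      then show ?case using B by simp
    qed
  qed
  moreover have "(\<lambda>n. \<theta> ^ n) \<longlonglongrightarrow> 0" by (rule LIMSEQ_power_zero) (use \<theta> in simp)
  ultimately have "(\<lambda>n. \<theta> ^ c n) \<longlonglongrightarrow> 0" by (rule filterlim_compose[rotated])
  show ?thesis
  proof (rule tendsto_sandwich)
    show "\<forall>\<^sub>F n in sequentially. 0 \<le> real (Q n) / real (P 0 n)" by simp
    show "\<forall>\<^sub>F n in sequentially. real (Q n) / real (P 0 n) \<le> \<theta> ^ c n" using bound by simp
  qed (simp, fact)
qed

lemma mu_concentrated: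
  assumes inf: "infinite {j. p j > card (D j)}"
  shows "\<exists>A\<in>sets borel. emeasure lborel A = 0 \<and> emeasure \<mu> (space \<mu> - A) = 0"
proof (intro bexI conjI)
  define E where "E n = cover n (2 * C / real (P 0 n))" for n
  show meas: "(\<Inter>n. E n) \<in> sets borel" by (auto simp: E_def)
  have "emeasure lborel (\<Inter>n. E n) \<le> 0"
  proof (rule LIMSEQ_le_const)
    have "(\<lambda>n. 2 * C * (real (Q n) / real (P 0 n))) \<longlonglongrightarrow> 2 * C * 0"
      by (intro tendsto_intros ratio_tendsto_0 inf)
    then show "(\<lambda>n. ennreal (2 * C * (real (Q n) / real (P 0 n)))) \<longlonglongrightarrow> 0"
      using tendsto_ennrealI by fastforce
    show "\<exists>N. \<forall>n\<ge>N. emeasure lborel (\<Inter>n. E n) \<le> ennreal (2 * C * (real (Q n) / real (P 0 n)))"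
    proof (intro exI allI impI)
      fix n
      have "emeasure lborel (\<Inter>n. E n) \<le> emeasure lborel (E n)" by (rule emeasure_mono) (auto simp: E_def)
      also have "\<dots> \<le> ennreal (real (Q n) * (2 * C / real (P 0 n)))"
        unfolding E_def using C_nonneg by (intro lborel_cover) simp
      finally show "emeasure lborel (\<Inter>n. E n) \<le> ennreal (2 * C * (real (Q n) / real (P 0 n)))"
        by (simp add: mult_ac)
    qed
  qed
  then show "emeasure lborel (\<Inter>n. E n) = 0" by simp
  have "space \<mu> - (\<Inter>n. E n) = (\<Union>n. - E n)" by auto
  moreover have "emeasure \<mu> (\<Union>n. - E n) = 0"
  proof (rule emeasure_UN_eq_0)
    show "emeasure \<mu> (- E n) = 0" for n using mu_cover[of n] by (simp add: E_def emeasure_eq_measure)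
    show "range (\<lambda>n. - E n) \<subseteq> sets \<mu>" by (auto simp: E_def)
  qed
  ultimately show "emeasure \<mu> (space \<mu> - (\<Inter>n. E n)) = 0" by simp
qed

text \<open>If only finitely many levels have p > card D, a Lebesgue-null set carrying the measure
  would be null for it, against total mass 1.\<close>

lemma singularly_continuous_iff: "singularly_continuous \<mu> \<longleftrightarrow> infinite {j. p j > card (D j)}"
proof
  show "singularly_continuous \<mu>" if "infinite {j. p j > card (D j)}"
    unfolding singularly_continuous_def using mu_no_atoms mu_concentrated[OF that] by blast
  show "infinite {j. p j > card (D j)}" if sc: "singularly_continuous \<mu>"
  proof
    assume fin: "finite {j. p j > card (D j)}"
    obtain A where A: "A \<in> sets borel" "emeasure lborel A = 0" "emeasure \<mu> (space \<mu> - A) = 0"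
      using sc by (auto simp: singularly_continuous_def)
    have "emeasure \<mu> (space \<mu>) = emeasure \<mu> A + emeasure \<mu> (space \<mu> - A)"
      using A by (subst plus_emeasure) auto
    then show False
      using mu_absolutely_continuous[OF fin A(1,2)] A(3) emeasure_space_1 by simp
  qed
qed

end

theorem theorem2p2:
  fixes p :: "nat \<Rightarrow> nat" and D L :: "nat \<Rightarrow> int set" and \<mu> :: "real measure"
  assumes hadamard: "\<And>n. hadamard_triple (p n) (D n) (L n)"
    and p_gt1: "\<And>n. p n > 1"
    and zero_in: "\<And>n. 0 \<in> D n"
    and nonneg: "\<And>n. D n \<subseteq> {0..}"
    and card_ge2: "\<And>n. card (D n) \<ge> 2"
    and bdd_digits: "\<exists>C. \<forall>n. \<forall>d\<in>D n. real_of_int d / real (p n) \<le> C"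
    and bdd_card: "\<exists>K. \<forall>n. card (D n) \<le> K"
    and mu_distr: "real_distribution \<mu>"
    and mu_limit: "weak_conv_m (moran_partial p D) \<mu>"
  shows "(singularly_continuous \<mu> \<longleftrightarrow> infinite {j. p j > card (D j)})
       \<and> (infinite {j. p j > card (D j)} \<longleftrightarrow> infinite {j. DPC (p j) (D j)})
       \<and> (singularly_continuous \<mu> \<longrightarrow> spectral \<mu>)"
proof -
  obtain C where C: "\<forall>n. \<forall>d\<in>D n. real_of_int d / real (p n) \<le> C" using bdd_digits by blast
  obtain K where K: "\<forall>n. card (D n) \<le> K" using bdd_card by blast
  interpret cantor_moran p D L C K \<mu>
  proof (intro cantor_moran.intro hadamard_sequence.intro cantor_moran_axioms.intro)
    show "real_of_int d / real (p n) \<le> C" if "d \<in> D n" for d n using C that by blast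
    show "card (D n) \<le> K" for n using K by blast
  qed (fact hadamard zero_in nonneg card_ge2 mu_distr mu_limit)+
  have "DPC (p j) (D j) \<longleftrightarrow> p j > card (D j)" for j
    using hadamard_DPC_iff[OF hadamard[of j]] zero_in[of j] by blast
  then show ?thesis
    using singularly_continuous_iff mu_spectral by simp
qed

end
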